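(* Let $k$ be an algebraically closed field of characteristic $p>0$. Let $g:D\to E$ be an isogeny of $p$-divisible groups over $k$ such that the kernel of $g$ is annihilated by $p$. Then $|b_D-b_E|\leq 1$.
   Context: The isogeny cutoff $b_D$ of a $p$-divisible group $D$ over $k$ is the smallest non-negative integer $m$ such that every $p$-divisible group $D'$ over $k$ with $D'[p^m]\cong D[p^m]$ is isogenous to $D$. *)

theory Defs
  imports
    "HOL-Computational_Algebra.Computational_Algebra"
    "Jordan_Normal_Form.Matrix"
begin

text \<open>
  A finite commutative group scheme over a field \<open>k\<close> is \<open>G = Spec A\<close> for a finite-dimensional
  commutative and cocommutative Hopf algebra \<open>A\<close> over \<open>k\<close>. Choosing a basis, \<open>A = k\<^sup>n\<close>, and every
  structure map is a matrix acting on column vectors; \<open>A \<otimes> A\<close> is \<open>k\<^bsup>n * n\<^esup>\<close> with basis vector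
  \<open>e\<^sub>i \<otimes> e\<^sub>j\<close> at position \<open>i * n + j\<close>. With this numbering the Kronecker product of matrices is the
  tensor product of linear maps, and it is strictly associative and unital. Every finite commutative
  group scheme over \<open>k\<close> is isomorphic to one of this form, so quantifying over these objects
  quantifies over all of them.
\<close>

definition kron :: "'k::semiring_1 mat \<Rightarrow> 'k mat \<Rightarrow> 'k mat" (infixr "\<otimes>\<^sub>m" 75) where
  "A \<otimes>\<^sub>m B = mat (dim_row A * dim_row B) (dim_col A * dim_col B)
     (\<lambda>(i, j). A $$ (i div dim_row B, j div dim_col B) * B $$ (i mod dim_row B, j mod dim_col B))"

text \<open>The flip \<open>x \<otimes> y \<mapsto> y \<otimes> x\<close> on \<open>k\<^sup>n \<otimes> k\<^sup>n\<close>.\<close>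

definition flip_mat :: "nat \<Rightarrow> 'k::semiring_1 mat" where
  "flip_mat n = mat (n * n) (n * n)
     (\<lambda>(i, j). if i div n = j mod n \<and> i mod n = j div n then 1 else 0)"

record 'k hopf =
  order :: nat
  mult :: "'k mat"
  unit :: "'k mat"
  comult :: "'k mat"
  counit :: "'k mat"
  antipode :: "'k mat"

definition finite_comm_group_scheme :: "'k::field hopf \<Rightarrow> bool" where
  "finite_comm_group_scheme G \<longleftrightarrow>
    (let n = order G; m = mult G; u = unit G; \<Delta> = comult G; \<epsilon> = counit G; S = antipode G;
         I = 1\<^sub>m n; \<tau> = flip_mat n
     in m \<in> carrier_mat n (n * n) \<and> u \<in> carrier_mat n 1 \<and>
        \<Delta> \<in> carrier_mat (n * n) n \<and> \<epsilon> \<in> carrier_mat 1 n \<and> S \<in> carrier_mat n n \<and>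
        \<comment> \<open>commutative algebra\<close>
        m * (m \<otimes>\<^sub>m I) = m * (I \<otimes>\<^sub>m m) \<and> m * (u \<otimes>\<^sub>m I) = I \<and> m * (I \<otimes>\<^sub>m u) = I \<and> m * \<tau> = m \<and>
        \<comment> \<open>cocommutative coalgebra\<close>
        (\<Delta> \<otimes>\<^sub>m I) * \<Delta> = (I \<otimes>\<^sub>m \<Delta>) * \<Delta> \<and> (\<epsilon> \<otimes>\<^sub>m I) * \<Delta> = I \<and> (I \<otimes>\<^sub>m \<epsilon>) * \<Delta> = I \<and> \<tau> * \<Delta> = \<Delta> \<and>
        \<comment> \<open>comultiplication and counit are algebra maps\<close>
        \<Delta> * m = (m \<otimes>\<^sub>m m) * (I \<otimes>\<^sub>m \<tau> \<otimes>\<^sub>m I) * (\<Delta> \<otimes>\<^sub>m \<Delta>) \<and> \<Delta> * u = u \<otimes>\<^sub>m u \<and>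
        \<epsilon> * m = \<epsilon> \<otimes>\<^sub>m \<epsilon> \<and> \<epsilon> * u = 1\<^sub>m 1 \<and>
        \<comment> \<open>antipode\<close>
        m * (S \<otimes>\<^sub>m I) * \<Delta> = u * \<epsilon> \<and> m * (I \<otimes>\<^sub>m S) * \<Delta> = u * \<epsilon>)"

text \<open>
  A homomorphism \<open>f : G \<rightarrow> H\<close> is given by the matrix of its comorphism \<open>f\<^sup>* : \<O>(H) \<rightarrow> \<O>(G)\<close>, a map of
  bialgebras (compatibility with the antipodes is then automatic). Passing to comorphisms reverses
  the order of composition.
\<close>

definition gs_hom :: "'k::field hopf \<Rightarrow> 'k hopf \<Rightarrow> 'k mat set" where
  "gs_hom G H = {f \<in> carrier_mat (order G) (order H).
     f * mult H = mult G * (f \<otimes>\<^sub>m f) \<and> f * unit H = unit G \<and>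
     comult G * f = (f \<otimes>\<^sub>m f) * comult H \<and> counit G * f = counit H}"

definition gs_comp :: "'k::field mat \<Rightarrow> 'k mat \<Rightarrow> 'k mat" (infixl "\<circ>\<^sub>g" 70) where
  "g \<circ>\<^sub>g f = f * g"

definition gs_id :: "'k::field hopf \<Rightarrow> 'k mat" where
  "gs_id G = 1\<^sub>m (order G)"

definition gs_zero :: "'k::field hopf \<Rightarrow> 'k hopf \<Rightarrow> 'k mat" where
  "gs_zero G H = unit G * counit H"

text \<open>Multiplication by \<open>n\<close> on \<open>G\<close>; the sum of \<open>f, g : G \<rightarrow> H\<close> has comorphism
  \<open>mult G * (f \<otimes>\<^sub>m g) * comult H\<close>.\<close>

primrec gs_times :: "'k::field hopf \<Rightarrow> nat \<Rightarrow> 'k mat" where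
  "gs_times G 0 = gs_zero G G"
| "gs_times G (Suc n) = mult G * (gs_id G \<otimes>\<^sub>m gs_times G n) * comult G"

definition gs_isomorphic :: "'k::field hopf \<Rightarrow> 'k hopf \<Rightarrow> bool" (infix "\<cong>\<^sub>g" 50) where
  "G \<cong>\<^sub>g H \<longleftrightarrow> (\<exists>f \<in> gs_hom G H. \<exists>g \<in> gs_hom H G. g \<circ>\<^sub>g f = gs_id G \<and> f \<circ>\<^sub>g g = gs_id H)"

text \<open>\<open>\<iota> : K \<rightarrow> G\<close> is a kernel of \<open>f : G \<rightarrow> H\<close>. The scheme-theoretic kernel of a homomorphism of finite
  commutative group schemes is again one, so it suffices to test against such \<open>T\<close>.\<close>

definition is_kernel ::
  "'k::field hopf \<Rightarrow> 'k mat \<Rightarrow> 'k hopf \<Rightarrow> 'k hopf \<Rightarrow> 'k mat \<Rightarrow> bool" where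
  "is_kernel K \<iota> G H f \<longleftrightarrow>
     finite_comm_group_scheme K \<and> \<iota> \<in> gs_hom K G \<and> f \<circ>\<^sub>g \<iota> = gs_zero K H \<and>
     (\<forall>T t. finite_comm_group_scheme T \<and> t \<in> gs_hom T G \<and> f \<circ>\<^sub>g t = gs_zero T H \<longrightarrow>
        (\<exists>!s. s \<in> gs_hom T K \<and> \<iota> \<circ>\<^sub>g s = t))"

text \<open>
  \<open>p\<close>-divisible groups as defined by Tate: an inductive system \<open>D[p\<^sup>0] \<rightarrow> D[p\<^sup>1] \<rightarrow> D[p\<^sup>2] \<rightarrow> \<dots>\<close> of finite
  commutative group schemes such that, for some \<open>h\<close> (the height), \<open>D[p\<^sup>n]\<close> has order \<open>p\<^bsup>h * n\<^esup>\<close> and the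
  transition map identifies \<open>D[p\<^sup>n]\<close> with the kernel of \<open>p\<^sup>n\<close> on \<open>D[p\<^bsup>n+1\<^esup>]\<close>.
\<close>

record 'k pdiv =
  torsion :: "nat \<Rightarrow> 'k hopf"  \<comment> \<open>\<open>torsion D n\<close> is \<open>D[p\<^sup>n]\<close>\<close>
  incl :: "nat \<Rightarrow> 'k mat"  \<comment> \<open>\<open>incl D n : D[p\<^sup>n] \<rightarrow> D[p\<^bsup>n+1\<^esup>]\<close>\<close>

definition p_divisible_group :: "nat \<Rightarrow> 'k::field pdiv \<Rightarrow> bool" where
  "p_divisible_group p D \<longleftrightarrow>
     (\<forall>n. finite_comm_group_scheme (torsion D n)) \<and>
     (\<exists>h. \<forall>n. order (torsion D n) = p ^ (h * n)) \<and>
     (\<forall>n. is_kernel (torsion D n) (incl D n) (torsion D (Suc n)) (torsion D (Suc n))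
            (gs_times (torsion D (Suc n)) (p ^ n)))"

text \<open>The inclusion \<open>D[p\<^sup>n] \<rightarrow> D[p\<^bsup>n+r\<^esup>]\<close>.\<close>

primrec incl_iter :: "'k::field pdiv \<Rightarrow> nat \<Rightarrow> nat \<Rightarrow> 'k mat" where
  "incl_iter D n 0 = gs_id (torsion D n)"
| "incl_iter D n (Suc r) = incl D (n + r) \<circ>\<^sub>g incl_iter D n r"

definition pdiv_hom :: "'k::field pdiv \<Rightarrow> 'k pdiv \<Rightarrow> (nat \<Rightarrow> 'k mat) set" where
  "pdiv_hom D E = {g. \<forall>n. g n \<in> gs_hom (torsion D n) (torsion E n) \<and>
                          g (Suc n) \<circ>\<^sub>g incl D n = incl E n \<circ>\<^sub>g g n}"

text \<open>The finite group scheme \<open>K\<close>, embedded by \<open>\<kappa> : K \<rightarrow> D[p\<^sup>n]\<close>, is the kernel of \<open>g : D \<rightarrow> E\<close>: it is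
  the kernel of \<open>g\<close> on \<open>D[p\<^bsup>n+r\<^esup>]\<close> for every \<open>r\<close>.\<close>

definition finite_kernel ::
  "'k::field pdiv \<Rightarrow> 'k pdiv \<Rightarrow> (nat \<Rightarrow> 'k mat) \<Rightarrow> 'k hopf \<Rightarrow> nat \<Rightarrow> 'k mat \<Rightarrow> bool" where
  "finite_kernel D E g K n \<kappa> \<longleftrightarrow> \<kappa> \<in> gs_hom K (torsion D n) \<and>
     (\<forall>r. is_kernel K (incl_iter D n r \<circ>\<^sub>g \<kappa>) (torsion D (n + r)) (torsion E (n + r)) (g (n + r)))"

text \<open>
  Surjectivity of \<open>g : D \<rightarrow> E\<close> as a map of fppf sheaves: each \<open>E[p\<^sup>n]\<close> is contained in the image of
  \<open>D[p\<^bsup>n+r\<^esup>]\<close> for some \<open>r\<close>. The image of \<open>g\<close> on \<open>D[p\<^bsup>n+r\<^esup>]\<close> is the closed subgroup scheme of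
  \<open>E[p\<^bsup>n+r\<^esup>]\<close> cut out by the kernel of the comorphism \<open>g\<^sup>*\<close>, so containment of closed subschemes is
  the reverse containment of ideals. Level by level surjectivity \<open>D[p\<^sup>n] \<rightarrow> E[p\<^sup>n]\<close> would be wrong: it
  fails for multiplication by \<open>p\<close>.
\<close>

definition pdiv_surj :: "'k::field pdiv \<Rightarrow> 'k pdiv \<Rightarrow> (nat \<Rightarrow> 'k mat) \<Rightarrow> bool" where
  "pdiv_surj D E g \<longleftrightarrow>
     (\<forall>n. \<exists>r. \<forall>x \<in> carrier_vec (order (torsion E (n + r))).
        g (n + r) *\<^sub>v x = 0\<^sub>v (order (torsion D (n + r))) \<longrightarrow>
        incl_iter E n r *\<^sub>v x = 0\<^sub>v (order (torsion E n)))"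

definition isogeny :: "'k::field pdiv \<Rightarrow> 'k pdiv \<Rightarrow> (nat \<Rightarrow> 'k mat) \<Rightarrow> bool" where
  "isogeny D E g \<longleftrightarrow> g \<in> pdiv_hom D E \<and> pdiv_surj D E g \<and> (\<exists>K n \<kappa>. finite_kernel D E g K n \<kappa>)"

definition isogenous :: "'k::field pdiv \<Rightarrow> 'k pdiv \<Rightarrow> bool" where
  "isogenous D E \<longleftrightarrow> (\<exists>g. isogeny D E g)"

definition isogeny_cutoff :: "nat \<Rightarrow> 'k::field pdiv \<Rightarrow> nat" where
  "isogeny_cutoff p D = (LEAST m. \<forall>D'. p_divisible_group p D' \<and> torsion D' m \<cong>\<^sub>g torsion D m \<longrightarrow>
     isogenous D' D)"

end

theory Submission
  imports Defs "Jordan_Normal_Form.Char_Poly"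
begin

text \<open>
  If \<open>D'[p\<^bsup>m+1\<^esup>]\<close> is isomorphic to \<open>D[p\<^bsup>m+1\<^esup>]\<close>, the kernel \<open>K \<subseteq> D[p]\<close> of \<open>g\<close> is carried to a subgroup
  \<open>K' \<subseteq> D'[p]\<close>, and \<open>E' = D'/K'\<close> satisfies \<open>E'[p\<^sup>m] \<cong> E[p\<^sup>m]\<close>, because \<open>E[p\<^sup>m]\<close> is the quotient of
  \<open>{x \<in> D[p\<^bsup>m+1\<^esup>]. p\<^sup>m x \<in> K}\<close> by \<open>K\<close>. If \<open>m\<close> bounds the cutoff of \<open>E\<close>, then \<open>D' \<sim> E' \<sim> E \<sim> D\<close>, so \<open>m + 1\<close>
  bounds the cutoff of \<open>D\<close>. Since \<open>g\<close> factors multiplication by \<open>p\<close>, there is an isogeny \<open>E \<rightarrow> D\<close> whose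
  kernel \<open>D[p]/K\<close> is again annihilated by \<open>p\<close>, which gives the other inequality.

  That \<open>E'\<close> is a \<open>p\<close>-divisible group rests on the multiplicativity of the order in short exact
  sequences \<open>K \<rightarrow> G \<rightarrow> H\<close>. With \<open>A = \<O>(G) \<supseteq> B = \<O>(H)\<close> and \<open>C = \<O>(K)\<close>, every fibre of \<open>A\<close> over a
  point of \<open>B\<close> has dimension \<open>c = dim C\<close> by translation, so \<open>dim (A \<otimes>\<^sub>B M) \<le> c * dim M\<close> for all
  \<open>B\<close>-modules \<open>M\<close>. The case \<open>M = B\<close> gives \<open>dim A \<le> c * dim B\<close>. As \<open>A \<otimes>\<^sub>B A\<close> surjects onto \<open>A \<otimes> C\<close>,
  the bound for \<open>M = A/B\<close> gives \<open>c * dim A \<le> dim A + c * (dim A - dim B)\<close>, the reverse inequality.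
\<close>

section \<open>Kronecker products\<close>

text \<open>An epimorphism of group schemes need not be onto on \<open>T\<close>-points, so
  surjectivity cannot be tested by lifting maps from test objects. Kernels and embeddings are
  therefore checked on test maps, while surjectivity is mostly deduced by comparing orders. This is
  why multiplicativity of the order, rather than formal exactness, carries the argument. No tensor
  product over a subalgebra is ever formed. Its dual is realised as a space of balanced row vectors,
  and an upper bound on its dimension is given by a matrix with that many columns annihilating no
  nonzero element of the space. Antipodes are a second obstacle: a quotient bialgebra does not
  visibly inherit one. What passes to quotients directly is invertibility of the shear
  \<open>(g, h) -> (g, g h)\<close>, whose comorphism is \<open>\<Psi>\<close>; the antipode is read
  off from its inverse.\<close>

lemma mat_assoc:
  "dim_col A = dim_row B \<Longrightarrow> dim_col B = dim_row C \<Longrightarrow> (A * B) * C = A * (B * (C :: 'a :: semiring_0 mat))"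
  by (rule assoc_mult_mat[of _ "dim_row A" "dim_col A" _ "dim_col B" _ "dim_col C"]) auto

text \<open>Side conditions are phrased as equations between dimensions rather than carrier
  memberships, so that the simplifier can discharge them from its dimension rules.\<close>

lemma mult_one_right [simp]: "dim_col A = n \<Longrightarrow> A * 1\<^sub>m n = (A :: 'a :: semiring_1 mat)"
  by (rule right_mult_one_mat') auto

lemma mult_one_left [simp]: "dim_row A = n \<Longrightarrow> 1\<^sub>m n * A = (A :: 'a :: semiring_1 mat)"
  by (rule left_mult_one_mat') auto

lemma mat_mult_index: "i < dim_row A \<Longrightarrow> j < dim_col B \<Longrightarrow> dim_col A = dim_row B \<Longrightarrow>
   (A * B) $$ (i, j) = (\<Sum>k = 0..<dim_row B. A $$ (i, k) * B $$ (k, j))"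
  by (simp add: scalar_prod_def)

lemma kron_dim [simp]:
  "dim_row (A \<otimes>\<^sub>m B) = dim_row A * dim_row B" "dim_col (A \<otimes>\<^sub>m B) = dim_col A * dim_col B"
  by (simp_all add: kron_def)

lemma kron_index:
  "i < dim_row A * dim_row B \<Longrightarrow> j < dim_col A * dim_col B \<Longrightarrow>
   (A \<otimes>\<^sub>m B) $$ (i, j) = A $$ (i div dim_row B, j div dim_col B) * B $$ (i mod dim_row B, j mod dim_col B)"
  by (simp add: kron_def)

lemma div_less_mult: "i < n * m \<Longrightarrow> i div m < (n :: nat)"
  by (simp add: less_mult_imp_div_less)

lemma mod_less_mult: "i < n * m \<Longrightarrow> i mod m < (m :: nat)"
  by (cases m) auto

text \<open>A position below \<open>n * m\<close> is a pair of digits, \<open>k div m\<close> and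
  \<open>k mod m\<close>. This turns the inner index of a product of Kronecker products into a
  double sum.\<close>

lemma sum_div_mod:
  "(\<Sum>k = 0..<n * m. g (k div m) (k mod m)) = (\<Sum>a = 0..<n. \<Sum>b = 0..<m. g a (b :: nat))"
proof (cases "m = 0")
  case False
  have "(\<Sum>k = 0..<n * m. g (k div m) (k mod m)) = (\<Sum>(a, b) \<in> {0..<n} \<times> {0..<m}. g a b)"
  proof (rule sum.reindex_bij_witness[where i = "\<lambda>(a, b). a * m + b" and j = "\<lambda>k. (k div m, k mod m)"], goal_cases)
    case (4 x)
    then obtain a b where x: "x = (a, b)" "a < n" "b < m" by auto
    have "a * m + b < Suc a * m" using x by simp
    also have "\<dots> \<le> n * m" using x by (intro mult_right_mono) auto
    finally show ?case using x by simp
  qed (use False in \<open>auto simp: div_less_mult mod_less_mult\<close>)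
  thus ?thesis by (simp add: sum.cartesian_product)
qed simp

lemma kron_mult:
  fixes A B C D :: "'a :: comm_semiring_1 mat"
  assumes "dim_col A = dim_row C" "dim_col B = dim_row D"
  shows "(A \<otimes>\<^sub>m B) * (C \<otimes>\<^sub>m D) = (A * C) \<otimes>\<^sub>m (B * D)"
proof (rule eq_matI, goal_cases)
  case (1 i j)
  hence i: "i < dim_row A * dim_row B" and j: "j < dim_col C * dim_col D" by auto
  note dm = div_less_mult[OF i] mod_less_mult[OF i] div_less_mult[OF j] mod_less_mult[OF j]
  let ?f = "\<lambda>a b. A $$ (i div dim_row B, a) * C $$ (a, j div dim_col D) *
                  (B $$ (i mod dim_row B, b) * D $$ (b, j mod dim_col D))"
  have "((A \<otimes>\<^sub>m B) * (C \<otimes>\<^sub>m D)) $$ (i, j) =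
     (\<Sum>k = 0..<dim_row C * dim_row D. (A \<otimes>\<^sub>m B) $$ (i, k) * (C \<otimes>\<^sub>m D) $$ (k, j))"
    using i j assms by (simp add: mat_mult_index del: index_mult_mat(1))
  also have "\<dots> = (\<Sum>k = 0..<dim_row C * dim_row D. ?f (k div dim_row D) (k mod dim_row D))"
    using i j assms by (intro sum.cong) (auto simp: kron_index mult_ac)
  also have "\<dots> = (\<Sum>a = 0..<dim_row C. \<Sum>b = 0..<dim_row D. ?f a b)" by (rule sum_div_mod)
  also have "\<dots> = ((A * C) \<otimes>\<^sub>m (B * D)) $$ (i, j)"
    using i j dm assms by (simp add: kron_index mat_mult_index sum_product del: index_mult_mat(1))
  finally show ?case .
qed auto

lemma kron_assoc: "(A \<otimes>\<^sub>m B) \<otimes>\<^sub>m C = A \<otimes>\<^sub>m (B \<otimes>\<^sub>m (C :: 'a :: comm_semiring_1 mat))"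
proof (rule eq_matI, goal_cases)
  case (1 i j)
  hence i: "i < dim_row A * dim_row B * dim_row C" and j: "j < dim_col A * dim_col B * dim_col C"
    by (auto simp: mult_ac)
  note dm = div_less_mult[OF i] mod_less_mult[OF i] div_less_mult[OF j] mod_less_mult[OF j]
  have i': "i < dim_row A * (dim_row B * dim_row C)" and j': "j < dim_col A * (dim_col B * dim_col C)"
    using i j by (auto simp: mult_ac)
  note dm' = mod_less_mult[OF i'] mod_less_mult[OF j'] 
  \<comment> \<open>Both bracketings read the same three mixed-radix digits of a position; these
    identities compare the two ways of extracting them.\<close>
  have q: "i div c mod b = i mod (b * c) div c" "i div c div b = i div (b * c)" "i mod (b * c) mod c = i mod c"
    for i b c :: nat
    by (simp_all add: mod_mult2_eq mult.commute[of b c] div_mult2_eq)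
       (cases "c = 0"; simp add: mod_mult2_eq div_mult2_eq)
  show ?case
    using i j i' j' dm dm' by (simp add: kron_index q mult_ac)
qed (auto simp: mult_ac)

lemma kron_one: "1\<^sub>m n \<otimes>\<^sub>m 1\<^sub>m m = (1\<^sub>m (n * m) :: 'a :: semiring_1 mat)"
proof (rule eq_matI, goal_cases)
  case (1 i j)
  have "i = j \<longleftrightarrow> i div m = j div m \<and> i mod m = j mod m"
    by (metis div_mult_mod_eq)
  thus ?case using 1 by (auto simp: kron_index div_less_mult mod_less_mult)
qed auto

lemma kron_one1 [simp]: "1\<^sub>m 1 \<otimes>\<^sub>m A = (A :: 'a :: semiring_1 mat)" "A \<otimes>\<^sub>m 1\<^sub>m 1 = A"
  "1\<^sub>m (Suc 0) \<otimes>\<^sub>m A = A" "A \<otimes>\<^sub>m 1\<^sub>m (Suc 0) = A"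
  by (rule eq_matI; simp add: kron_index)+

lemma kron_transpose: "(A \<otimes>\<^sub>m B)\<^sup>T = A\<^sup>T \<otimes>\<^sub>m B\<^sup>T"
  by (rule eq_matI) (auto simp: kron_index div_less_mult mod_less_mult)

lemma kron_add_left:
  fixes A :: "'a :: comm_ring_1 mat"
  assumes "dim_row A = dim_row B" "dim_col A = dim_col B"
  shows "(A + B) \<otimes>\<^sub>m C = A \<otimes>\<^sub>m C + B \<otimes>\<^sub>m C" "C \<otimes>\<^sub>m (A + B) = C \<otimes>\<^sub>m A + C \<otimes>\<^sub>m B"
    "(A - B) \<otimes>\<^sub>m C = A \<otimes>\<^sub>m C - B \<otimes>\<^sub>m C" "C \<otimes>\<^sub>m (A - B) = C \<otimes>\<^sub>m A - C \<otimes>\<^sub>m B"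
  by (rule eq_matI; use assms in \<open>simp add: kron_index div_less_mult mod_less_mult ring_distribs\<close>)+

lemma kron_zero [simp]: "0\<^sub>m a b \<otimes>\<^sub>m C = (0\<^sub>m (a * dim_row C) (b * dim_col C) :: 'a :: semiring_1 mat)"
  "C \<otimes>\<^sub>m 0\<^sub>m a b = (0\<^sub>m (dim_row C * a) (dim_col C * b) :: 'a :: semiring_1 mat)"
  by (rule eq_matI; simp add: kron_index div_less_mult mod_less_mult)+

text \<open>The flip \<open>k\<^sup>n \<otimes> k\<^sup>m \<rightarrow> k\<^sup>m \<otimes> k\<^sup>n\<close>, whose square instances are the matrices \<^const>\<open>flip_mat\<close>.\<close>

definition swap :: "nat \<Rightarrow> nat \<Rightarrow> 'a :: semiring_1 mat" where
  "swap n m = mat (m * n) (n * m) (\<lambda>(i, j). if i div n = j mod m \<and> i mod n = j div m then 1 else 0)"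

lemma swap_dim [simp]: "dim_row (swap n m) = m * n" "dim_col (swap n m) = n * m"
  by (simp_all add: swap_def)

lemma flip_mat_swap: "flip_mat n = swap n n"
  by (simp add: flip_mat_def swap_def)

lemma swap_one: "swap 1 n = (1\<^sub>m n :: 'a :: semiring_1 mat)" "swap n 1 = (1\<^sub>m n :: 'a :: semiring_1 mat)"
  by (rule eq_matI; auto simp: swap_def)+

lemmas [simp] = swap_one swap_one[unfolded One_nat_def]

lemma swap_flip: "swap m n = (swap n m :: 'a :: semiring_1 mat)\<^sup>T"
  by (rule eq_matI) (auto simp: swap_def)

text \<open>Solved for the column index, the definition shows one nonzero entry per row, so that
  multiplying by a flip merely permutes rows.\<close>

lemma swap_entry: "i < m * n \<Longrightarrow> j < n * m \<Longrightarrow>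
   swap n m $$ (i, j) = (if j = i mod n * m + i div n then 1 else (0 :: 'a :: semiring_1))"
proof -
  assume ij: "i < m * n" "j < n * m"
  have "i div n < m" "m > 0" using ij by (auto simp: div_less_mult intro: gr0I)
  hence "(i div n = j mod m \<and> i mod n = j div m) = (j = i mod n * m + i div n)"
    by (metis add.commute add_cancel_left_right div_less div_mult_mod_eq div_mult_self1 less_not_refl mod_less mod_mult_self1)
  thus ?thesis using ij by (simp add: swap_def)
qed

lemma swap_mult: "dim_row A = n * m \<Longrightarrow> i < m * n \<Longrightarrow> j < dim_col A \<Longrightarrow>
   (swap n m * A) $$ (i, j) = (A :: 'a :: semiring_1 mat) $$ (i mod n * m + i div n, j)"
proof -
  assume a: "dim_row A = n * m" "i < m * n" "j < dim_col A"
  have "i mod n * m + i div n < Suc (i mod n) * m" using a by (simp add: div_less_mult)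
  also have "\<dots> \<le> n * m" using mod_less_mult[OF a(2)] by (intro mult_right_mono) auto
  finally have k: "i mod n * m + i div n < n * m" .
  have "(swap n m * A) $$ (i, j) = (\<Sum>k = 0..<n * m. swap n m $$ (i, k) * A $$ (k, j))"
    using a by (simp add: mat_mult_index del: index_mult_mat(1))
  also have "\<dots> = (\<Sum>k = 0..<n * m. if i mod n * m + i div n = k then A $$ (k, j) else 0)"
    using a by (intro sum.cong) (auto simp: swap_entry)
  finally show ?thesis using k by simp
qed

lemma swap_kron:
  fixes A B :: "'a :: comm_semiring_1 mat"
  shows "swap (dim_row A) (dim_row B) * (A \<otimes>\<^sub>m B) = (B \<otimes>\<^sub>m A) * swap (dim_col A) (dim_col B)"
    (is "?L = ?R")
proof -
  have key: "(swap (dim_row A) (dim_row B) * (A \<otimes>\<^sub>m B)) $$ (i, j) =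
     B $$ (i div dim_row A, j mod dim_col B) * A $$ (i mod dim_row A, j div dim_col B)"
    if ij: "i < dim_row B * dim_row A" "j < dim_col A * dim_col B" for A B :: "'a mat" and i j
  proof -
    let ?k = "i mod dim_row A * dim_row B + i div dim_row A"
    have d: "i div dim_row A < dim_row B" using ij by (simp add: div_less_mult)
    have "?k < Suc (i mod dim_row A) * dim_row B" using d by simp
    also have "\<dots> \<le> dim_row A * dim_row B" using mod_less_mult[OF ij(1)] by (intro mult_right_mono) auto
    finally have "?k < dim_row A * dim_row B" .
    moreover have "?k div dim_row B = i mod dim_row A" "?k mod dim_row B = i div dim_row A"
      using d by auto
    ultimately show ?thesis using ij by (simp add: swap_mult kron_index mult.commute del: index_mult_mat(1))
  qed
  \<comment> \<open>Transposition moves the flip from the right to the left, so \<open>key\<close>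
    evaluates both sides of the equation.\<close>
  have R: "?R\<^sup>T = swap (dim_row B\<^sup>T) (dim_row A\<^sup>T) * (B\<^sup>T \<otimes>\<^sub>m A\<^sup>T)"
    by (subst transpose_mult[of _ "dim_row B * dim_row A" "dim_col B * dim_col A"])
       (auto simp: kron_transpose swap_flip[symmetric] mult.commute)
  show ?thesis
  proof (rule eq_matI, goal_cases)
    case (1 i j)
    hence ij: "i < dim_row B * dim_row A" "j < dim_col A * dim_col B" by auto
    have "?R $$ (i, j) = ?R\<^sup>T $$ (j, i)" using ij by (simp del: index_mult_mat(1))
    also have "\<dots> = A\<^sup>T $$ (j div dim_row B\<^sup>T, i mod dim_col A\<^sup>T) * B\<^sup>T $$ (j mod dim_row B\<^sup>T, i div dim_col A\<^sup>T)"
      unfolding R by (rule key) (use ij in auto)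
    also have "\<dots> = ?L $$ (i, j)"
      using ij mod_less_mult[OF ij(1)] div_less_mult[OF ij(1)] mod_less_mult[OF ij(2)] div_less_mult[OF ij(2)]
      by (simp add: key div_less_mult mod_less_mult mult.commute del: index_mult_mat(1))
    finally show ?case by simp
  qed auto
qed

section \<open>Linear algebra with matrices\<close>

lemma mat_minus_distrib:
  fixes A :: "'a :: comm_ring_1 mat"
  shows "dim_row A = dim_row B \<Longrightarrow> dim_col A = dim_col B \<Longrightarrow> dim_col B = dim_row C \<Longrightarrow> (A - B) * C = A * C - B * C"
    "dim_col C = dim_row A \<Longrightarrow> dim_row A = dim_row B \<Longrightarrow> dim_col A = dim_col B \<Longrightarrow> C * (A - B) = C * A - C * B"
    "dim_row A = dim_row B \<Longrightarrow> dim_col A = dim_col B \<Longrightarrow> dim_col B = dim_row C \<Longrightarrow> (A + B) * C = A * C + B * C"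
    "dim_col C = dim_row A \<Longrightarrow> dim_row A = dim_row B \<Longrightarrow> dim_col A = dim_col B \<Longrightarrow> C * (A + B) = C * A + C * B"
  by (rule minus_mult_distrib_mat mult_minus_distrib_mat add_mult_distrib_mat mult_add_distrib_mat; force)+

text \<open>Products are normalised to nest on the right, which hides a known product
  \<open>A * B\<close> whenever another factor follows. This form lets the equation rewrite
  there.\<close>

lemma mult_pull:
  "A * B = C \<Longrightarrow> dim_col A = dim_row B \<Longrightarrow> dim_col B = dim_row X \<Longrightarrow> A * (B * X) = C * (X :: 'a :: semiring_0 mat)"
  using mat_assoc[of A B X] by simp

lemma mat_transpose_mult:
  "dim_col A = dim_row B \<Longrightarrow> (A * B)\<^sup>T = B\<^sup>T * (A :: 'a :: comm_semiring_0 mat)\<^sup>T"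
  by (rule transpose_mult[of _ "dim_row A" "dim_col A" _ "dim_col B"]) auto

lemma mat_zero_mult [simp]:
  fixes A :: "'a :: comm_ring_1 mat"
  shows "dim_row A = n \<Longrightarrow> 0\<^sub>m m n * A = 0\<^sub>m m (dim_col A)" "dim_col A = n \<Longrightarrow> A * 0\<^sub>m n m = 0\<^sub>m (dim_row A) m"
  by (auto simp: left_mult_zero_mat right_mult_zero_mat)

lemma mat_minus_zero:
  fixes A :: "'a :: comm_ring_1 mat"
  shows "dim_row A = n \<Longrightarrow> dim_col A = m \<Longrightarrow> A - 0\<^sub>m n m = A" "A - A = 0\<^sub>m (dim_row A) (dim_col A)"
  by (auto intro!: eq_matI)

lemma mat_minus_eq_zero:
  fixes A :: "'a :: comm_ring_1 mat"
  assumes "A - B = 0\<^sub>m n m" "A \<in> carrier_mat n m" "B \<in> carrier_mat n m"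
  shows "A = B"
proof (rule eq_matI, goal_cases)
  case (1 i j)
  have "(A - B) $$ (i, j) = 0" using assms 1 by simp
  thus ?case using 1 by simp
qed (use assms in auto)

lemma minus_eq_swap:
  fixes A :: "'a :: comm_ring_1 mat"
  assumes "A - B = C" "A \<in> carrier_mat n m" "B \<in> carrier_mat n m"
  shows "B = A - C"
  using assms by (intro eq_matI) auto

lemma mat_smult_mult:
  fixes A :: "'a :: comm_ring_1 mat"
  shows "dim_col A = dim_row B \<Longrightarrow> (c \<cdot>\<^sub>m A) * B = c \<cdot>\<^sub>m (A * B)"
    "dim_col A = dim_row B \<Longrightarrow> A * (c \<cdot>\<^sub>m B) = c \<cdot>\<^sub>m (A * B)"
  by (rule mult_smult_assoc_mat mult_smult_distrib; force)+

section \<open>Coordinate vectors, kernels, cokernels and ranks of matrices\<close>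

definition unit_col :: "nat \<Rightarrow> nat \<Rightarrow> 'a :: semiring_1 mat" where
  "unit_col n i = mat n 1 (\<lambda>(r, _). if r = i then 1 else 0)"

lemma unit_col_dim [simp]: "dim_row (unit_col n i) = n" "dim_col (unit_col n i) = Suc 0"
  by (simp_all add: unit_col_def)

lemma unit_col_carrier: "unit_col n i \<in> carrier_mat n 1"
  by (rule carrier_matI) simp_all

lemma mult_unit_col: "i < dim_col M \<Longrightarrow> r < dim_row M \<Longrightarrow> dim_col M = n \<Longrightarrow>
   (M * unit_col n i) $$ (r, 0) = (M :: 'a :: semiring_1 mat) $$ (r, i)"
  by (simp add: mat_mult_index unit_col_def if_distrib[of "\<lambda>x. _ * x"] del: index_mult_mat(1) cong: if_cong)

lemma mat_eq_by_cols:
  fixes M :: "'a :: semiring_1 mat"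
  assumes "M \<in> carrier_mat r n" "N \<in> carrier_mat r n"
    and "\<And>i. i < n \<Longrightarrow> M * unit_col n i = N * unit_col n i"
  shows "M = N"
proof (rule eq_matI, goal_cases)
  case (1 i j)
  have "M $$ (i, j) = (M * unit_col n j) $$ (i, 0)" using 1 assms by (subst mult_unit_col) auto
  also have "\<dots> = (N * unit_col n j) $$ (i, 0)" using 1 assms by simp
  also have "\<dots> = N $$ (i, j)" using 1 assms by (subst mult_unit_col) auto
  finally show ?case .
qed (use assms in auto)

text \<open>\<open>\<rho>\<close> is the quotient by the line of \<open>w\<close>, \<open>s\<close>
  a section of it, and \<open>\<phi>\<close> a functional with value 1 on \<open>w\<close>.
  Subtracting a multiple of \<open>w\<close> makes a coordinate \<open>i\<close> at which
  \<open>w\<close> is nonzero vanish, and that coordinate is then dropped.\<close>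

lemma split_off_vector:
  fixes w :: "'a :: field mat"
  assumes w: "w \<in> carrier_mat c 1" "w \<noteq> 0\<^sub>m c 1"
  obtains \<rho> s \<phi> where "c > 0" "\<rho> \<in> carrier_mat (c - 1) c" "s \<in> carrier_mat c (c - 1)" "\<phi> \<in> carrier_mat 1 c"
    "\<rho> * s = 1\<^sub>m (c - 1)" "s * \<rho> = 1\<^sub>m c - w * \<phi>" "\<rho> * w = 0\<^sub>m (c - 1) 1" "\<phi> * w = 1\<^sub>m 1"
proof -
  obtain i where i: "i < c" "w $$ (i, 0) \<noteq> 0"
  proof (rule ccontr)
    assume "\<not> thesis"
    hence "w = 0\<^sub>m c 1" using w(1) that by (intro eq_matI) auto
    thus False using w by simp
  qed
  \<comment> \<open>\<open>skip\<close> enumerates the indices other than \<open>i\<close>;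
    \<open>d\<close> deletes coordinate \<open>i\<close>, and its transpose \<open>s\<close> inserts
    a zero there.\<close>
  define skip where "skip x = (if x < i then x else Suc x)" for x
  define d :: "'a mat" where "d = mat (c - 1) c (\<lambda>(x, y). if y = skip x then 1 else 0)"
  define s :: "'a mat" where "s = d\<^sup>T"
  define \<phi> :: "'a mat" where "\<phi> = mat 1 c (\<lambda>(_, y). if y = i then inverse (w $$ (i, 0)) else 0)"
  define \<rho> where "\<rho> = d * (1\<^sub>m c - w * \<phi>)"
  have car: "d \<in> carrier_mat (c - 1) c" "s \<in> carrier_mat c (c - 1)" "\<phi> \<in> carrier_mat 1 c"
    "\<rho> \<in> carrier_mat (c - 1) c"
    using w by (auto simp: d_def s_def \<phi>_def \<rho>_def)
  have skip: "x < c - 1 \<Longrightarrow> skip x < c" for x by (auto simp: skip_def)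
  have skip_inj: "skip x = skip y \<longleftrightarrow> x = y" "skip x \<noteq> i" for x y by (auto simp: skip_def)
  have dA: "(d * A) $$ (x, j) = A $$ (skip x, j)" if "x < c - 1" "j < dim_col A" "dim_row A = c" for A x j
    using that car skip[of x]
    by (simp add: mat_mult_index d_def if_distrib[of "\<lambda>x. x * _"] del: index_mult_mat(1) cong: if_cong)
  have As: "(A * s) $$ (x, j) = A $$ (x, skip j)" if "j < c - 1" "x < dim_row A" "dim_col A = c" for A x j
    using that car skip[of j]
    by (simp add: mat_mult_index s_def d_def if_distrib[of "\<lambda>x. _ * x"] del: index_mult_mat(1) cong: if_cong)
  have sA: "(s * A) $$ (x, j) = (if x = i then 0 else A $$ (if x < i then x else x - 1, j))"
    if "x < c" "j < dim_col A" "dim_row A = c - 1" for A x j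
  proof -
    have *: "x = skip k \<longleftrightarrow> x \<noteq> i \<and> k = (if x < i then x else x - 1)" for k
      by (auto simp: skip_def)
    have "(s * A) $$ (x, j) = (\<Sum>k = 0..<c - 1. s $$ (x, k) * A $$ (k, j))"
      using that car by (simp add: mat_mult_index del: index_mult_mat(1))
    also have "\<dots> = (\<Sum>k = 0..<c - 1. if k = (if x < i then x else x - 1) then (if x = i then 0 else A $$ (k, j)) else 0)"
      using that by (intro sum.cong) (auto simp: s_def d_def *)
    also have "\<dots> = (if x = i then 0 else A $$ (if x < i then x else x - 1, j))"
    proof (cases "x = i")
      case False
      hence "(if x < i then x else x - 1) < c - 1" using that i by auto
      thus ?thesis using False by (simp del: One_nat_def)
    qed simp
    finally show ?thesis .
  qed
  have s_idx: "s $$ (y, x) = (if y = skip x then 1 else 0)" if "y < c" "x < c - 1" for x y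
    using that by (simp add: s_def d_def)
  have \<phi>_idx: "\<phi> $$ (0, y) = (if y = i then inverse (w $$ (i, 0)) else 0)" if "y < c" for y
    using that by (simp add: \<phi>_def)
  have ds: "d * s = 1\<^sub>m (c - 1)"
  proof (rule eq_matI, goal_cases)
    case (1 x y)
    hence xy: "x < c - 1" "y < c - 1" by auto
    have "(d * s) $$ (x, y) = s $$ (skip x, y)" using xy car by (intro dA) auto
    thus ?case using xy skip s_idx skip_inj by auto
  qed (use car in auto)
  have \<phi>s: "\<phi> * s = 0\<^sub>m 1 (c - 1)"
  proof (rule eq_matI, goal_cases)
    case (1 x y)
    hence xy: "x = 0" "y < c - 1" by auto
    have "(\<phi> * s) $$ (x, y) = \<phi> $$ (x, skip y)" using xy car by (intro As) auto
    thus ?case using xy skip \<phi>_idx skip_inj by auto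
  qed (use car in auto)
  have \<phi>w: "\<phi> * w = 1\<^sub>m 1"
    using i w by (intro eq_matI)
      (auto simp: mat_mult_index \<phi>_def if_distrib[of "\<lambda>x. x * _"] simp del: index_mult_mat(1) cong: if_cong)
  have \<rho>s: "\<rho> * s = 1\<^sub>m (c - 1)"
    using car w by (simp add: \<rho>_def mat_assoc mat_minus_distrib ds \<phi>s mat_minus_zero)
  have w\<phi>: "(w * \<phi>) $$ (i, j) = (if j = i then 1 else 0)" if "j < c" for j
    using that i w car by (simp add: mat_mult_index del: index_mult_mat(1)) (simp add: \<phi>_def)
  have s\<rho>: "s * \<rho> = 1\<^sub>m c - w * \<phi>"
  proof (rule eq_matI, goal_cases)
    case (1 x j)
    hence xj: "x < c" "j < c" using car w by auto
    let ?y = "if x < i then x else x - 1"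
    have y: "x \<noteq> i \<Longrightarrow> ?y < c - 1" "x \<noteq> i \<Longrightarrow> skip ?y = x" using xj i by (auto simp: skip_def)
    show ?case
    proof (cases "x = i")
      case True
      thus ?thesis using xj car w w\<phi> by (subst sA) (auto simp del: index_mult_mat(1))
    next
      case False
      have "(s * \<rho>) $$ (x, j) = \<rho> $$ (?y, j)" using xj car False by (subst sA) auto
      also have "\<dots> = (1\<^sub>m c - w * \<phi>) $$ (x, j)"
        unfolding \<rho>_def using xj car w y False by (subst dA) auto
      finally show ?thesis .
    qed
  qed (use car w in auto)
  have "\<rho> * w = d * (w - w * (\<phi> * w))"
    using car w by (simp add: \<rho>_def mat_assoc mat_minus_distrib)
  also have "\<dots> = 0\<^sub>m (c - 1) 1" using car w by (simp add: \<phi>w mat_minus_zero)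
  finally show thesis using that[of \<rho> s \<phi>] car \<rho>s s\<rho> \<phi>w i by simp
qed

text \<open>Among the \<open>\<pi>\<close> that split up to a correction factoring through \<open>M\<close>, one with the fewest rows
  kills \<open>M\<close>: otherwise a nonzero column of \<open>\<pi> M\<close> could be split off.\<close>

lemma cokernel_mat:
  fixes M :: "'a :: field mat"
  assumes M: "M \<in> carrier_mat r n"
  obtains c \<pi> \<sigma> X where "\<pi> \<in> carrier_mat c r" "\<sigma> \<in> carrier_mat r c" "X \<in> carrier_mat n r"
    "\<pi> * \<sigma> = 1\<^sub>m c" "\<pi> * M = 0\<^sub>m c n" "1\<^sub>m r - \<sigma> * \<pi> = M * X"
proof -
  define P where "P c = (\<exists>\<pi> \<sigma> X. \<pi> \<in> carrier_mat c r \<and> \<sigma> \<in> carrier_mat r c \<and> X \<in> carrier_mat n r \<and>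
    \<pi> * \<sigma> = 1\<^sub>m c \<and> 1\<^sub>m r - \<sigma> * \<pi> = M * X)" for c
  have "P r" unfolding P_def using M
    by (intro exI[of _ "1\<^sub>m r"] exI[of _ "0\<^sub>m n r"]) (auto simp: mat_minus_zero)
  hence "P (LEAST c. P c)" by (rule LeastI)
  then obtain c \<pi> \<sigma> X where c: "c = (LEAST c. P c)"
    and car: "\<pi> \<in> carrier_mat c r" "\<sigma> \<in> carrier_mat r c" "X \<in> carrier_mat n r"
    and eq: "\<pi> * \<sigma> = 1\<^sub>m c" "1\<^sub>m r - \<sigma> * \<pi> = M * X"
    unfolding P_def by blast
  have "\<pi> * M = 0\<^sub>m c n"
  proof (rule mat_eq_by_cols[of _ c n])
    fix i assume i: "i < n"
    define v :: "'a mat" where "v = unit_col n i"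
    have v: "v \<in> carrier_mat n 1" unfolding v_def by (rule unit_col_carrier)
    define w where "w = \<pi> * M * v"
    have w: "w \<in> carrier_mat c 1" using car M v by (auto simp: w_def)
    have "w = 0\<^sub>m c 1"
    proof (rule ccontr)
      assume "w \<noteq> 0\<^sub>m c 1"
      then obtain \<rho> s \<phi> where s: "c > 0" "\<rho> \<in> carrier_mat (c - 1) c" "s \<in> carrier_mat c (c - 1)" "\<phi> \<in> carrier_mat 1 c"
        "\<rho> * s = 1\<^sub>m (c - 1)" "s * \<rho> = 1\<^sub>m c - w * \<phi>"
        using w split_off_vector by metis
      \<comment> \<open>Chosen to give \<open>1 - \<sigma> s \<rho> \<pi> = M Y\<close>: expand
        \<open>\<sigma> (1 - w \<phi>) \<pi>\<close> with \<open>w = \<pi> M v\<close>, then replace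
        \<open>\<sigma> \<pi>\<close> by \<open>1 - M X\<close>.\<close>
      define Y where "Y = X + (v * \<phi> * \<pi> - X * M * v * \<phi> * \<pi>)"
      have Y: "Y \<in> carrier_mat n r" using car s M v by (auto simp: Y_def)
      have ps: "(\<rho> * \<pi>) * (\<sigma> * s) = 1\<^sub>m (c - 1)"
      proof -
        have "(\<rho> * \<pi>) * (\<sigma> * s) = \<rho> * (\<pi> * \<sigma>) * s" using car s(2-4) by (simp add: mat_assoc)
        thus ?thesis using car s(2-5) by (simp add: eq)
      qed
      have sp: "\<sigma> * \<pi> = 1\<^sub>m r - M * X" 
        by (rule minus_eq_swap[OF eq(2)]) (use car in auto)
      have "(\<sigma> * s) * (\<rho> * \<pi>) = \<sigma> * (s * \<rho>) * \<pi>" using car s(2-4) by (simp add: mat_assoc)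
      also have "\<dots> = \<sigma> * \<pi> - (\<sigma> * \<pi>) * (M * v * \<phi> * \<pi>)"
        unfolding s(6) using car s(2-4) M v w by (simp add: w_def mat_assoc mat_minus_distrib)
      also have "\<dots> = 1\<^sub>m r - M * X - (M * v * \<phi> * \<pi> - M * X * (M * v * \<phi> * \<pi>))"
        unfolding sp using car s(2-4) M v by (simp add: mat_minus_distrib)
      finally have "1\<^sub>m r - (\<sigma> * s) * (\<rho> * \<pi>) =
         1\<^sub>m r - (1\<^sub>m r - M * X - (M * v * \<phi> * \<pi> - M * X * (M * v * \<phi> * \<pi>)))" by simp
      also have "\<dots> = M * X + (M * v * \<phi> * \<pi> - M * X * (M * v * \<phi> * \<pi>))"
        using car s(2-4) M v by (intro eq_matI) (auto simp del: index_mult_mat(1))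
      also have "\<dots> = M * Y" unfolding Y_def
        using car s(2-4) M v by (simp add: mat_assoc mat_minus_distrib)
      finally have "1\<^sub>m r - (\<sigma> * s) * (\<rho> * \<pi>) = M * Y" .
      moreover have "\<rho> * \<pi> \<in> carrier_mat (c - 1) r" "\<sigma> * s \<in> carrier_mat r (c - 1)"
        using car s(2,3) by auto
      ultimately have "P (c - 1)" unfolding P_def using ps Y by blast
      hence "c \<le> c - 1" unfolding c by (rule Least_le)
      thus False using s(1) by simp
    qed
    thus "\<pi> * M * unit_col n i = 0\<^sub>m c n * unit_col n i"
      by (simp add: w_def v_def)
  qed (use car M in auto)
  thus thesis using that car eq by blast
qed

text \<open>The transpose of \<open>cokernel_mat\<close>. The last identity encodes universality:
  \<open>M * t = 0\<close> forces \<open>t = \<kappa> * (li * t)\<close>.\<close>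

lemma kernel_mat:
  fixes M :: "'a :: field mat"
  assumes M: "M \<in> carrier_mat r n"
  obtains c \<kappa> li Y where "\<kappa> \<in> carrier_mat n c" "li \<in> carrier_mat c n" "Y \<in> carrier_mat n r"
    "li * \<kappa> = 1\<^sub>m c" "M * \<kappa> = 0\<^sub>m r c" "1\<^sub>m n - \<kappa> * li = Y * M"
proof -
  obtain c \<pi> \<sigma> X where car: "\<pi> \<in> carrier_mat c n" "\<sigma> \<in> carrier_mat n c" "X \<in> carrier_mat r n"
    and eq: "\<pi> * \<sigma> = 1\<^sub>m c" "\<pi> * M\<^sup>T = 0\<^sub>m c r" "1\<^sub>m n - \<sigma> * \<pi> = M\<^sup>T * X"
    using cokernel_mat[of "M\<^sup>T" n r] M transpose_carrier_mat by metis
  have "\<sigma>\<^sup>T * \<pi>\<^sup>T = 1\<^sub>m c" using arg_cong[OF eq(1), of transpose_mat] car by (simp add: transpose_mult[of _ c n _ c])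
  moreover have "M * \<pi>\<^sup>T = 0\<^sub>m r c"
    using arg_cong[OF eq(2), of transpose_mat] car M by (simp add: transpose_mult[of _ c n _ r])
  moreover have "1\<^sub>m n - \<pi>\<^sup>T * \<sigma>\<^sup>T = X\<^sup>T * M"
    using arg_cong[OF eq(3), of transpose_mat] car M
    by (simp add: transpose_minus[of _ n n] transpose_mult[of _ n c _ n] transpose_mult[of _ n r _ n])
  ultimately show thesis using that[of "\<pi>\<^sup>T" c "\<sigma>\<^sup>T" "X\<^sup>T"] car by simp
qed

text \<open>With \<open>\<pi>\<close> the projection modulo the kernel of \<open>M\<close>, one has
  \<open>M = (M * \<sigma>) * \<pi>\<close>, and the first factor is injective with left inverse
  \<open>\<pi> * Y\<close>.\<close>

lemma rank_factorization:
  fixes M :: "'a :: field mat"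
  assumes M: "M \<in> carrier_mat r n"
  obtains c \<iota> \<pi> \<sigma> li where "\<iota> \<in> carrier_mat r c" "\<pi> \<in> carrier_mat c n" "\<sigma> \<in> carrier_mat n c" "li \<in> carrier_mat c r"
    "M = \<iota> * \<pi>" "\<pi> * \<sigma> = 1\<^sub>m c" "li * \<iota> = 1\<^sub>m c"
proof -
  obtain d \<kappa> l Y where k: "\<kappa> \<in> carrier_mat n d" "l \<in> carrier_mat d n" "Y \<in> carrier_mat n r"
    "l * \<kappa> = 1\<^sub>m d" "M * \<kappa> = 0\<^sub>m r d" "1\<^sub>m n - \<kappa> * l = Y * M"
    using kernel_mat[OF M] by metis
  obtain c \<pi> \<sigma> X where c: "\<pi> \<in> carrier_mat c n" "\<sigma> \<in> carrier_mat n c" "X \<in> carrier_mat d n"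
    "\<pi> * \<sigma> = 1\<^sub>m c" "\<pi> * \<kappa> = 0\<^sub>m c d" "1\<^sub>m n - \<sigma> * \<pi> = \<kappa> * X"
    using cokernel_mat[OF k(1)] by metis
  have "\<sigma> * \<pi> = 1\<^sub>m n - \<kappa> * X" by (rule minus_eq_swap[OF c(6)]) (use c in auto)
  hence "M * \<sigma> * \<pi> = M - M * (\<kappa> * X)" using M k(1) c(1-3) by (simp add: mat_assoc mat_minus_distrib)
  hence 1: "M = M * \<sigma> * \<pi>" using M k(1) c(3) by (simp add: mat_minus_zero mult_pull[OF k(5)])
  have "\<pi> * Y * (M * \<sigma>) = \<pi> * (Y * M) * \<sigma>" using M k(3) c(1,2) by (simp add: mat_assoc)
  also have "\<dots> = \<pi> * \<sigma> - \<pi> * (\<kappa> * (l * \<sigma>))" unfolding k(6)[symmetric]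
    using M k(1-3) c(1-3) by (simp add: mat_assoc mat_minus_distrib)
  also have "\<dots> = 1\<^sub>m c" using k(1,2) c(1-4) by (simp add: mat_minus_zero mult_pull[OF c(5)])
  finally show thesis using that[of "M * \<sigma>" c \<pi> \<sigma> "\<pi> * Y"] 1 M k c by simp
qed

text \<open>If \<open>b < a\<close>, padding with zeros makes both matrices square without changing
  \<open>L * A\<close>. A square left inverse is two-sided, yet the padded \<open>A\<close> has a
  zero row.\<close>

lemma left_inverse_dim:
  fixes A :: "'a :: field mat"
  assumes A: "A \<in> carrier_mat b a" and L: "L \<in> carrier_mat a b" and LA: "L * A = 1\<^sub>m a"
  shows "a \<le> b"
proof (rule ccontr)
  assume "\<not> a \<le> b"
  hence ba: "b < a" by simp
  define A' where "A' = mat a a (\<lambda>(i, j). if i < b then A $$ (i, j) else 0)"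
  define L' where "L' = mat a a (\<lambda>(i, j). if j < b then L $$ (i, j) else 0)"
  have car: "A' \<in> carrier_mat a a" "L' \<in> carrier_mat a a" by (auto simp: A'_def L'_def)
  have "L' * A' = L * A"
  proof (rule eq_matI, goal_cases)
    case (1 i j)
    hence ij: "i < a" "j < a" using A L by auto
    have "(L' * A') $$ (i, j) = (\<Sum>k = 0..<a. L' $$ (i, k) * A' $$ (k, j))"
      using ij car by (simp add: mat_mult_index del: index_mult_mat(1))
    also have "\<dots> = (\<Sum>k = 0..<b. L' $$ (i, k) * A' $$ (k, j))"
      using ba ij by (intro sum.mono_neutral_right) (auto simp: A'_def)
    also have "\<dots> = (\<Sum>k = 0..<b. L $$ (i, k) * A $$ (k, j))"
      using ba ij by (intro sum.cong) (auto simp: A'_def L'_def)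
    also have "\<dots> = (L * A) $$ (i, j)" using A L ij by (simp add: mat_mult_index del: index_mult_mat(1))
    finally show ?case .
  qed (use A L car in auto)
  hence "A' * L' = 1\<^sub>m a" using LA mat_mult_left_right_inverse[OF car(2,1)] by simp
  hence "(A' * L') $$ (b, b) = 1" using ba by simp
  moreover have "(A' * L') $$ (b, b) = 0"
    using ba car by (simp add: mat_mult_index del: index_mult_mat(1)) (simp add: A'_def)
  ultimately show False by simp
qed

text \<open>The form in which dimensions are bounded later: rows are functionals on a space of
  dimension \<open>N\<close>, and if no nonzero one vanishes on the \<open>n\<close> columns of
  \<open>M\<close>, these columns span.\<close>

lemma separating_dim:
  fixes M :: "'a :: field mat"
  assumes M: "M \<in> carrier_mat N n"
    and inj: "\<And>G. G \<in> carrier_mat 1 N \<Longrightarrow> G * M = 0\<^sub>m 1 n \<Longrightarrow> G = 0\<^sub>m 1 N"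
  obtains X where "X \<in> carrier_mat n N" "M * X = 1\<^sub>m N" "N \<le> n"
proof -
  obtain c \<pi> \<sigma> X where c: "\<pi> \<in> carrier_mat c N" "\<sigma> \<in> carrier_mat N c" "X \<in> carrier_mat n N"
    "\<pi> * \<sigma> = 1\<^sub>m c" "\<pi> * M = 0\<^sub>m c n" "1\<^sub>m N - \<sigma> * \<pi> = M * X"
    using cokernel_mat[OF M] by metis
  have "\<pi> = 0\<^sub>m c N"
  proof -
    have "\<pi>\<^sup>T = 0\<^sub>m N c"
    proof (rule mat_eq_by_cols[of _ N c])
      fix i assume i: "i < c"
      let ?G = "(unit_col c i)\<^sup>T * \<pi>"
      note u = unit_col_carrier[of c i]
      have "?G * M = 0\<^sub>m 1 n" using c M by (simp add: mat_assoc)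
      moreover have "?G \<in> carrier_mat 1 N" using c(1) by (intro carrier_matI) simp_all
      ultimately have "?G = 0\<^sub>m 1 N" using inj by blast
      hence "?G\<^sup>T = 0\<^sub>m N 1" by simp
      thus "\<pi>\<^sup>T * unit_col c i = 0\<^sub>m N c * unit_col c i"
        using c u by (simp add: mat_transpose_mult)
    qed (use c in auto)
    hence "\<pi>\<^sup>T\<^sup>T = (0\<^sub>m N c)\<^sup>T" by (rule arg_cong)
    thus ?thesis by simp
  qed
  hence MX: "M * X = 1\<^sub>m N" using c by (simp add: mat_minus_zero)
  show thesis using that[OF c(3) MX] left_inverse_dim[OF c(3) M MX] .
qed

lemma left_inverse_square:
  fixes A :: "'a :: field mat"
  assumes "A \<in> carrier_mat n n" "L \<in> carrier_mat n n" "L * A = 1\<^sub>m n"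
  shows "A * L = 1\<^sub>m n"
  using mat_mult_left_right_inverse[OF assms(2,1,3)] .

text \<open>Induction on the dimension. If all matrices are scalar, any nonzero vector works.
  Otherwise some \<open>S i\<close> has an eigenspace that is nonzero and proper, and the commuting
  family restricts to it. Algebraic closedness supplies the eigenvalue.\<close>

lemma common_eigenvector:
  fixes S :: "'i \<Rightarrow> 'a :: alg_closed_field mat"
  assumes "w > 0" and "\<And>j. j \<in> J \<Longrightarrow> S j \<in> carrier_mat w w"
    and "\<And>i j. i \<in> J \<Longrightarrow> j \<in> J \<Longrightarrow> S i * S j = S j * S i"
  shows "\<exists>v \<chi>. v \<in> carrier_mat w 1 \<and> v \<noteq> 0\<^sub>m w 1 \<and> (\<forall>j \<in> J. S j * v = \<chi> j \<cdot>\<^sub>m v)"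
  using assms
proof (induction w arbitrary: S rule: less_induct)
  case (less w)
  note S = less.prems(2) and comm = less.prems(3)
  show ?case
  proof (cases "\<forall>j \<in> J. \<exists>\<mu>. S j = \<mu> \<cdot>\<^sub>m 1\<^sub>m w")
    case True
    then obtain \<chi> where \<chi>: "\<And>j. j \<in> J \<Longrightarrow> S j = \<chi> j \<cdot>\<^sub>m 1\<^sub>m w" by metis
    let ?v = "unit_col w 0 :: 'a mat"
    have "?v $$ (0, 0) = 1" using less.prems(1) by (simp add: unit_col_def)
    hence "?v \<noteq> 0\<^sub>m w 1" using less.prems(1) by force
    moreover note unit_col_carrier[of w 0]
    moreover have "S j * ?v = \<chi> j \<cdot>\<^sub>m ?v" if "j \<in> J" for j
      using \<chi>[OF that] by (simp add: mat_smult_mult)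
    ultimately show ?thesis by blast
  next
    case False
    then obtain i where i: "i \<in> J" "\<And>\<mu>. S i \<noteq> \<mu> \<cdot>\<^sub>m 1\<^sub>m w" by blast
    have "degree (char_poly (S i)) > 0" using degree_monic_char_poly[OF S[OF i(1)]] less.prems(1) by simp
    then obtain \<mu> where "poly (char_poly (S i)) \<mu> = 0"
      using alg_closed_imp_poly_has_root by blast
    define N where "N = S i - \<mu> \<cdot>\<^sub>m 1\<^sub>m w"
    have N: "N \<in> carrier_mat w w" unfolding N_def by (intro minus_carrier_mat smult_carrier_mat one_carrier_mat)
    have "N = char_matrix (S i) \<mu>" using S[OF i(1)] unfolding N_def char_matrix_def
      by (intro eq_matI) auto
    hence det: "det N = 0"
      using \<open>poly _ \<mu> = 0\<close> eigenvalue_root_char_poly[OF S[OF i(1)]] eigenvalue_det[OF S[OF i(1)]] by simp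
    obtain c \<kappa> l Y where k: "\<kappa> \<in> carrier_mat w c" "l \<in> carrier_mat c w" "Y \<in> carrier_mat w w"
      "l * \<kappa> = 1\<^sub>m c" "N * \<kappa> = 0\<^sub>m w c" "1\<^sub>m w - \<kappa> * l = Y * N"
      using kernel_mat[OF N] by metis
    have "c \<noteq> 0"
    proof
      assume "c = 0"
      hence "\<kappa> * l = 0\<^sub>m w w" using k
        by (intro eq_matI) (auto simp: mat_mult_index simp del: index_mult_mat(1))
      hence "Y * N = 1\<^sub>m w" using k(6) by (simp add: mat_minus_zero)
      hence "det Y * det N = 1" using det_mult[OF k(3) N] by simp
      thus False using det by simp
    qed
    moreover have "c \<noteq> w"
    proof
      assume "c = w"
      hence "\<kappa> * l = 1\<^sub>m w" using k left_inverse_square[of \<kappa> w l] by simp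
      hence "N * (\<kappa> * l) = N" using N by simp
      moreover have "N * (\<kappa> * l) = N * \<kappa> * l" using N k(1,2) by (simp add: mat_assoc)
      ultimately have "N = 0\<^sub>m w w" using k by simp
      hence "S i = \<mu> \<cdot>\<^sub>m 1\<^sub>m w" unfolding N_def
        by (rule mat_minus_eq_zero) (use S[OF i(1)] in auto)
      thus False using i by blast
    qed
    moreover have "c \<le> w" using left_inverse_dim k by blast
    ultimately have c: "c < w" "c > 0" by auto
    have NS: "N * S j = S j * N" if "j \<in> J" for j
      using S[OF i(1)] S[OF that] comm[OF i(1) that] by (simp add: N_def mat_minus_distrib mat_smult_mult)
    \<comment> \<open>By \<open>NS\<close> the eigenspace, which is the image of
      \<open>\<kappa>\<close>, is stable under \<open>S j\<close>; hence
      \<open>l * S j * \<kappa>\<close> is the restriction of \<open>S j\<close> to it.\<close>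
    have kS: "\<kappa> * (l * S j * \<kappa>) = S j * \<kappa>" if "j \<in> J" for j
    proof -
      have kl: "\<kappa> * l = 1\<^sub>m w - Y * N" by (rule minus_eq_swap[OF k(6)]) (use k in auto)
      have "\<kappa> * (l * S j * \<kappa>) = (\<kappa> * l) * (S j * \<kappa>)" using k S[OF that] by (simp add: mat_assoc)
      also have "\<dots> = S j * \<kappa> - Y * ((N * S j) * \<kappa>)" unfolding kl using N k S[OF that] 
        by (simp add: mat_assoc mat_minus_distrib)
      also have "\<dots> = S j * \<kappa>" unfolding NS[OF that] using N k S[OF that]
        by (simp add: mat_assoc mat_minus_zero)
      finally show ?thesis .
    qed
    have "\<exists>v \<chi>. v \<in> carrier_mat c 1 \<and> v \<noteq> 0\<^sub>m c 1 \<and> (\<forall>j \<in> J. l * S j * \<kappa> * v = \<chi> j \<cdot>\<^sub>m v)"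
    proof (rule less.IH[OF c])
      fix i j assume ij: "i \<in> J" "j \<in> J"
      have p: "l * S i * \<kappa> * (l * S j * \<kappa>) = l * (S i * S j) * \<kappa>" if "i \<in> J" "j \<in> J" for i j
      proof -
        have "l * S i * \<kappa> * (l * S j * \<kappa>) = l * S i * (\<kappa> * (l * S j * \<kappa>))"
          using k S that by (simp add: mat_assoc carrier_matD[OF S])
        thus ?thesis unfolding kS[OF that(2)] using k S that by (simp add: mat_assoc carrier_matD[OF S])
      qed
      show "l * S i * \<kappa> * (l * S j * \<kappa>) = l * S j * \<kappa> * (l * S i * \<kappa>)"
        using p ij comm by simp
    qed (use k S in auto)
    then obtain v \<chi> where v: "v \<in> carrier_mat c 1" "v \<noteq> 0\<^sub>m c 1"
      "\<And>j. j \<in> J \<Longrightarrow> l * S j * \<kappa> * v = \<chi> j \<cdot>\<^sub>m v" by blast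
    have "l * (\<kappa> * v) = v" using k v by (simp add: mat_assoc[symmetric])
    hence "\<kappa> * v \<noteq> 0\<^sub>m w 1" using v k by auto
    moreover have "S j * (\<kappa> * v) = \<chi> j \<cdot>\<^sub>m (\<kappa> * v)" if "j \<in> J" for j
    proof -
      have "S j * (\<kappa> * v) = (S j * \<kappa>) * v" using k v S[OF that] by (simp add: mat_assoc)
      also have "\<dots> = \<kappa> * (l * S j * \<kappa> * v)" unfolding kS[OF that, symmetric]
        using k v S[OF that] by (simp add: mat_assoc)
      also have "\<dots> = \<chi> j \<cdot>\<^sub>m (\<kappa> * v)" unfolding v(3)[OF that] using k v by (simp add: mat_smult_mult)
      finally show ?thesis .
    qed
    ultimately show ?thesis using k v by (intro exI[of _ "\<kappa> * v"] exI[of _ \<chi>]) auto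
  qed
qed

definition hcat :: "'a mat \<Rightarrow> 'a mat \<Rightarrow> 'a mat" where
  "hcat A B = mat (dim_row A) (dim_col A + dim_col B)
     (\<lambda>(i, j). if j < dim_col A then A $$ (i, j) else B $$ (i, j - dim_col A))"

lemma hcat_dim [simp]: "dim_row (hcat A B) = dim_row A" "dim_col (hcat A B) = dim_col A + dim_col B"
  by (simp_all add: hcat_def)

lemma hcat_eq_zero:
  fixes A :: "'a :: comm_ring_1 mat"
  assumes "F \<in> carrier_mat r q" "A \<in> carrier_mat q m" "B \<in> carrier_mat q n"
    and 0: "F * hcat A B = 0\<^sub>m r (m + n)"
  shows "F * A = 0\<^sub>m r m" "F * B = 0\<^sub>m r n"
proof -
  have *: "(F * hcat A B) $$ (i, j) = 0" if "i < r" "j < m + n" for i j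
    unfolding 0 using that by simp
  show "F * A = 0\<^sub>m r m"
  proof (rule eq_matI, goal_cases)
    case (1 i j)
    hence "(F * A) $$ (i, j) = (F * hcat A B) $$ (i, j)" using assms(1-3)
      by (simp add: mat_mult_index del: index_mult_mat(1)) (simp add: hcat_def)
    thus ?case using *[of i j] 1 by simp
  qed (use assms in auto)
  show "F * B = 0\<^sub>m r n"
  proof (rule eq_matI, goal_cases)
    case (1 i j)
    hence "(F * B) $$ (i, j) = (F * hcat A B) $$ (i, m + j)" using assms(1-3)
      by (simp add: mat_mult_index del: index_mult_mat(1)) (simp add: hcat_def)
    thus ?case using *[of i "m + j"] 1 by simp
  qed (use assms in auto)
qed

section \<open>Bialgebras and antipodes\<close>

lemma kron_mult_pull:
  fixes A B C D X :: "'a :: comm_semiring_1 mat"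
  assumes "dim_col A = dim_row C" "dim_col B = dim_row D" "dim_row X = dim_col C * dim_col D"
  shows "(A \<otimes>\<^sub>m B) * ((C \<otimes>\<^sub>m D) * X) = ((A * C) \<otimes>\<^sub>m (B * D)) * X"
  by (rule mult_pull) (use assms in \<open>auto simp: kron_mult\<close>)

lemma kron_one_split: "1\<^sub>m (n * m) = (1\<^sub>m n \<otimes>\<^sub>m 1\<^sub>m m :: 'a :: semiring_1 mat)"
  by (rule kron_one[symmetric])

text \<open>Tensoring with the one-dimensional space changes no positions, so a column or a row
  slides past the other factor. Each equation is the mixed product rule with a factor
  \<open>1\<^sub>m 1\<close>.\<close>

lemma kron_vec:
  fixes A B X :: "'a :: comm_semiring_1 mat"
  shows "dim_col A = 1 \<Longrightarrow> dim_row X = k \<Longrightarrow> (A \<otimes>\<^sub>m 1\<^sub>m k) * X = A \<otimes>\<^sub>m X"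
    "dim_col A = 1 \<Longrightarrow> dim_row X = k \<Longrightarrow> (1\<^sub>m k \<otimes>\<^sub>m A) * X = X \<otimes>\<^sub>m A"
    "dim_row B = 1 \<Longrightarrow> dim_col X = k \<Longrightarrow> X * (B \<otimes>\<^sub>m 1\<^sub>m k) = B \<otimes>\<^sub>m X"
    "dim_row B = 1 \<Longrightarrow> dim_col X = k \<Longrightarrow> X * (1\<^sub>m k \<otimes>\<^sub>m B) = X \<otimes>\<^sub>m B"
  using kron_mult[of A "1\<^sub>m 1" "1\<^sub>m k" X] kron_mult[of "1\<^sub>m k" X A "1\<^sub>m 1"]
    kron_mult[of "1\<^sub>m 1" B X "1\<^sub>m k"] kron_mult[of X "1\<^sub>m k" "1\<^sub>m 1" B] by simp_all

lemma kron_col_row: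
  fixes A B :: "'a :: comm_semiring_1 mat"
  shows "dim_col A = 1 \<Longrightarrow> dim_row B = 1 \<Longrightarrow> A \<otimes>\<^sub>m B = A * B"
    "dim_col A = 1 \<Longrightarrow> dim_row B = 1 \<Longrightarrow> B \<otimes>\<^sub>m A = A * B"
  using kron_mult[of A "1\<^sub>m 1" "1\<^sub>m 1" B] kron_mult[of "1\<^sub>m 1" B A "1\<^sub>m 1"] by simp_all

text \<open>\<open>P\<close> is surjective as a linear map. This is how laws on a quotient are
  verified: compose with the projection, compute upstairs, cancel.\<close>

lemma right_cancel:
  fixes X Y P :: "'a :: semiring_1 mat"
  assumes eq: "X * P = Y * P" and PQ: "P * Q = 1\<^sub>m c"
    and d: "dim_col X = c" "dim_col Y = c" "dim_row P = c" "dim_row Q = dim_col P"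
  shows "X = Y"
proof -
  have "X * (P * Q) = Y * (P * Q)" using eq d by (simp add: mat_assoc[symmetric])
  thus ?thesis using d by (simp add: PQ)
qed

lemma left_cancel:
  fixes X Y P :: "'a :: semiring_1 mat"
  assumes eq: "P * X = P * Y" and QP: "Q * P = 1\<^sub>m c"
    and d: "dim_row X = c" "dim_row Y = c" "dim_col P = c" "dim_col Q = dim_row P"
  shows "X = Y"
proof -
  have "(Q * P) * X = (Q * P) * Y" using eq d by (simp add: mat_assoc)
  thus ?thesis using d by (simp add: QP)
qed

text \<open>The axioms of \<open>finite_comm_group_scheme\<close> with the antipode left out, so
  that quotients can be treated before an antipode is available.\<close>

locale bialg =
  fixes n :: nat and m u D e :: "'k :: field mat"
  assumes m_carrier: "m \<in> carrier_mat n (n * n)" and u_carrier: "u \<in> carrier_mat n 1"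
    and D_carrier: "D \<in> carrier_mat (n * n) n" and e_carrier: "e \<in> carrier_mat 1 n"
    and m_assoc: "m * (m \<otimes>\<^sub>m 1\<^sub>m n) = m * (1\<^sub>m n \<otimes>\<^sub>m m)"
    and unit_left: "m * (u \<otimes>\<^sub>m 1\<^sub>m n) = 1\<^sub>m n" and unit_right: "m * (1\<^sub>m n \<otimes>\<^sub>m u) = 1\<^sub>m n"
    and m_comm: "m * swap n n = m"
    and D_coassoc: "(D \<otimes>\<^sub>m 1\<^sub>m n) * D = (1\<^sub>m n \<otimes>\<^sub>m D) * D"
    and counit_left: "(e \<otimes>\<^sub>m 1\<^sub>m n) * D = 1\<^sub>m n" and counit_right: "(1\<^sub>m n \<otimes>\<^sub>m e) * D = 1\<^sub>m n"
    and D_cocomm: "swap n n * D = D"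
    and D_m: "D * m = (m \<otimes>\<^sub>m m) * (1\<^sub>m n \<otimes>\<^sub>m swap n n \<otimes>\<^sub>m 1\<^sub>m n) * (D \<otimes>\<^sub>m D)"
    and D_u: "D * u = u \<otimes>\<^sub>m u" and e_m: "e * m = e \<otimes>\<^sub>m e" and e_u: "e * u = 1\<^sub>m 1"
begin

lemma dims [simp]: "dim_row m = n" "dim_col m = n * n" "dim_row u = n" "dim_col u = Suc 0"
  "dim_row D = n * n" "dim_col D = n" "dim_row e = Suc 0" "dim_col e = n"
  using m_carrier u_carrier D_carrier e_carrier by auto

text \<open>Comorphism of the shear \<open>(g, h) -> (g, g h)\<close> of
  \<open>G \<times> G\<close>; it sends \<open>x \<otimes> y\<close> to the sum of
  \<open>x y1 \<otimes> y2\<close>. It is bijective exactly when an antipode exists, and the two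
  implications are the next two results.\<close>

definition \<Psi> :: "'k mat" where
  "\<Psi> = (m \<otimes>\<^sub>m 1\<^sub>m n) * (1\<^sub>m n \<otimes>\<^sub>m D)"

lemma \<Psi>_dims [simp]: "dim_row \<Psi> = n * n" "dim_col \<Psi> = n * n"
  by (simp_all add: \<Psi>_def)

text \<open>The proposed inverse is the comorphism of \<open>(g, h) -> (g, g^-1 h)\<close>.
  Coassociativity and associativity bring \<open>S\<close> next to the factor it cancels.\<close>

lemma \<Psi>_right_inverse:
  assumes S: "S \<in> carrier_mat n n" and anti: "m * (S \<otimes>\<^sub>m 1\<^sub>m n) * D = u * e"
  shows "\<Psi> * ((m \<otimes>\<^sub>m 1\<^sub>m n) * (1\<^sub>m n \<otimes>\<^sub>m ((S \<otimes>\<^sub>m 1\<^sub>m n) * D))) = 1\<^sub>m (n * n)"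
proof -
  let ?I = "1\<^sub>m n :: 'k mat"
  note [simp] = carrier_matD[OF S]
  define Z where "Z = (S \<otimes>\<^sub>m ?I) * D"
  have [simp]: "dim_row Z = n * n" "dim_col Z = n" by (simp_all add: Z_def)
  have mZ: "m * Z = u * e" using anti by (simp add: Z_def mat_assoc)
  have "(Z \<otimes>\<^sub>m ?I) * D = ((S \<otimes>\<^sub>m ?I) \<otimes>\<^sub>m ?I) * ((D \<otimes>\<^sub>m ?I) * D)"
    by (simp add: Z_def kron_mult_pull)
  also have "\<dots> = (S \<otimes>\<^sub>m D) * D"
    unfolding D_coassoc by (simp add: kron_assoc kron_one kron_mult_pull)
  also have "\<dots> = (?I \<otimes>\<^sub>m D) * Z" by (simp add: Z_def kron_mult_pull)
  finally have hZ: "(?I \<otimes>\<^sub>m D) * Z = (Z \<otimes>\<^sub>m ?I) * D" by simp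
  have "\<Psi> * ((m \<otimes>\<^sub>m ?I) * (?I \<otimes>\<^sub>m Z)) = (m \<otimes>\<^sub>m ?I) * ((?I \<otimes>\<^sub>m D) * ((m \<otimes>\<^sub>m ?I) * (?I \<otimes>\<^sub>m Z)))"
    by (simp add: \<Psi>_def mat_assoc)
  also have "(?I \<otimes>\<^sub>m D) * ((m \<otimes>\<^sub>m ?I) * (?I \<otimes>\<^sub>m Z)) = (m \<otimes>\<^sub>m 1\<^sub>m (n * n)) * ((1\<^sub>m (n * n) \<otimes>\<^sub>m D) * (?I \<otimes>\<^sub>m Z))"
    by (simp add: kron_mult_pull)
  also have "(1\<^sub>m (n * n) \<otimes>\<^sub>m D) * (?I \<otimes>\<^sub>m Z) = ?I \<otimes>\<^sub>m ((Z \<otimes>\<^sub>m ?I) * D)"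
    by (simp add: kron_one_split kron_assoc kron_mult hZ)
  also have "m \<otimes>\<^sub>m 1\<^sub>m (n * n) = (m \<otimes>\<^sub>m ?I) \<otimes>\<^sub>m ?I" by (simp add: kron_assoc kron_one)
  also have "(m \<otimes>\<^sub>m ?I) * (((m \<otimes>\<^sub>m ?I) \<otimes>\<^sub>m ?I) * (?I \<otimes>\<^sub>m ((Z \<otimes>\<^sub>m ?I) * D))) =
      (m \<otimes>\<^sub>m ?I) * (((?I \<otimes>\<^sub>m m) \<otimes>\<^sub>m ?I) * (?I \<otimes>\<^sub>m ((Z \<otimes>\<^sub>m ?I) * D)))"
    by (simp add: kron_mult_pull m_assoc mult.assoc)
  also have "((?I \<otimes>\<^sub>m m) \<otimes>\<^sub>m ?I) * (?I \<otimes>\<^sub>m ((Z \<otimes>\<^sub>m ?I) * D)) = ?I \<otimes>\<^sub>m (((u * e) \<otimes>\<^sub>m ?I) * D)"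
    by (simp add: kron_assoc kron_mult kron_mult_pull mZ)
  also have "((u * e) \<otimes>\<^sub>m ?I) * D = (u \<otimes>\<^sub>m ?I) * ((e \<otimes>\<^sub>m ?I) * D)" by (simp add: kron_mult_pull)
  also have "\<dots> = u \<otimes>\<^sub>m ?I" by (simp add: counit_left)
  also have "(m \<otimes>\<^sub>m ?I) * (?I \<otimes>\<^sub>m (u \<otimes>\<^sub>m ?I)) = 1\<^sub>m (n * n)"
    by (simp add: kron_assoc[symmetric] kron_mult unit_right kron_one)
  finally show ?thesis by (simp add: Z_def)
qed

text \<open>The inverse shear sends \<open>(g, 1)\<close> to \<open>(g, g^-1)\<close>;
  \<open>S\<close> is the second component of this, obtained by feeding \<open>1 \<otimes> y\<close>
  into \<open>P\<close> and applying the counit to the second factor.\<close>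

lemma antipode_exists:
  assumes P: "P \<in> carrier_mat (n * n) (n * n)" and inv: "\<Psi> * P = 1\<^sub>m (n * n)"
  shows "\<exists>S. S \<in> carrier_mat n n \<and> m * (S \<otimes>\<^sub>m 1\<^sub>m n) * D = u * e \<and> m * (1\<^sub>m n \<otimes>\<^sub>m S) * D = u * e"
proof -
  let ?I = "1\<^sub>m n :: 'k mat"
  note [simp] = carrier_matD[OF P]
  have \<Psi>: "\<Psi> \<in> carrier_mat (n * n) (n * n)" by (intro carrier_matI) simp_all
  have inv': "P * \<Psi> = 1\<^sub>m (n * n)" by (rule left_inverse_square[OF P \<Psi> inv])
  define S where "S = (?I \<otimes>\<^sub>m e) * (P * (u \<otimes>\<^sub>m ?I))"
  have [simp]: "dim_row S = n" "dim_col S = n" by (simp_all add: S_def)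
  \<comment> \<open>Linearity of the shear over the first tensor factor. It passes to the inverse
    \<open>P\<close>, which is therefore determined by its values on
    \<open>1 \<otimes> y\<close>.\<close>
  have m\<Psi>: "\<Psi> * (m \<otimes>\<^sub>m ?I) = (m \<otimes>\<^sub>m ?I) * (?I \<otimes>\<^sub>m \<Psi>)"
  proof -
    have "\<Psi> * (m \<otimes>\<^sub>m ?I) = (m \<otimes>\<^sub>m ?I) * (m \<otimes>\<^sub>m D)" by (simp add: \<Psi>_def mat_assoc kron_mult)
    also have "m \<otimes>\<^sub>m D = ((m \<otimes>\<^sub>m ?I) \<otimes>\<^sub>m ?I) * (1\<^sub>m (n * n) \<otimes>\<^sub>m D)"
      by (simp add: kron_assoc kron_one kron_mult)
    also have "(m \<otimes>\<^sub>m ?I) * (((m \<otimes>\<^sub>m ?I) \<otimes>\<^sub>m ?I) * (1\<^sub>m (n * n) \<otimes>\<^sub>m D)) =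
        (m \<otimes>\<^sub>m ?I) * (((?I \<otimes>\<^sub>m m) \<otimes>\<^sub>m ?I) * (1\<^sub>m (n * n) \<otimes>\<^sub>m D))"
      by (simp add: kron_mult_pull m_assoc mult.assoc)
    also have "((?I \<otimes>\<^sub>m m) \<otimes>\<^sub>m ?I) * (1\<^sub>m (n * n) \<otimes>\<^sub>m D) = ?I \<otimes>\<^sub>m \<Psi>"
      by (simp add: kron_one_split kron_assoc kron_mult \<Psi>_def)
    finally show ?thesis .
  qed
  have mP: "P * (m \<otimes>\<^sub>m ?I) = (m \<otimes>\<^sub>m ?I) * (?I \<otimes>\<^sub>m P)"
  proof -
    have "P * (m \<otimes>\<^sub>m ?I) = P * ((m \<otimes>\<^sub>m ?I) * (?I \<otimes>\<^sub>m (\<Psi> * P)))"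
      by (simp add: inv kron_one mult.assoc)
    also have "\<dots> = P * (((m \<otimes>\<^sub>m ?I) * (?I \<otimes>\<^sub>m \<Psi>)) * (?I \<otimes>\<^sub>m P))"
      by (simp add: mat_assoc kron_mult)
    also have "\<dots> = (P * \<Psi>) * ((m \<otimes>\<^sub>m ?I) * (?I \<otimes>\<^sub>m P))"
      unfolding m\<Psi>[symmetric] by (simp add: mat_assoc)
    also have "\<dots> = (m \<otimes>\<^sub>m ?I) * (?I \<otimes>\<^sub>m P)" by (simp add: inv')
    finally show ?thesis .
  qed
  have eP: "(?I \<otimes>\<^sub>m e) * P = m * (?I \<otimes>\<^sub>m S)"
  proof -
    have "P = P * ((m * (?I \<otimes>\<^sub>m u)) \<otimes>\<^sub>m ?I)" by (simp add: unit_right kron_one)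
    also have "\<dots> = P * ((m \<otimes>\<^sub>m ?I) * (?I \<otimes>\<^sub>m (u \<otimes>\<^sub>m ?I)))"
      by (simp add: kron_assoc[symmetric] kron_mult)
    also have "\<dots> = (m \<otimes>\<^sub>m ?I) * (?I \<otimes>\<^sub>m (P * (u \<otimes>\<^sub>m ?I)))"
      by (simp add: mat_assoc[symmetric] mP) (simp add: mat_assoc kron_mult)
    finally have "(?I \<otimes>\<^sub>m e) * P = (?I \<otimes>\<^sub>m e) * ((m \<otimes>\<^sub>m ?I) * (?I \<otimes>\<^sub>m (P * (u \<otimes>\<^sub>m ?I))))" by simp
    also have "\<dots> = m * ((1\<^sub>m (n * n) \<otimes>\<^sub>m e) * (?I \<otimes>\<^sub>m (P * (u \<otimes>\<^sub>m ?I))))"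
      by (simp add: kron_mult_pull mult_pull[OF kron_vec(4)[of e m "n * n"]])
    also have "\<dots> = m * (?I \<otimes>\<^sub>m S)" by (simp add: kron_one_split kron_assoc kron_mult S_def)
    finally show ?thesis .
  qed
  \<comment> \<open>The shear sends \<open>1 \<otimes> y\<close> to the coproduct of
    \<open>y\<close>, so \<open>P\<close> undoes the comultiplication.\<close>
  have "\<Psi> * (u \<otimes>\<^sub>m ?I) = (m \<otimes>\<^sub>m ?I) * (u \<otimes>\<^sub>m D)" by (simp add: \<Psi>_def mat_assoc kron_mult)
  also have "u \<otimes>\<^sub>m D = (u \<otimes>\<^sub>m 1\<^sub>m (n * n)) * D" by (simp add: kron_vec)
  also have "u \<otimes>\<^sub>m 1\<^sub>m (n * n) = ((u \<otimes>\<^sub>m ?I) \<otimes>\<^sub>m ?I)" by (simp add: kron_assoc kron_one)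
  also have "(m \<otimes>\<^sub>m ?I) * (((u \<otimes>\<^sub>m ?I) \<otimes>\<^sub>m ?I) * D) = D"
    by (simp add: kron_mult_pull unit_left kron_one)
  finally have "P * D = P * (\<Psi> * (u \<otimes>\<^sub>m ?I))" by simp
  also have "\<dots> = u \<otimes>\<^sub>m ?I" by (simp add: mult_pull[OF inv'])
  finally have PD: "P * D = u \<otimes>\<^sub>m ?I" .
  have 1: "m * (?I \<otimes>\<^sub>m S) * D = u * e"
  proof -
    have "m * (?I \<otimes>\<^sub>m S) * D = (?I \<otimes>\<^sub>m e) * (P * D)" unfolding eP[symmetric] by (simp add: mat_assoc)
    also have "\<dots> = u * e" unfolding PD by (simp add: kron_mult kron_col_row)
    finally show ?thesis .
  qed
  \<comment> \<open>Commutativity and cocommutativity turn one antipode law into the other.\<close>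
  have "m * (S \<otimes>\<^sub>m ?I) * D = m * (swap n n * (S \<otimes>\<^sub>m ?I)) * D"
    using mult_pull[OF m_comm, of "S \<otimes>\<^sub>m ?I"] by simp
  also have "swap n n * (S \<otimes>\<^sub>m ?I) = (?I \<otimes>\<^sub>m S) * swap n n"
    using swap_kron[of S ?I] by simp
  also have "m * ((?I \<otimes>\<^sub>m S) * swap n n) * D = m * (?I \<otimes>\<^sub>m S) * D"
    by (simp add: mat_assoc D_cocomm)
  also note 1
  finally show ?thesis using 1 by (intro exI[of _ S]) auto
qed

end

text \<open>Every law holds after composing with one, two or three copies of the surjection
  \<open>\<pi>\<close>, which then cancel. The shears of the two bialgebras commute with
  \<open>\<pi> \<otimes> \<pi>\<close>, so a right inverse descends too; stability of the kernel of
  \<open>\<pi>\<close> under the antipode is thereby bypassed.\<close>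

lemma bialg_quotient:
  fixes m u D e :: "'k :: field mat"
  assumes "bialg n m u D e"
    and car: "\<pi> \<in> carrier_mat c n" "\<sigma> \<in> carrier_mat n c" "m' \<in> carrier_mat c (c * c)"
      "D' \<in> carrier_mat (c * c) c" "e' \<in> carrier_mat 1 c"
    and \<pi>\<sigma>: "\<pi> * \<sigma> = 1\<^sub>m c"
    and m': "m' * (\<pi> \<otimes>\<^sub>m \<pi>) = \<pi> * m" and D': "D' * \<pi> = (\<pi> \<otimes>\<^sub>m \<pi>) * D" and e': "e' * \<pi> = e"
  shows "bialg c m' (\<pi> * u) D' e'"
    "P \<in> carrier_mat (n * n) (n * n) \<Longrightarrow> bialg.\<Psi> n m D * P = 1\<^sub>m (n * n) \<Longrightarrow>
       bialg.\<Psi> c m' D' * ((\<pi> \<otimes>\<^sub>m \<pi>) * P * (\<sigma> \<otimes>\<^sub>m \<sigma>)) = 1\<^sub>m (c * c)"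
proof -
  interpret bialg n m u D e by fact
  note [simp] = carrier_matD[OF car(1)] carrier_matD[OF car(2)] carrier_matD[OF car(3)]
    carrier_matD[OF car(4)] carrier_matD[OF car(5)]
  let ?I = "1\<^sub>m n :: 'k mat" and ?J = "1\<^sub>m c :: 'k mat"
  have \<pi>\<sigma>2: "(\<pi> \<otimes>\<^sub>m \<pi>) * (\<sigma> \<otimes>\<^sub>m \<sigma>) = 1\<^sub>m (c * c)" by (simp add: kron_mult \<pi>\<sigma> kron_one)
  have \<pi>\<sigma>3: "(\<pi> \<otimes>\<^sub>m (\<pi> \<otimes>\<^sub>m \<pi>)) * (\<sigma> \<otimes>\<^sub>m (\<sigma> \<otimes>\<^sub>m \<sigma>)) = 1\<^sub>m (c * (c * c))" by (simp add: kron_mult \<pi>\<sigma> kron_one)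
  have ml: "((m' \<otimes>\<^sub>m ?J) * (\<pi> \<otimes>\<^sub>m (\<pi> \<otimes>\<^sub>m \<pi>))) = (\<pi> \<otimes>\<^sub>m \<pi>) * (m \<otimes>\<^sub>m ?I)"
    by (simp add: kron_assoc[symmetric] kron_mult m')
  have mr: "((?J \<otimes>\<^sub>m m') * (\<pi> \<otimes>\<^sub>m (\<pi> \<otimes>\<^sub>m \<pi>))) = (\<pi> \<otimes>\<^sub>m \<pi>) * (?I \<otimes>\<^sub>m m)"
    by (simp add: kron_mult m')
  have Dl: "(D' \<otimes>\<^sub>m ?J) * (\<pi> \<otimes>\<^sub>m \<pi>) = (\<pi> \<otimes>\<^sub>m (\<pi> \<otimes>\<^sub>m \<pi>)) * (D \<otimes>\<^sub>m ?I)"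
    by (simp add: kron_assoc[symmetric] kron_mult D')
  have Dr: "(?J \<otimes>\<^sub>m D') * (\<pi> \<otimes>\<^sub>m \<pi>) = (\<pi> \<otimes>\<^sub>m (\<pi> \<otimes>\<^sub>m \<pi>)) * (?I \<otimes>\<^sub>m D)"
    by (simp add: kron_mult D')
  have sw: "swap c c * (\<pi> \<otimes>\<^sub>m \<pi>) = (\<pi> \<otimes>\<^sub>m \<pi>) * swap n n" using swap_kron[of \<pi> \<pi>] by simp
  show "bialg c m' (\<pi> * u) D' e'"
  proof
    show "m' * (m' \<otimes>\<^sub>m ?J) = m' * (?J \<otimes>\<^sub>m m')"
      by (rule right_cancel[OF _ \<pi>\<sigma>3])
         (simp_all add: mat_assoc ml mr mult_pull[OF m'] m_assoc mult.assoc)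
    have "m' * ((\<pi> * u) \<otimes>\<^sub>m ?J) * \<pi> = m' * ((\<pi> \<otimes>\<^sub>m \<pi>) * (u \<otimes>\<^sub>m ?I))"
      by (simp add: mat_assoc kron_vec kron_mult)
    also have "\<dots> = ?J * \<pi>" by (simp add: mult_pull[OF m'] unit_left mat_assoc)
    finally show "m' * ((\<pi> * u) \<otimes>\<^sub>m ?J) = ?J" by (rule right_cancel[OF _ \<pi>\<sigma>]) simp_all
    have "m' * (?J \<otimes>\<^sub>m (\<pi> * u)) * \<pi> = m' * ((\<pi> \<otimes>\<^sub>m \<pi>) * (?I \<otimes>\<^sub>m u))"
      by (simp add: mat_assoc kron_vec kron_mult)
    also have "\<dots> = ?J * \<pi>" by (simp add: mult_pull[OF m'] unit_right mat_assoc)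
    finally show "m' * (?J \<otimes>\<^sub>m (\<pi> * u)) = ?J" by (rule right_cancel[OF _ \<pi>\<sigma>]) simp_all
    show "m' * swap c c = m'"
      by (rule right_cancel[OF _ \<pi>\<sigma>2]) (simp_all add: mat_assoc sw mult_pull[OF m'] m_comm m')
    have "(D' \<otimes>\<^sub>m ?J) * D' * \<pi> = (\<pi> \<otimes>\<^sub>m (\<pi> \<otimes>\<^sub>m \<pi>)) * ((D \<otimes>\<^sub>m ?I) * D)"
      by (simp add: mat_assoc D' mult_pull[OF Dl] mult.assoc)
    also have "\<dots> = (?J \<otimes>\<^sub>m D') * D' * \<pi>"
      unfolding D_coassoc by (simp add: mat_assoc D' mult_pull[OF Dr] mult.assoc)
    finally show "(D' \<otimes>\<^sub>m ?J) * D' = (?J \<otimes>\<^sub>m D') * D'"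
      by (rule right_cancel[OF _ \<pi>\<sigma>]) simp_all
    have "(e' \<otimes>\<^sub>m ?J) * D' * \<pi> = (e \<otimes>\<^sub>m \<pi>) * D" by (simp add: mat_assoc D' kron_mult_pull e')
    also have "\<dots> = \<pi> * ((e \<otimes>\<^sub>m ?I) * D)" by (simp add: mat_assoc[symmetric] kron_vec)
    also have "\<dots> = ?J * \<pi>" by (simp add: counit_left)
    finally show "(e' \<otimes>\<^sub>m ?J) * D' = ?J" by (rule right_cancel[OF _ \<pi>\<sigma>]) simp_all
    have "(?J \<otimes>\<^sub>m e') * D' * \<pi> = (\<pi> \<otimes>\<^sub>m e) * D" by (simp add: mat_assoc D' kron_mult_pull e')
    also have "\<dots> = \<pi> * ((?I \<otimes>\<^sub>m e) * D)" by (simp add: mat_assoc[symmetric] kron_vec)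
    also have "\<dots> = ?J * \<pi>" by (simp add: counit_right)
    finally show "(?J \<otimes>\<^sub>m e') * D' = ?J" by (rule right_cancel[OF _ \<pi>\<sigma>]) simp_all
    show "swap c c * D' = D'"
      by (rule right_cancel[OF _ \<pi>\<sigma>]) (simp_all add: mat_assoc D' mult_pull[OF sw] D_cocomm)
    have "D' * m' * (\<pi> \<otimes>\<^sub>m \<pi>) = (\<pi> \<otimes>\<^sub>m \<pi>) * ((m \<otimes>\<^sub>m m) * ((?I \<otimes>\<^sub>m swap n n \<otimes>\<^sub>m ?I) * (D \<otimes>\<^sub>m D)))"
      by (simp add: mat_assoc m' mult_pull[OF D'] D_m mult.assoc)
    also have "\<dots> = (m' \<otimes>\<^sub>m m') * (((\<pi> \<otimes>\<^sub>m \<pi>) \<otimes>\<^sub>m (\<pi> \<otimes>\<^sub>m \<pi>)) * ((?I \<otimes>\<^sub>m swap n n \<otimes>\<^sub>m ?I) * (D \<otimes>\<^sub>m D)))"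
      by (simp add: kron_mult_pull m' mult.assoc)
    also have "(\<pi> \<otimes>\<^sub>m \<pi>) \<otimes>\<^sub>m (\<pi> \<otimes>\<^sub>m \<pi>) = \<pi> \<otimes>\<^sub>m ((\<pi> \<otimes>\<^sub>m \<pi>) \<otimes>\<^sub>m \<pi>)" by (simp add: kron_assoc)
    also have "(\<pi> \<otimes>\<^sub>m ((\<pi> \<otimes>\<^sub>m \<pi>) \<otimes>\<^sub>m \<pi>)) * ((?I \<otimes>\<^sub>m swap n n \<otimes>\<^sub>m ?I) * (D \<otimes>\<^sub>m D)) =
       (?J \<otimes>\<^sub>m swap c c \<otimes>\<^sub>m ?J) * ((\<pi> \<otimes>\<^sub>m ((\<pi> \<otimes>\<^sub>m \<pi>) \<otimes>\<^sub>m \<pi>)) * (D \<otimes>\<^sub>m D))"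
      by (simp add: kron_mult_pull kron_mult sw mult.assoc)
    also have "\<pi> \<otimes>\<^sub>m ((\<pi> \<otimes>\<^sub>m \<pi>) \<otimes>\<^sub>m \<pi>) = (\<pi> \<otimes>\<^sub>m \<pi>) \<otimes>\<^sub>m (\<pi> \<otimes>\<^sub>m \<pi>)" by (simp add: kron_assoc)
    also have "((\<pi> \<otimes>\<^sub>m \<pi>) \<otimes>\<^sub>m (\<pi> \<otimes>\<^sub>m \<pi>)) * (D \<otimes>\<^sub>m D) = (D' \<otimes>\<^sub>m D') * (\<pi> \<otimes>\<^sub>m \<pi>)"
      by (simp add: kron_mult D')
    also have "(m' \<otimes>\<^sub>m m') * ((?J \<otimes>\<^sub>m swap c c \<otimes>\<^sub>m ?J) * ((D' \<otimes>\<^sub>m D') * (\<pi> \<otimes>\<^sub>m \<pi>))) =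
       (m' \<otimes>\<^sub>m m') * (?J \<otimes>\<^sub>m swap c c \<otimes>\<^sub>m ?J) * (D' \<otimes>\<^sub>m D') * (\<pi> \<otimes>\<^sub>m \<pi>)"
      by (simp add: mat_assoc mult.assoc)
    finally show "D' * m' = (m' \<otimes>\<^sub>m m') * (?J \<otimes>\<^sub>m swap c c \<otimes>\<^sub>m ?J) * (D' \<otimes>\<^sub>m D')"
      by (rule right_cancel[OF _ \<pi>\<sigma>2]) (simp_all add: mult.assoc)
    show "D' * (\<pi> * u) = (\<pi> * u) \<otimes>\<^sub>m (\<pi> * u)"
      by (simp add: mult_pull[OF D'] mat_assoc D_u kron_mult)
    show "e' * m' = e' \<otimes>\<^sub>m e'"
      by (rule right_cancel[OF _ \<pi>\<sigma>2]) (simp_all add: mat_assoc m' mult_pull[OF e'] e_m kron_mult e')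
    show "e' * (\<pi> * u) = 1\<^sub>m 1" using e_u by (simp add: mult_pull[OF e'])
  qed (use car u_carrier in auto)
  then interpret Q: bialg c m' "\<pi> * u" D' e' .
  assume P: "P \<in> carrier_mat (n * n) (n * n)" "\<Psi> * P = 1\<^sub>m (n * n)"
  have "Q.\<Psi> * (\<pi> \<otimes>\<^sub>m \<pi>) = (m' \<otimes>\<^sub>m ?J) * (\<pi> \<otimes>\<^sub>m ((\<pi> \<otimes>\<^sub>m \<pi>) * D))"
    by (simp add: Q.\<Psi>_def mat_assoc kron_mult D')
  also have "\<pi> \<otimes>\<^sub>m ((\<pi> \<otimes>\<^sub>m \<pi>) * D) = ((\<pi> \<otimes>\<^sub>m \<pi>) \<otimes>\<^sub>m \<pi>) * (?I \<otimes>\<^sub>m D)"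
    by (simp add: kron_assoc kron_mult)
  also have "(m' \<otimes>\<^sub>m ?J) * (((\<pi> \<otimes>\<^sub>m \<pi>) \<otimes>\<^sub>m \<pi>) * (?I \<otimes>\<^sub>m D)) = (\<pi> \<otimes>\<^sub>m \<pi>) * \<Psi>"
    by (simp add: kron_mult_pull m' \<Psi>_def mult.assoc)
  finally have Q\<Psi>: "Q.\<Psi> * (\<pi> \<otimes>\<^sub>m \<pi>) = (\<pi> \<otimes>\<^sub>m \<pi>) * \<Psi>" .
  show "Q.\<Psi> * ((\<pi> \<otimes>\<^sub>m \<pi>) * P * (\<sigma> \<otimes>\<^sub>m \<sigma>)) = 1\<^sub>m (c * c)"
    using P carrier_matD[OF P(1)] by (simp add: mat_assoc mult_pull[OF Q\<Psi>] mult_pull[OF P(2)] \<pi>\<sigma>2)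
qed

section \<open>Finite commutative group schemes\<close>

locale scheme =
  fixes G :: "'k :: field hopf"
  assumes scheme: "finite_comm_group_scheme G"
begin

sublocale bialg "order G" "mult G" "unit G" "comult G" "counit G"
  using scheme unfolding finite_comm_group_scheme_def Let_def flip_mat_swap
  by unfold_locales auto

lemma antipode_carrier: "antipode G \<in> carrier_mat (order G) (order G)"
  and antipode_left: "mult G * (antipode G \<otimes>\<^sub>m 1\<^sub>m (order G)) * comult G = unit G * counit G"
  and antipode_right: "mult G * (1\<^sub>m (order G) \<otimes>\<^sub>m antipode G) * comult G = unit G * counit G"
  using scheme unfolding finite_comm_group_scheme_def Let_def by auto

lemma \<Psi>_invertible:
  obtains P where "P \<in> carrier_mat (order G * order G) (order G * order G)" "\<Psi> * P = 1\<^sub>m (order G * order G)"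
  using \<Psi>_right_inverse[OF antipode_carrier antipode_left] carrier_matD[OF antipode_carrier]
  by (intro that[of "(mult G \<otimes>\<^sub>m 1\<^sub>m (order G)) *
    (1\<^sub>m (order G) \<otimes>\<^sub>m ((antipode G \<otimes>\<^sub>m 1\<^sub>m (order G)) * comult G))"] carrier_matI) simp_all

lemma order_pos: "order G > 0"
proof (rule ccontr)
  assume "\<not> order G > 0"
  hence "(counit G * unit G) $$ (0, 0) = 0" by (simp add: mat_mult_index del: index_mult_mat(1))
  thus False using e_u by simp
qed

end

lemma scheme_of_bialg:
  assumes "bialg n m u D e" "P \<in> carrier_mat (n * n) (n * n)" "bialg.\<Psi> n m D * P = 1\<^sub>m (n * n)"
  obtains S where "finite_comm_group_scheme \<lparr>order = n, mult = m, unit = u, comult = D, counit = e, antipode = S\<rparr>"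
proof -
  interpret bialg n m u D e by fact
  obtain S where S: "S \<in> carrier_mat n n" "m * (S \<otimes>\<^sub>m 1\<^sub>m n) * D = u * e" "m * (1\<^sub>m n \<otimes>\<^sub>m S) * D = u * e"
    using antipode_exists assms by blast
  show thesis
    by (rule that[of S])
      (use S m_carrier u_carrier D_carrier e_carrier m_assoc unit_left unit_right m_comm D_coassoc
        counit_left counit_right D_cocomm D_m D_u e_m e_u
       in \<open>simp add: finite_comm_group_scheme_def Let_def flip_mat_swap\<close>)
qed

section \<open>Homomorphisms, closed subgroups and images\<close>

lemma gs_homD:
  assumes "f \<in> gs_hom G H"
  shows "f \<in> carrier_mat (order G) (order H)" "f * mult H = mult G * (f \<otimes>\<^sub>m f)" "f * unit H = unit G"
    "comult G * f = (f \<otimes>\<^sub>m f) * comult H" "counit G * f = counit H"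
  using assms by (auto simp: gs_hom_def)

lemma gs_hom_dims:
  assumes "f \<in> gs_hom G H"
  shows "dim_row f = order G" "dim_col f = order H"
  using gs_homD(1)[OF assms] by auto

lemma gs_homI:
  assumes "f \<in> carrier_mat (order G) (order H)" "f * mult H = mult G * (f \<otimes>\<^sub>m f)" "f * unit H = unit G"
    "comult G * f = (f \<otimes>\<^sub>m f) * comult H" "counit G * f = counit H"
  shows "f \<in> gs_hom G H"
  using assms by (auto simp: gs_hom_def)

lemma gs_id_hom: "finite_comm_group_scheme G \<Longrightarrow> gs_id G \<in> gs_hom G G"
proof -
  assume "finite_comm_group_scheme G"
  then interpret scheme G by unfold_locales
  show ?thesis by (rule gs_homI) (simp_all add: gs_id_def kron_one)
qed

lemma gs_comp_hom:
  assumes "finite_comm_group_scheme G" "finite_comm_group_scheme H" "finite_comm_group_scheme K"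
    and f: "f \<in> gs_hom G H" and g: "g \<in> gs_hom H K"
  shows "g \<circ>\<^sub>g f \<in> gs_hom G K"
proof -
  interpret G: scheme G + H: scheme H + K: scheme K using assms by unfold_locales
  note F = gs_homD[OF f] and K = gs_homD[OF g]
  note [simp] = gs_hom_dims[OF f] gs_hom_dims[OF g]
  show ?thesis unfolding gs_comp_def
    by (rule gs_homI)
      (simp_all add: mat_assoc K kron_mult kron_mult_pull mult_pull[OF F(2)] mult_pull[OF F(4)] mult_pull[OF F(5)] F(3)
        mult_carrier_mat[OF F(1) K(1)])
qed

lemma gs_zero_hom:
  assumes "finite_comm_group_scheme G" "finite_comm_group_scheme H"
  shows "gs_zero G H \<in> gs_hom G H"
proof -
  interpret G: scheme G + H: scheme H using assms by unfold_locales
  have "(unit G * counit H) * mult H = unit G * (counit H \<otimes>\<^sub>m counit H)" by (simp add: mat_assoc H.e_m)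
  also have "\<dots> = mult G * ((unit G * counit H) \<otimes>\<^sub>m (unit G * counit H))"
  proof -
    have "mult G * ((unit G * counit H) \<otimes>\<^sub>m (unit G * counit H)) =
        mult G * ((unit G \<otimes>\<^sub>m 1\<^sub>m (order G)) * (1\<^sub>m 1 \<otimes>\<^sub>m unit G) * (counit H \<otimes>\<^sub>m counit H))"
      by (simp add: kron_mult mat_assoc kron_mult_pull kron_vec del: kron_one1)
    also have "\<dots> = unit G * (counit H \<otimes>\<^sub>m counit H)"
      by (simp add: mat_assoc mult_pull[OF G.unit_left])
    finally show ?thesis by simp
  qed
  finally have 1: "(unit G * counit H) * mult H = mult G * ((unit G * counit H) \<otimes>\<^sub>m (unit G * counit H))" .
  have "(counit H \<otimes>\<^sub>m counit H) * comult H = counit H * ((counit H \<otimes>\<^sub>m 1\<^sub>m (order H)) * comult H)"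
    by (simp add: mat_assoc[symmetric] kron_vec)
  hence 2: "(counit H \<otimes>\<^sub>m counit H) * comult H = counit H" by (simp add: H.counit_left)
  show ?thesis unfolding gs_zero_def
    by (rule gs_homI) (simp_all add: 1 mat_assoc H.e_u[simplified] mult_pull[OF G.D_u] G.e_u kron_mult[symmetric] 2
        mult_pull[OF G.e_u] carrier_matI)
qed

text \<open>The comorphism \<open>\<pi>\<close> is surjective, so the bialgebra laws for a linear
  factor \<open>t\<close> may be checked after composing with it. Linear factorizations through
  closed subgroups are thus automatically homomorphisms.\<close>

lemma hom_cancel_mono:
  assumes "finite_comm_group_scheme T" "finite_comm_group_scheme I" "finite_comm_group_scheme H"
    and \<pi>: "\<pi> \<in> gs_hom I H" and \<sigma>: "\<sigma> \<in> carrier_mat (order H) (order I)" "\<pi> * \<sigma> = 1\<^sub>m (order I)"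
    and t: "t \<in> carrier_mat (order T) (order I)" and t\<pi>: "t * \<pi> \<in> gs_hom T H"
  shows "t \<in> gs_hom T I"
proof -
  interpret T: scheme T + I: scheme I + H: scheme H using assms by unfold_locales
  note P = gs_homD[OF \<pi>] and Q = gs_homD[OF t\<pi>]
  note [simp] = gs_hom_dims[OF \<pi>] carrier_matD[OF t] carrier_matD[OF \<sigma>(1)]
  have \<sigma>2: "(\<pi> \<otimes>\<^sub>m \<pi>) * (\<sigma> \<otimes>\<^sub>m \<sigma>) = 1\<^sub>m (order I * order I)" by (simp add: kron_mult \<sigma> kron_one)
  show ?thesis
  proof (rule gs_homI)
    show "t * mult I = mult T * (t \<otimes>\<^sub>m t)"
      by (rule right_cancel[OF _ \<sigma>2]) (use Q(2) in \<open>simp_all add: mat_assoc P(2) kron_mult\<close>)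
    show "t * unit I = unit T" using Q(3) by (simp add: mat_assoc P(3))
    show "comult T * t = (t \<otimes>\<^sub>m t) * comult I"
      by (rule right_cancel[OF _ \<sigma>(2)]) (use Q(4) in \<open>simp_all add: mat_assoc P(4) kron_mult_pull\<close>)
    show "counit T * t = counit I"
      by (rule right_cancel[OF _ \<sigma>(2)]) (use Q(5) in \<open>simp_all add: mat_assoc P(5)\<close>)
  qed (rule t)
qed

text \<open>Invariance under the idempotent \<open>\<sigma> * \<pi>\<close> expresses that the
  kernel of \<open>\<pi>\<close> is a bi-ideal. Structure maps on the quotient are obtained by
  lifting along \<open>\<sigma>\<close>.\<close>

lemma quotient_scheme:
  assumes G: "finite_comm_group_scheme G"
    and car: "\<pi> \<in> carrier_mat c (order G)" "\<sigma> \<in> carrier_mat (order G) c" and \<pi>\<sigma>: "\<pi> * \<sigma> = 1\<^sub>m c"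
    and m: "\<pi> * mult G * ((\<sigma> * \<pi>) \<otimes>\<^sub>m (\<sigma> * \<pi>)) = \<pi> * mult G"
    and D: "(\<pi> \<otimes>\<^sub>m \<pi>) * comult G * (\<sigma> * \<pi>) = (\<pi> \<otimes>\<^sub>m \<pi>) * comult G"
    and e: "counit G * (\<sigma> * \<pi>) = counit G"
  obtains Q where "finite_comm_group_scheme Q" "order Q = c" "\<pi> \<in> gs_hom Q G"
proof -
  interpret G: scheme G using G by unfold_locales
  note [simp] = carrier_matD[OF car(1)] carrier_matD[OF car(2)]
  define m' where "m' = \<pi> * mult G * (\<sigma> \<otimes>\<^sub>m \<sigma>)"
  define D' where "D' = (\<pi> \<otimes>\<^sub>m \<pi>) * comult G * \<sigma>"
  define e' where "e' = counit G * \<sigma>"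
  have c': "m' \<in> carrier_mat c (c * c)" "D' \<in> carrier_mat (c * c) c" "e' \<in> carrier_mat 1 c"
    by (rule carrier_matI; simp add: m'_def D'_def e'_def)+
  have mp: "m' * (\<pi> \<otimes>\<^sub>m \<pi>) = \<pi> * mult G" using m by (simp add: m'_def mat_assoc kron_mult)
  have Dp: "D' * \<pi> = (\<pi> \<otimes>\<^sub>m \<pi>) * comult G" using D by (simp add: D'_def mat_assoc)
  have ep: "e' * \<pi> = counit G" using e by (simp add: e'_def mat_assoc)
  note q = bialg_quotient[OF G.bialg_axioms car c' \<pi>\<sigma> mp Dp ep]
  obtain P where P: "P \<in> carrier_mat (order G * order G) (order G * order G)"
    "G.\<Psi> * P = 1\<^sub>m (order G * order G)" by (rule G.\<Psi>_invertible)
  have "(\<pi> \<otimes>\<^sub>m \<pi>) * P * (\<sigma> \<otimes>\<^sub>m \<sigma>) \<in> carrier_mat (c * c) (c * c)" by (rule carrier_matI) simp_all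
  then obtain S where S: "finite_comm_group_scheme \<lparr>order = c, mult = m', unit = \<pi> * unit G,
      comult = D', counit = e', antipode = S\<rparr>"
    by (rule scheme_of_bialg[OF q(1) _ q(2)[OF P]])
  show thesis by (rule that[OF S]) (use car mp Dp ep in \<open>auto simp: gs_hom_def\<close>)
qed

text \<open>Surjectivity of the comorphism, just as \<open>quotient_map\<close> is its injectivity.
  Over a field both amount to a one-sided inverse that is only linear, not a homomorphism.\<close>

definition closed_emb :: "'k :: field hopf \<Rightarrow> 'k hopf \<Rightarrow> 'k mat \<Rightarrow> bool" where
  "closed_emb K G f \<longleftrightarrow> f \<in> gs_hom K G \<and> (\<exists>\<sigma> \<in> carrier_mat (order G) (order K). f * \<sigma> = 1\<^sub>m (order K))"

definition quotient_map :: "'k :: field hopf \<Rightarrow> 'k hopf \<Rightarrow> 'k mat \<Rightarrow> bool" where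
  "quotient_map G H f \<longleftrightarrow> f \<in> gs_hom G H \<and> (\<exists>l \<in> carrier_mat (order H) (order G). l * f = 1\<^sub>m (order H))"

text \<open>The image is cut out by the kernel of the comorphism. A rank factorization
  \<open>f = \<iota> * \<pi>\<close> yields it; that this kernel is a bi-ideal is checked after the
  injective \<open>\<iota>\<close>, where the laws for \<open>f\<close> apply.\<close>

lemma image_factorization:
  assumes G: "finite_comm_group_scheme G" and H: "finite_comm_group_scheme H" and f: "f \<in> gs_hom G H"
  obtains I q i where "finite_comm_group_scheme I" "quotient_map G I q" "closed_emb I H i" "f = i \<circ>\<^sub>g q"
proof -
  interpret G: scheme G + H: scheme H using G H by unfold_locales
  note F = gs_homD[OF f]
  obtain c \<iota> \<pi> \<sigma> l where car: "\<iota> \<in> carrier_mat (order G) c" "\<pi> \<in> carrier_mat c (order H)"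
      "\<sigma> \<in> carrier_mat (order H) c" "l \<in> carrier_mat c (order G)"
    and eq: "f = \<iota> * \<pi>" "\<pi> * \<sigma> = 1\<^sub>m c" "l * \<iota> = 1\<^sub>m c"
    by (rule rank_factorization[OF F(1)])
  note [simp] = carrier_matD[OF car(1)] carrier_matD[OF car(2)] carrier_matD[OF car(3)] carrier_matD[OF car(4)]
    gs_hom_dims[OF f]
  have fE: "f * (\<sigma> * \<pi>) = f" using eq by (simp add: mat_assoc mult_pull[OF eq(2)])
  have l2: "(l \<otimes>\<^sub>m l) * (\<iota> \<otimes>\<^sub>m \<iota>) = 1\<^sub>m (c * c)" by (simp add: kron_mult eq(3) kron_one)
  have f2: "f \<otimes>\<^sub>m f = (\<iota> \<otimes>\<^sub>m \<iota>) * (\<pi> \<otimes>\<^sub>m \<pi>)" by (simp add: eq(1) kron_mult)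
  have m: "\<pi> * mult H * ((\<sigma> * \<pi>) \<otimes>\<^sub>m (\<sigma> * \<pi>)) = \<pi> * mult H"
  proof (rule left_cancel[OF _ eq(3)])
    have "\<iota> * (\<pi> * mult H * ((\<sigma> * \<pi>) \<otimes>\<^sub>m (\<sigma> * \<pi>))) = f * mult H * ((\<sigma> * \<pi>) \<otimes>\<^sub>m (\<sigma> * \<pi>))"
      by (simp add: eq(1) mat_assoc)
    also have "\<dots> = f * mult H" unfolding F(2) by (simp add: mat_assoc kron_mult fE)
    finally show "\<iota> * (\<pi> * mult H * ((\<sigma> * \<pi>) \<otimes>\<^sub>m (\<sigma> * \<pi>))) = \<iota> * (\<pi> * mult H)"
      by (simp add: eq(1) mat_assoc)
  qed simp_all
  have D: "(\<pi> \<otimes>\<^sub>m \<pi>) * comult H * (\<sigma> * \<pi>) = (\<pi> \<otimes>\<^sub>m \<pi>) * comult H"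
  proof (rule left_cancel[OF _ l2])
    have "(\<iota> \<otimes>\<^sub>m \<iota>) * ((\<pi> \<otimes>\<^sub>m \<pi>) * comult H * (\<sigma> * \<pi>)) = (f \<otimes>\<^sub>m f) * comult H * (\<sigma> * \<pi>)"
      unfolding f2 by (simp add: mat_assoc del: kron_mult)
    also have "\<dots> = (f \<otimes>\<^sub>m f) * comult H" unfolding F(4)[symmetric] by (simp add: mat_assoc fE)
    finally show "(\<iota> \<otimes>\<^sub>m \<iota>) * ((\<pi> \<otimes>\<^sub>m \<pi>) * comult H * (\<sigma> * \<pi>)) = (\<iota> \<otimes>\<^sub>m \<iota>) * ((\<pi> \<otimes>\<^sub>m \<pi>) * comult H)"
      unfolding f2 by (simp add: mat_assoc)
  qed simp_all
  have e: "counit H * (\<sigma> * \<pi>) = counit H"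
    unfolding F(5)[symmetric] by (simp add: mat_assoc fE)
  obtain I where I: "finite_comm_group_scheme I" "order I = c" "\<pi> \<in> gs_hom I H"
    by (rule quotient_scheme[OF H car(2,3) eq(2) m D e])
  have "\<iota> \<in> gs_hom G I"
    by (rule hom_cancel_mono[OF G I(1) H I(3), of \<sigma>]) (use car eq f I(2) in auto)
  thus thesis
    by (intro that[of I \<iota> \<pi>]) (use I car eq in \<open>auto simp: quotient_map_def closed_emb_def gs_comp_def\<close>)
qed

text \<open>With \<open>\<epsilon>\<close> the counit of \<open>H\<close> and \<open>u\<close> the unit of \<open>G\<close>, the columns of \<open>aug_ideal G H f\<close> span the ideal of
  \<open>\<O>(G)\<close> generated by the image of the augmentation ideal of \<open>\<O>(H)\<close>.\<close>

definition aug_ideal :: "'k :: field hopf \<Rightarrow> 'k hopf \<Rightarrow> 'k mat \<Rightarrow> 'k mat" where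
  "aug_ideal G H f = mult G * (1\<^sub>m (order G) \<otimes>\<^sub>m (f - unit G * counit H))"

text \<open>\<open>\<pi>\<close> is the projection of O(G) modulo the augmentation ideal extended
  along \<open>f\<close>. The splitting \<open>\<sigma>\<close> and the matrix \<open>X\<close> are
  returned as well: they show that a functional vanishing on this ideal factors through
  \<open>\<pi>\<close>, which the count of fibre dimensions uses.\<close>

lemma kernel_exists:
  assumes G: "finite_comm_group_scheme G" and H: "finite_comm_group_scheme H" and f: "f \<in> gs_hom G H"
  obtains K \<pi> \<sigma> X where "is_kernel K \<pi> G H f" "\<sigma> \<in> carrier_mat (order G) (order K)" "\<pi> * \<sigma> = 1\<^sub>m (order K)"
    "X \<in> carrier_mat (order G * order H) (order G)"
    "1\<^sub>m (order G) - \<sigma> * \<pi> = aug_ideal G H f * X"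
proof -
  interpret G: scheme G + H: scheme H using G H by unfold_locales
  note F = gs_homD[OF f]
  define n b where n_def: "n = order G" and b_def: "b = order H"
  note [simp] = n_def[symmetric] b_def[symmetric]
  let ?I = "1\<^sub>m n :: 'a mat" and ?J = "1\<^sub>m b :: 'a mat"
  let ?m = "mult G" and ?u = "unit G" and ?D = "comult G" and ?e = "counit G" and ?eH = "counit H"
  note [simp] = gs_hom_dims[OF f, folded n_def b_def] G.dims[folded n_def] H.dims[folded b_def]
  define f' where "f' = f - ?u * ?eH"
  have [simp]: "dim_row f' = n" "dim_col f' = b" by (simp_all add: f'_def)
  define J where "J = ?m * (?I \<otimes>\<^sub>m f')"
  have J: "J \<in> carrier_mat n (n * b)" by (rule carrier_matI) (simp_all add: J_def)
  note [simp] = carrier_matD[OF J]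
  obtain c \<pi> \<sigma> X where car: "\<pi> \<in> carrier_mat c n" "\<sigma> \<in> carrier_mat n c" "X \<in> carrier_mat (n * b) n"
    and \<pi>\<sigma>: "\<pi> * \<sigma> = 1\<^sub>m c" and \<pi>J: "\<pi> * J = 0\<^sub>m c (n * b)" and JX: "?I - \<sigma> * \<pi> = J * X"
    by (rule cokernel_mat[OF J])
  note [simp] = carrier_matD[OF car(1)] carrier_matD[OF car(2)] carrier_matD[OF car(3)]
  define E where "E = \<sigma> * \<pi>"
  have [simp]: "dim_row E = n" "dim_col E = n" by (simp_all add: E_def)
  have E: "E = ?I - J * X" unfolding E_def by (rule minus_eq_swap[OF JX]) (rule carrier_matI; simp)+
  \<comment> \<open>Whatever vanishes on the ideal is unchanged by the idempotent \<open>E\<close>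
    and so descends to the quotient.\<close>
  have killE: "t * E = t" if "t * J = 0\<^sub>m r (n * b)" "dim_col t = n" "dim_row t = r" for t r
    unfolding E using that by (simp add: mat_minus_distrib mult_pull[OF that(1)] mat_minus_zero)
  have Ju: "J * (?u \<otimes>\<^sub>m ?J) = f'"
  proof -
    have "J * (?u \<otimes>\<^sub>m ?J) = ?m * (?u \<otimes>\<^sub>m f')" by (simp add: J_def mat_assoc kron_mult)
    also have "?u \<otimes>\<^sub>m f' = (?u \<otimes>\<^sub>m ?I) * f'" by (simp add: kron_vec)
    also have "?m * \<dots> = f'" by (simp add: mult_pull[OF G.unit_left[folded n_def]])
    finally show ?thesis .
  qed
  have "\<pi> * f' = (\<pi> * J) * (?u \<otimes>\<^sub>m ?J)" by (simp add: mat_assoc Ju)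
  hence \<pi>f': "\<pi> * f' = 0\<^sub>m c b" by (simp add: \<pi>J)
  have "\<pi> * f - \<pi> * (?u * ?eH) = 0\<^sub>m c b" using \<pi>f' by (simp add: f'_def mat_minus_distrib)
  hence \<pi>f: "\<pi> * f = \<pi> * (?u * ?eH)" by (rule mat_minus_eq_zero) (rule carrier_matI; simp)+
  \<comment> \<open>The column span of \<open>J\<close> is an ideal: by associativity a further
    multiplier is absorbed into the first tensor factor.\<close>
  have mJ: "?m * (?I \<otimes>\<^sub>m J) = J * (?m \<otimes>\<^sub>m ?J)"
  proof -
    have "?m * (?I \<otimes>\<^sub>m J) = ?m * ((?I \<otimes>\<^sub>m ?m) * ((?I \<otimes>\<^sub>m ?I) \<otimes>\<^sub>m f'))"
      by (simp add: J_def kron_mult kron_assoc)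
    also have "\<dots> = ?m * ((?m \<otimes>\<^sub>m ?I) * ((?I \<otimes>\<^sub>m ?I) \<otimes>\<^sub>m f'))"
      by (simp add: mult_pull[OF G.m_assoc[folded n_def]] mult_pull[OF refl, of ?m "?m \<otimes>\<^sub>m ?I"] mult.assoc del: kron_mult)
         (simp add: mat_assoc mult.assoc)
    also have "(?m \<otimes>\<^sub>m ?I) * ((?I \<otimes>\<^sub>m ?I) \<otimes>\<^sub>m f') = (?I \<otimes>\<^sub>m f') * (?m \<otimes>\<^sub>m ?J)"
      by (simp add: kron_mult kron_one)
    finally show ?thesis by (simp add: J_def mat_assoc)
  qed
  have m1: "\<pi> * ?m * (?I \<otimes>\<^sub>m E) = \<pi> * ?m"
  proof -
    have "\<pi> * ?m * (?I \<otimes>\<^sub>m E) = \<pi> * ?m - \<pi> * ((?m * (?I \<otimes>\<^sub>m J)) * (?I \<otimes>\<^sub>m X))"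
      unfolding E by (simp add: kron_add_left mat_minus_distrib kron_one mat_assoc kron_mult)
    also have "\<pi> * ((?m * (?I \<otimes>\<^sub>m J)) * (?I \<otimes>\<^sub>m X)) = 0\<^sub>m c (n * n)"
      unfolding mJ by (simp add: mat_assoc mult_pull[OF \<pi>J])
    finally show ?thesis by (simp add: mat_minus_zero)
  qed
  have m2: "\<pi> * ?m * (E \<otimes>\<^sub>m ?I) = \<pi> * ?m"
  proof -
    have "\<pi> * ?m * (E \<otimes>\<^sub>m ?I) = \<pi> * ((?m * swap n n) * (E \<otimes>\<^sub>m ?I))"
      by (simp add: G.m_comm[folded n_def] mat_assoc)
    also have "\<dots> = \<pi> * ?m * (?I \<otimes>\<^sub>m E) * swap n n"
      using swap_kron[of E ?I] by (simp add: mat_assoc)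
    also have "\<dots> = \<pi> * ?m" unfolding m1 by (simp add: mat_assoc G.m_comm[folded n_def])
    finally show ?thesis .
  qed
  have m: "\<pi> * ?m * (E \<otimes>\<^sub>m E) = \<pi> * ?m"
  proof -
    have "\<pi> * ?m * (E \<otimes>\<^sub>m E) = (\<pi> * ?m * (E \<otimes>\<^sub>m ?I)) * (?I \<otimes>\<^sub>m E)" by (simp add: mat_assoc kron_mult)
    thus ?thesis unfolding m2 m1 .
  qed
  define m' where "m' = \<pi> * ?m * (\<sigma> \<otimes>\<^sub>m \<sigma>)"
  have [simp]: "dim_row m' = c" "dim_col m' = c * c" by (simp_all add: m'_def)
  have m'\<pi>: "m' * (\<pi> \<otimes>\<^sub>m \<pi>) = \<pi> * ?m" using m by (simp add: m'_def mat_assoc kron_mult E_def)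
  \<comment> \<open>The coideal property on generators: after \<open>\<pi>\<close>, the map
    \<open>f\<close> becomes trivial, and so does its coproduct. \<open>DJ\<close> extends this to
    the ideal by multiplicativity of the comultiplication.\<close>
  have Df': "(\<pi> \<otimes>\<^sub>m \<pi>) * ?D * f' = 0\<^sub>m (c * c) b"
  proof -
    have "(?eH \<otimes>\<^sub>m ?eH) * comult H = ?eH * ((?eH \<otimes>\<^sub>m ?J) * comult H)"
      by (simp add: mat_assoc[symmetric] kron_vec)
    hence ee: "(?eH \<otimes>\<^sub>m ?eH) * comult H = ?eH" by (simp add: H.counit_left[folded b_def])
    have "(\<pi> \<otimes>\<^sub>m \<pi>) * ?D * f = ((\<pi> * ?u) \<otimes>\<^sub>m (\<pi> * ?u)) * ((?eH \<otimes>\<^sub>m ?eH) * comult H)"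
      by (simp add: mat_assoc F(4) kron_mult_pull \<pi>f)
    also have "\<dots> = ((\<pi> * ?u) \<otimes>\<^sub>m (\<pi> * ?u)) * ?eH" unfolding ee ..
    also have "\<dots> = (\<pi> \<otimes>\<^sub>m \<pi>) * ?D * (?u * ?eH)"
      by (simp add: mat_assoc mult_pull[OF G.D_u] kron_mult_pull)
    finally show ?thesis unfolding f'_def by (simp add: mat_minus_distrib mat_minus_zero)
  qed
  have DJ: "(\<pi> \<otimes>\<^sub>m \<pi>) * ?D * J = 0\<^sub>m (c * c) (n * b)"
  proof -
    have "(\<pi> \<otimes>\<^sub>m \<pi>) * ?D * J = (\<pi> \<otimes>\<^sub>m \<pi>) * ((?D * ?m) * (?I \<otimes>\<^sub>m f'))" by (simp add: J_def mat_assoc)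
    also have "\<dots> = ((\<pi> * ?m) \<otimes>\<^sub>m (\<pi> * ?m)) * ((?I \<otimes>\<^sub>m swap n n \<otimes>\<^sub>m ?I) * (?D \<otimes>\<^sub>m (?D * f')))"
      unfolding G.D_m[folded n_def] by (simp add: mat_assoc kron_mult kron_mult_pull mult.assoc)
    also have "\<dots> = (m' \<otimes>\<^sub>m m') * (((\<pi> \<otimes>\<^sub>m \<pi>) \<otimes>\<^sub>m (\<pi> \<otimes>\<^sub>m \<pi>)) * ((?I \<otimes>\<^sub>m swap n n \<otimes>\<^sub>m ?I) * (?D \<otimes>\<^sub>m (?D * f'))))"
      by (simp add: kron_mult_pull m'\<pi> mult.assoc)
    also have "(\<pi> \<otimes>\<^sub>m \<pi>) \<otimes>\<^sub>m (\<pi> \<otimes>\<^sub>m \<pi>) = \<pi> \<otimes>\<^sub>m ((\<pi> \<otimes>\<^sub>m \<pi>) \<otimes>\<^sub>m \<pi>)" by (simp add: kron_assoc)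
    also have "(\<pi> \<otimes>\<^sub>m ((\<pi> \<otimes>\<^sub>m \<pi>) \<otimes>\<^sub>m \<pi>)) * ((?I \<otimes>\<^sub>m swap n n \<otimes>\<^sub>m ?I) * (?D \<otimes>\<^sub>m (?D * f'))) =
       (1\<^sub>m c \<otimes>\<^sub>m swap c c \<otimes>\<^sub>m 1\<^sub>m c) * ((\<pi> \<otimes>\<^sub>m ((\<pi> \<otimes>\<^sub>m \<pi>) \<otimes>\<^sub>m \<pi>)) * (?D \<otimes>\<^sub>m (?D * f')))"
      using swap_kron[of \<pi> \<pi>] by (simp add: kron_mult_pull kron_mult mult.assoc)
    also have "\<pi> \<otimes>\<^sub>m ((\<pi> \<otimes>\<^sub>m \<pi>) \<otimes>\<^sub>m \<pi>) = (\<pi> \<otimes>\<^sub>m \<pi>) \<otimes>\<^sub>m (\<pi> \<otimes>\<^sub>m \<pi>)" by (simp add: kron_assoc)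
    also have "((\<pi> \<otimes>\<^sub>m \<pi>) \<otimes>\<^sub>m (\<pi> \<otimes>\<^sub>m \<pi>)) * (?D \<otimes>\<^sub>m (?D * f')) = ((\<pi> \<otimes>\<^sub>m \<pi>) * ?D) \<otimes>\<^sub>m ((\<pi> \<otimes>\<^sub>m \<pi>) * ?D * f')"
      by (simp add: kron_mult mat_assoc)
    finally show ?thesis unfolding Df' by (simp add: mult.assoc)
  qed
  have ef': "?e * f' = 0\<^sub>m 1 b"
    by (simp add: f'_def mat_minus_distrib F(5) mult_pull[OF G.e_u] mat_minus_zero)
  have eJ: "?e * J = 0\<^sub>m 1 (n * b)"
    by (simp add: J_def mult_pull[OF G.e_m] kron_mult ef'[simplified])
  obtain K where K: "finite_comm_group_scheme K" "order K = c" "\<pi> \<in> gs_hom K G"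
  proof (rule quotient_scheme[OF G, of \<pi> c \<sigma>])
    show "\<pi> * ?m * ((\<sigma> * \<pi>) \<otimes>\<^sub>m (\<sigma> * \<pi>)) = \<pi> * ?m" using m by (simp add: E_def)
    show "(\<pi> \<otimes>\<^sub>m \<pi>) * ?D * (\<sigma> * \<pi>) = (\<pi> \<otimes>\<^sub>m \<pi>) * ?D" using killE[OF DJ] by (simp add: E_def)
    show "?e * (\<sigma> * \<pi>) = ?e" using killE[OF eJ] by (simp add: E_def)
  qed (use car \<pi>\<sigma> in auto)
  interpret K: scheme K using K by unfold_locales
  have "is_kernel K \<pi> G H f" unfolding is_kernel_def
  proof (intro conjI allI impI)
    show "finite_comm_group_scheme K" "\<pi> \<in> gs_hom K G" by fact+
    show "f \<circ>\<^sub>g \<pi> = gs_zero K H"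
      unfolding gs_comp_def gs_zero_def \<pi>f using gs_homD(3)[OF K(3)] by (simp add: mat_assoc[symmetric])
    fix T t assume "finite_comm_group_scheme T \<and> t \<in> gs_hom T G \<and> f \<circ>\<^sub>g t = gs_zero T H"
    hence T: "finite_comm_group_scheme T" and t: "t \<in> gs_hom T G" and tf: "t * f = unit T * counit H"
      by (auto simp: gs_comp_def gs_zero_def)
    interpret T: scheme T using T by unfold_locales
    note [simp] = gs_hom_dims[OF t, folded n_def]
    have "t * f' = 0\<^sub>m (order T) b"
      by (simp add: f'_def mat_minus_distrib tf mult_pull[OF gs_homD(3)[OF t]] mat_minus_zero)
    hence "t * J = 0\<^sub>m (order T) (n * b)"
      by (simp add: J_def mult_pull[OF gs_homD(2)[OF t]] kron_mult mat_assoc)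
    hence tE: "t * \<sigma> * \<pi> = t" using killE[of t] by (simp add: E_def mat_assoc)
    show "\<exists>!s. s \<in> gs_hom T K \<and> \<pi> \<circ>\<^sub>g s = t"
    proof
      have c: "t * \<sigma> \<in> carrier_mat (order T) (order K)" using K(2) by (intro carrier_matI) simp_all
      have "t * \<sigma> \<in> gs_hom T K"
        by (rule hom_cancel_mono[OF T K(1) G K(3) _ _ c]) (use car \<pi>\<sigma> K(2) tE t in simp_all)
      thus "t * \<sigma> \<in> gs_hom T K \<and> \<pi> \<circ>\<^sub>g (t * \<sigma>) = t" using tE by (simp add: gs_comp_def)
      fix s assume "s \<in> gs_hom T K \<and> \<pi> \<circ>\<^sub>g s = t"
      hence s: "s \<in> gs_hom T K" "s * \<pi> = t" by (auto simp: gs_comp_def)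
      have "s * (\<pi> * \<sigma>) = t * \<sigma>" using s(2) gs_hom_dims[OF s(1)] K(2) by (simp add: mat_assoc[symmetric])
      thus "s = t * \<sigma>" using gs_hom_dims[OF s(1)] K(2) by (simp add: \<pi>\<sigma>)
    qed
  qed
  thus thesis by (rule that) (use car \<pi>\<sigma> JX K(2) in \<open>simp_all add: J_def f'_def aug_ideal_def\<close>)
qed

text \<open>The Cartier dual: in finite dimension, transposition exchanges algebra and coalgebra,
  and the axioms are permuted among themselves.\<close>

definition dual_gs :: "'k :: field hopf \<Rightarrow> 'k hopf" where
  "dual_gs G = \<lparr>order = order G, mult = (comult G)\<^sup>T, unit = (counit G)\<^sup>T,
     comult = (mult G)\<^sup>T, counit = (unit G)\<^sup>T, antipode = (antipode G)\<^sup>T\<rparr>"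

lemma dual_gs_simps [simp]: "order (dual_gs G) = order G" "mult (dual_gs G) = (comult G)\<^sup>T"
  "unit (dual_gs G) = (counit G)\<^sup>T" "comult (dual_gs G) = (mult G)\<^sup>T" "counit (dual_gs G) = (unit G)\<^sup>T"
  "antipode (dual_gs G) = (antipode G)\<^sup>T"
  by (simp_all add: dual_gs_def)

lemma dual_dual_gs [simp]: "dual_gs (dual_gs G) = G"
  by (simp add: dual_gs_def)

lemma dual_scheme:
  assumes "finite_comm_group_scheme G"
  shows "finite_comm_group_scheme (dual_gs G)"
proof -
  interpret G: scheme G using assms by unfold_locales
  note [simp] = carrier_matD[OF G.antipode_carrier]
  note tr = arg_cong[of _ _ transpose_mat]
  note s = kron_transpose mat_transpose_mult swap_flip[symmetric] mat_assoc
  show ?thesis unfolding finite_comm_group_scheme_def Let_def flip_mat_swap dual_gs_simps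
    using tr[OF G.D_coassoc] tr[OF G.counit_left] tr[OF G.counit_right] tr[OF G.D_cocomm] tr[OF G.m_assoc]
      tr[OF G.unit_left] tr[OF G.unit_right] tr[OF G.m_comm] tr[OF G.D_m] tr[OF G.D_u] tr[OF G.e_m]
      tr[OF G.e_u] tr[OF G.antipode_left] tr[OF G.antipode_right]
      G.m_carrier G.u_carrier G.D_carrier G.e_carrier G.antipode_carrier
    by (intro conjI) (simp_all add: s mult.assoc)
qed

lemma dual_hom:
  assumes "finite_comm_group_scheme G" "finite_comm_group_scheme H" "f \<in> gs_hom G H"
  shows "f\<^sup>T \<in> gs_hom (dual_gs H) (dual_gs G)"
proof -
  interpret G: scheme G + H: scheme H using assms by unfold_locales
  note [simp] = gs_hom_dims[OF assms(3)]
  note tr = arg_cong[of _ _ transpose_mat]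
  note F = gs_homD[OF assms(3)]
  show ?thesis
    by (rule gs_homI)
      (use F(1) tr[OF F(2)] tr[OF F(3)] tr[OF F(4)] tr[OF F(5)] in
        \<open>simp_all add: kron_transpose mat_transpose_mult\<close>)
qed

section \<open>The order of a quotient\<close>

lemma kron_smult:
  fixes A B :: "'a :: comm_ring_1 mat"
  shows "A \<otimes>\<^sub>m (c \<cdot>\<^sub>m B) = c \<cdot>\<^sub>m (A \<otimes>\<^sub>m B)" "(c \<cdot>\<^sub>m A) \<otimes>\<^sub>m B = c \<cdot>\<^sub>m (A \<otimes>\<^sub>m B)"
  by (rule eq_matI; simp add: kron_index div_less_mult mod_less_mult mult_ac)+

lemma transpose_smult: "(c \<cdot>\<^sub>m A)\<^sup>T = c \<cdot>\<^sub>m A\<^sup>T"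
  by (rule eq_matI) simp_all

lemma mat_1_1:
  fixes A :: "'a :: comm_ring_1 mat"
  assumes "dim_row A = 1" "dim_col A = 1"
  shows "A = (A $$ (0, 0)) \<cdot>\<^sub>m 1\<^sub>m 1"
  by (rule eq_matI) (use assms in auto)

lemma smult_cancel:
  fixes A B :: "'a :: field mat"
  assumes "c \<cdot>\<^sub>m A = c \<cdot>\<^sub>m B" "c \<noteq> 0"
  shows "A = B"
proof -
  have d: "dim_row A = dim_row B" "dim_col A = dim_col B"
    using arg_cong[OF assms(1), of dim_row] arg_cong[OF assms(1), of dim_col] by auto
  show ?thesis
  proof (rule eq_matI)
    fix i j assume ij: "i < dim_row B" "j < dim_col B"
    have "(c \<cdot>\<^sub>m A) $$ (i, j) = (c \<cdot>\<^sub>m B) $$ (i, j)" by (simp add: assms)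
    thus "A $$ (i, j) = B $$ (i, j)" using ij d assms(2) by simp
  qed (use d in auto)
qed

lemma unit_col_kron:
  assumes "k < a * b"
  shows "unit_col (a * b) k = (unit_col a (k div b) \<otimes>\<^sub>m unit_col b (k mod b) :: 'a :: comm_semiring_1 mat)"
proof (rule eq_matI, goal_cases)
  case (1 i j)
  hence i: "i < a * b" "j = 0" by auto
  have "i = k \<longleftrightarrow> i div b = k div b \<and> i mod b = k mod b" by (metis div_mult_mod_eq)
  thus ?case using i by (simp add: kron_index div_less_mult mod_less_mult) (auto simp: unit_col_def div_less_mult mod_less_mult)
qed auto

lemma mat_eq_by_kron_cols:
  fixes M N :: "'a :: comm_semiring_1 mat"
  assumes M: "M \<in> carrier_mat r (a * b)" "N \<in> carrier_mat r (a * b)"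
    and eq: "\<And>j. j < b \<Longrightarrow> M * (1\<^sub>m a \<otimes>\<^sub>m unit_col b j) = N * (1\<^sub>m a \<otimes>\<^sub>m unit_col b j)"
  shows "M = N"
proof (rule mat_eq_by_cols[OF M])
  fix k assume k: "k < a * b"
  have "Z * unit_col (a * b) k = (Z * (1\<^sub>m a \<otimes>\<^sub>m unit_col b (k mod b))) * unit_col a (k div b)"
    if "Z \<in> carrier_mat r (a * b)" for Z :: "'a mat"
    using that k by (simp add: mat_assoc kron_vec unit_col_kron)
  thus "M * unit_col (a * b) k = N * unit_col (a * b) k"
    using M eq[of "k mod b"] mod_less_mult[OF k] by simp
qed

context bialg
begin

lemma m_comm_kron:
  assumes "dim_row P = n" "dim_row Q = n" "dim_col Q = 1"
  shows "m * (P \<otimes>\<^sub>m Q) = m * (Q \<otimes>\<^sub>m P)"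
proof -
  have "m * (P \<otimes>\<^sub>m Q) = m * (swap n n * (P \<otimes>\<^sub>m Q))" using assms by (simp add: mult_pull[OF m_comm])
  also have "swap n n * (P \<otimes>\<^sub>m Q) = Q \<otimes>\<^sub>m P" using swap_kron[of P Q] assms by simp
  finally show ?thesis .
qed

lemma m_assoc_kron:
  assumes "dim_row P = n" "dim_row Q = n" "dim_row R = n"
  shows "m * ((m * (P \<otimes>\<^sub>m Q)) \<otimes>\<^sub>m R) = m * (P \<otimes>\<^sub>m (m * (Q \<otimes>\<^sub>m R)))"
proof -
  have "m * ((m * (P \<otimes>\<^sub>m Q)) \<otimes>\<^sub>m R) = m * ((m \<otimes>\<^sub>m 1\<^sub>m n) * ((P \<otimes>\<^sub>m Q) \<otimes>\<^sub>m R))"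
    using assms by (simp add: kron_mult)
  also have "\<dots> = (m * (m \<otimes>\<^sub>m 1\<^sub>m n)) * (P \<otimes>\<^sub>m (Q \<otimes>\<^sub>m R))" using assms by (simp add: mat_assoc kron_assoc mult.assoc)
  also have "\<dots> = m * (P \<otimes>\<^sub>m (m * (Q \<otimes>\<^sub>m R)))" unfolding m_assoc using assms
    by (simp add: mat_assoc kron_mult mult.assoc)
  finally show ?thesis .
qed

end

text \<open>\<open>f\<close> is the injective comorphism of a quotient map. The kernel is the one
  built by \<open>kernel_exists\<close>, since \<open>\<sigma>\<close> and \<open>X\<^sub>0\<close>
  are used to describe its functionals; arbitrary kernels are compared with it afterwards.\<close>

locale flat_cover = G: scheme G + H: scheme H for G H :: "'k :: alg_closed_field hopf" +
  fixes f l :: "'k mat" and K :: "'k hopf" and \<pi> \<sigma> X\<^sub>0 :: "'k mat"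
  assumes f_hom: "f \<in> gs_hom G H"
    and l_carrier: "l \<in> carrier_mat (order H) (order G)" and lf: "l * f = 1\<^sub>m (order H)"
    and ker: "is_kernel K \<pi> G H f"
    and \<sigma>_carrier: "\<sigma> \<in> carrier_mat (order G) (order K)" and \<pi>\<sigma>: "\<pi> * \<sigma> = 1\<^sub>m (order K)"
    and X_carrier: "X\<^sub>0 \<in> carrier_mat (order G * order H) (order G)"
    and \<sigma>\<pi>: "1\<^sub>m (order G) - \<sigma> * \<pi> = aug_ideal G H f * X\<^sub>0"
begin

abbreviation "a \<equiv> order G"
abbreviation "b \<equiv> order H"
abbreviation "c \<equiv> order K"
abbreviation "m \<equiv> mult G"
abbreviation "u \<equiv> unit G"
abbreviation "D \<equiv> comult G"
abbreviation "e \<equiv> counit G"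

lemma \<pi>_hom: "\<pi> \<in> gs_hom K G" and K_scheme: "finite_comm_group_scheme K"
  and \<pi>f: "\<pi> * f = unit K * counit H"
  using ker by (auto simp: is_kernel_def gs_comp_def gs_zero_def)

sublocale K: scheme K using K_scheme by unfold_locales

lemmas f_eqs = gs_homD[OF f_hom]
lemmas \<pi>_eqs = gs_homD[OF \<pi>_hom]

lemma dims' [simp]: "dim_row f = a" "dim_col f = b" "dim_row l = b" "dim_col l = a"
  "dim_row \<pi> = c" "dim_col \<pi> = a" "dim_row \<sigma> = a" "dim_col \<sigma> = c"
  using gs_hom_dims[OF f_hom] gs_hom_dims[OF \<pi>_hom] l_carrier \<sigma>_carrier by auto

text \<open>Right multiplication of \<open>\<O>(G)\<close> by \<open>\<O>(H)\<close>.\<close>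

definition R :: "'k mat" where "R = m * (1\<^sub>m a \<otimes>\<^sub>m f)"

lemma R_dims [simp]: "dim_row R = a" "dim_col R = a * b" by (simp_all add: R_def)

lemma R_unit: "R * (1\<^sub>m a \<otimes>\<^sub>m unit H) = 1\<^sub>m a"
  by (simp add: R_def mat_assoc kron_mult f_eqs(3) G.unit_right)

text \<open>The dual of the fibre of O(G) over \<open>\<chi>\<close>: functionals with
  \<open>\<psi>(x f(y)) = \<psi>(x) \<chi>(y)\<close>. No multiplicativity of \<open>\<chi>\<close>
  is demanded.\<close>

definition weight_space :: "'k mat \<Rightarrow> 'k mat set" where
  "weight_space \<chi> = {\<psi> \<in> carrier_mat 1 a. \<psi> * R = \<psi> \<otimes>\<^sub>m \<chi>}"

text \<open>A nonzero functional shows that the fibre over \<open>\<chi>\<close> is a nonzero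
  finite-dimensional commutative algebra, so over an algebraically closed field it has a point. The
  point arises as the eigenvalues of all multiplication operators on a common
  eigenfunctional.\<close>

lemma extend_character:
  assumes \<chi>: "\<chi> \<in> carrier_mat 1 b" and \<psi>: "\<psi> \<in> weight_space \<chi>" "\<psi> \<noteq> 0\<^sub>m 1 a"
  obtains X where "X \<in> carrier_mat 1 a" "X * m = X \<otimes>\<^sub>m X" "X * u = 1\<^sub>m 1" "X * f = \<chi>"
proof -
  note [simp] = carrier_matD[OF \<chi>]
  let ?I = "1\<^sub>m a :: 'k mat"
  define N where "N = R - (?I \<otimes>\<^sub>m \<chi>)"
  have N: "N \<in> carrier_mat a (a * b)" by (rule carrier_matI) (simp_all add: N_def)
  note [simp] = carrier_matD[OF N]
  have Nzero: "\<phi> * R = \<phi> \<otimes>\<^sub>m \<chi>" if "\<phi> * N = 0\<^sub>m 1 (a * b)" "\<phi> \<in> carrier_mat 1 a" for \<phi>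
  proof (rule mat_minus_eq_zero)
    show "\<phi> * R - \<phi> \<otimes>\<^sub>m \<chi> = 0\<^sub>m 1 (a * b)"
      using that carrier_matD[OF that(2)] by (simp add: N_def mat_minus_distrib kron_vec)
  qed (rule carrier_matI; use that in simp)+
  have \<psi>N: "\<psi> * N = 0\<^sub>m 1 (a * b)" and \<psi>c: "\<psi> \<in> carrier_mat 1 a"
    using \<psi>(1) by (auto simp: weight_space_def N_def mat_minus_distrib kron_vec mat_minus_zero)
  obtain w \<rho> s Y where car: "\<rho> \<in> carrier_mat w a" "s \<in> carrier_mat a w" "Y \<in> carrier_mat (a * b) a"
    and \<rho>s: "\<rho> * s = 1\<^sub>m w" and \<rho>N: "\<rho> * N = 0\<^sub>m w (a * b)" and NY: "?I - s * \<rho> = N * Y"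
    by (rule cokernel_mat[OF N])
  note [simp] = carrier_matD[OF car(1)] carrier_matD[OF car(2)] carrier_matD[OF car(3)]
  have s\<rho>: "s * \<rho> = ?I - N * Y" by (rule minus_eq_swap[OF NY]) (rule carrier_matI; simp)+
  \<comment> \<open>\<open>\<psi>\<close> factors through the fibre, which has dimension
    \<open>w\<close>, and is nonzero; so \<open>w\<close> is not 0.\<close>
  have "\<psi> * (s * \<rho>) = \<psi>"
    unfolding s\<rho> using \<psi>c by (simp add: mat_minus_distrib mult_pull[OF \<psi>N] mat_minus_zero)
  moreover have "s * \<rho> = 0\<^sub>m a a" if "w = 0"
    using car that by (intro eq_matI) (auto simp: mat_mult_index simp del: index_mult_mat(1))
  ultimately have "w \<noteq> 0" using \<psi>(2) carrier_matD[OF \<psi>c] by auto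
  define S where "S j = m * (?I \<otimes>\<^sub>m unit_col a j)" for j
  have [simp]: "dim_row (S j) = a" "dim_col (S j) = a" for j by (simp_all add: S_def)
  \<comment> \<open>Multiplication by a basis vector preserves the relations defining the fibre, so
    it induces the operator \<open>T j\<close> there.\<close>
  have SN: "S j * N = N * (S j \<otimes>\<^sub>m 1\<^sub>m b)" for j
  proof -
    have "S j * R = m * (R \<otimes>\<^sub>m unit_col a j)" by (simp add: S_def mat_assoc kron_vec)
    also have "\<dots> = m * (?I \<otimes>\<^sub>m (m * (f \<otimes>\<^sub>m unit_col a j)))" unfolding R_def by (rule G.m_assoc_kron) simp_all
    also have "m * (f \<otimes>\<^sub>m unit_col a j) = m * (unit_col a j \<otimes>\<^sub>m f)" by (rule G.m_comm_kron) simp_all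
    also have "m * (?I \<otimes>\<^sub>m (m * (unit_col a j \<otimes>\<^sub>m f))) = m * (S j \<otimes>\<^sub>m f)"
      unfolding S_def by (rule G.m_assoc_kron[symmetric]) simp_all
    also have "\<dots> = R * (S j \<otimes>\<^sub>m 1\<^sub>m b)" by (simp add: R_def mat_assoc kron_mult)
    finally show ?thesis by (simp add: N_def mat_minus_distrib kron_mult kron_vec)
  qed
  have SS: "S i * S j = S j * S i" for i j
  proof -
    have *: "S i * S j = m * (?I \<otimes>\<^sub>m (m * (unit_col a j \<otimes>\<^sub>m unit_col a i)))" for i j
    proof -
      have "S i * S j = m * (S j \<otimes>\<^sub>m unit_col a i)" unfolding S_def[of i] by (simp add: mat_assoc kron_vec)
      thus ?thesis unfolding S_def using G.m_assoc_kron[of ?I "unit_col a j" "unit_col a i"] by simp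
    qed
    show ?thesis unfolding *[of i j] *[of j i] using G.m_comm_kron[of "unit_col a j" "unit_col a i"] by simp
  qed
  define T where "T j = \<rho> * S j * s" for j
  have [simp]: "dim_row (T j) = w" "dim_col (T j) = w" for j by (simp_all add: T_def)
  have T\<rho>: "T j * \<rho> = \<rho> * S j" for j
  proof -
    have "T j * \<rho> = \<rho> * S j * (s * \<rho>)" by (simp add: T_def mat_assoc)
    also have "\<dots> = \<rho> * S j - \<rho> * ((S j * N) * Y)" unfolding s\<rho> by (simp add: mat_minus_distrib mat_assoc)
    also have "\<rho> * ((S j * N) * Y) = 0\<^sub>m w a" unfolding SN by (simp add: mat_assoc mult_pull[OF \<rho>N])
    finally show ?thesis by (simp add: mat_minus_zero)
  qed
  have TT: "T i * T j = T j * T i" for i j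
  proof -
    have *: "T i * T j = \<rho> * (S i * S j) * s" for i j
      unfolding T_def[of j] by (simp add: mat_assoc mult_pull[OF T\<rho>])
    show ?thesis unfolding * SS[of i j] ..
  qed
  \<comment> \<open>An eigenvector of the transposes is a functional on the fibre; pulled back to
    O(G), it is scaled by \<open>\<theta> j\<close> under multiplication by the \<open>j\<close>-th
    basis vector.\<close>
  have "\<exists>v \<theta>. v \<in> carrier_mat w 1 \<and> v \<noteq> 0\<^sub>m w 1 \<and> (\<forall>j \<in> {..<a}. (T j)\<^sup>T * v = \<theta> j \<cdot>\<^sub>m v)"
    by (rule common_eigenvector) (use \<open>w \<noteq> 0\<close> TT in \<open>auto simp: mat_transpose_mult[symmetric] intro!: carrier_matI\<close>)
  then obtain v \<theta> where v: "v \<in> carrier_mat w 1" "v \<noteq> 0\<^sub>m w 1" "\<And>j. j < a \<Longrightarrow> (T j)\<^sup>T * v = \<theta> j \<cdot>\<^sub>m v"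
    by blast
  note [simp] = carrier_matD[OF v(1)]
  define X0 where "X0 = v\<^sup>T * \<rho>"
  have X0: "X0 \<in> carrier_mat 1 a" by (rule carrier_matI) (simp_all add: X0_def)
  note [simp] = carrier_matD[OF X0]
  have X0S: "X0 * S j = \<theta> j \<cdot>\<^sub>m X0" if "j < a" for j
  proof -
    have vT: "v\<^sup>T * T j = \<theta> j \<cdot>\<^sub>m v\<^sup>T" using arg_cong[OF v(3)[OF that], of transpose_mat]
      by (simp add: mat_transpose_mult transpose_smult)
    have "X0 * S j = v\<^sup>T * T j * \<rho>" by (simp add: X0_def mat_assoc T\<rho>)
    thus ?thesis unfolding vT by (simp add: X0_def mat_smult_mult)
  qed
  have X0_nz: "X0 \<noteq> 0\<^sub>m 1 a"
  proof
    assume "X0 = 0\<^sub>m 1 a"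
    hence "X0 * s = 0\<^sub>m 1 w" by simp
    hence "v\<^sup>T = 0\<^sub>m 1 w" by (simp add: X0_def mat_assoc \<rho>s)
    hence "v\<^sup>T\<^sup>T = 0\<^sub>m w 1" by simp
    thus False using v(2) by simp
  qed
  define \<Theta> where "\<Theta> = mat 1 a (\<lambda>(_, j). \<theta> j)"
  have \<Theta>: "\<Theta> \<in> carrier_mat 1 a" by (simp add: \<Theta>_def)
  note [simp] = carrier_matD[OF \<Theta>]
  have \<Theta>u: "\<Theta> * unit_col a j = \<theta> j \<cdot>\<^sub>m 1\<^sub>m 1" if "j < a" for j
    using that by (intro eq_matI) (auto simp: mult_unit_col \<Theta>_def simp del: index_mult_mat(1))
  have X0m: "X0 * m = X0 \<otimes>\<^sub>m \<Theta>"
  proof (rule mat_eq_by_kron_cols[of _ 1 a a])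
    fix j assume "j < a"
    thus "X0 * m * (?I \<otimes>\<^sub>m unit_col a j) = (X0 \<otimes>\<^sub>m \<Theta>) * (?I \<otimes>\<^sub>m unit_col a j)"
      using X0S[of j] by (simp add: S_def mat_assoc kron_mult \<Theta>u[simplified] kron_smult)
  qed (rule carrier_matI; simp)+
  define r where "r = (X0 * u) $$ (0, 0)"
  have r: "X0 * u = r \<cdot>\<^sub>m 1\<^sub>m 1" unfolding r_def by (rule mat_1_1) simp_all
  \<comment> \<open>Evaluation at the unit makes \<open>X0\<close> a multiple of
    \<open>\<Theta>\<close>, and the scalar is nonzero since \<open>X0\<close> is. Hence
    \<open>\<Theta>\<close> itself is multiplicative.\<close>
  have "X0 = X0 * m * (u \<otimes>\<^sub>m ?I)" by (simp add: mat_assoc G.unit_left)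
  also have "\<dots> = r \<cdot>\<^sub>m \<Theta>" unfolding X0m using r by (simp add: kron_mult kron_smult)
  finally have X0\<Theta>: "X0 = r \<cdot>\<^sub>m \<Theta>" .
  have "r \<noteq> 0" using X0_nz X0\<Theta> \<Theta> by (auto simp: smult_zero_mat intro!: eq_matI)
  have "\<Theta> * m = \<Theta> \<otimes>\<^sub>m \<Theta>"
    by (rule smult_cancel[OF _ \<open>r \<noteq> 0\<close>]) (use X0m in \<open>simp add: X0\<Theta> mat_smult_mult kron_smult\<close>)
  moreover have "\<Theta> * u = 1\<^sub>m 1"
  proof (rule smult_cancel[OF _ \<open>r \<noteq> 0\<close>])
    show "r \<cdot>\<^sub>m (\<Theta> * u) = r \<cdot>\<^sub>m 1\<^sub>m 1" using r by (simp add: X0\<Theta> mat_smult_mult)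
  qed
  moreover have "\<Theta> * f = \<chi>"
  proof (rule smult_cancel[OF _ \<open>r \<noteq> 0\<close>])
    have "X0 * N = 0\<^sub>m 1 (a * b)" by (simp add: X0_def mat_assoc \<rho>N)
    hence "X0 * R = X0 \<otimes>\<^sub>m \<chi>" by (rule Nzero[OF _ X0])
    hence "X0 * m * (?I \<otimes>\<^sub>m f) = X0 \<otimes>\<^sub>m \<chi>" by (simp add: R_def mat_assoc)
    hence "(X0 \<otimes>\<^sub>m (\<Theta> * f)) * (u \<otimes>\<^sub>m 1\<^sub>m b) = (X0 \<otimes>\<^sub>m \<chi>) * (u \<otimes>\<^sub>m 1\<^sub>m b)"
      unfolding X0m by (simp add: kron_mult)
    thus "r \<cdot>\<^sub>m (\<Theta> * f) = r \<cdot>\<^sub>m \<chi>" using r by (simp add: kron_mult kron_smult)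
  qed
  ultimately show thesis using that[of \<Theta>] \<Theta> by blast
qed

text \<open>Translation by a point \<open>X\<close> of \<open>G\<close> above \<open>\<chi>\<close> carries the weight space of \<open>\<chi>\<close> into that of the
  counit, which is the dual of \<open>\<O>(K)\<close>.\<close>

lemma weight_space_dim:
  assumes \<chi>: "\<chi> \<in> carrier_mat 1 b"
  obtains V where "V \<in> carrier_mat a c" "\<And>\<psi>. \<psi> \<in> weight_space \<chi> \<Longrightarrow> \<psi> * V = 0\<^sub>m 1 c \<Longrightarrow> \<psi> = 0\<^sub>m 1 a"
proof (cases "weight_space \<chi> \<subseteq> {0\<^sub>m 1 a}")
  case True
  \<comment> \<open>With no nonzero functional to separate, the zero matrix will do; there may be no
    point above \<open>\<chi>\<close> here.\<close>
  show thesis by (rule that[of "0\<^sub>m a c"]) (use True in auto)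
next
  case False
  then obtain \<psi>\<^sub>0 where "\<psi>\<^sub>0 \<in> weight_space \<chi>" "\<psi>\<^sub>0 \<noteq> 0\<^sub>m 1 a" by blast
  then obtain X where X: "X \<in> carrier_mat 1 a" "X * m = X \<otimes>\<^sub>m X" "X * u = 1\<^sub>m 1" "X * f = \<chi>"
    using extend_character[OF \<chi>] by metis
  note [simp] = carrier_matD[OF \<chi>] carrier_matD[OF X(1)] carrier_matD[OF G.antipode_carrier]
  let ?I = "1\<^sub>m a :: 'k mat" and ?S = "antipode G"
  \<comment> \<open>\<open>Y\<close> is the inverse of the point \<open>X\<close>, and
    \<open>\<tau>\<close>, \<open>\<tau>'\<close> are the comorphisms of the translations by
    \<open>X\<close> and \<open>Y\<close>.\<close>
  define Y where "Y = X * ?S"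
  have [simp]: "dim_row Y = 1" "dim_col Y = a" by (simp_all add: Y_def)
  define \<tau> \<tau>' where \<tau>_def: "\<tau> = (X \<otimes>\<^sub>m ?I) * D" and \<tau>'_def: "\<tau>' = (Y \<otimes>\<^sub>m ?I) * D"
  have [simp]: "dim_row \<tau> = a" "dim_col \<tau> = a" "dim_row \<tau>' = a" "dim_col \<tau>' = a"
    by (simp_all add: \<tau>_def \<tau>'_def)
  have YX: "(Y \<otimes>\<^sub>m X) * D = e"
  proof -
    have "(Y \<otimes>\<^sub>m X) * D = (X * m) * ((?S \<otimes>\<^sub>m ?I) * D)" unfolding X(2) by (simp add: Y_def kron_mult_pull)
    also have "\<dots> = X * (m * (?S \<otimes>\<^sub>m ?I) * D)" by (simp add: mat_assoc)
    also have "\<dots> = e" unfolding G.antipode_left by (simp add: mult_pull[OF X(3)])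
    finally show ?thesis .
  qed
  have \<tau>\<tau>': "\<tau> * \<tau>' = ?I"
  proof -
    have "\<tau> * \<tau>' = (X \<otimes>\<^sub>m ?I) * ((D * (Y \<otimes>\<^sub>m ?I)) * D)" by (simp add: \<tau>_def \<tau>'_def mat_assoc)
    also have "D * (Y \<otimes>\<^sub>m ?I) = (Y \<otimes>\<^sub>m 1\<^sub>m (a * a)) * (?I \<otimes>\<^sub>m D)" by (simp add: kron_mult kron_vec)
    also have "(X \<otimes>\<^sub>m ?I) * ((Y \<otimes>\<^sub>m 1\<^sub>m (a * a)) * (?I \<otimes>\<^sub>m D) * D) = ((Y \<otimes>\<^sub>m (X \<otimes>\<^sub>m ?I)) * (?I \<otimes>\<^sub>m D)) * D"
      by (simp add: mat_assoc mult_pull[OF kron_vec(3)[of Y "X \<otimes>\<^sub>m ?I" "a * a"]])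
    also have "\<dots> = ((Y \<otimes>\<^sub>m X) \<otimes>\<^sub>m ?I) * ((?I \<otimes>\<^sub>m D) * D)" by (simp add: mat_assoc kron_assoc)
    also have "\<dots> = (((Y \<otimes>\<^sub>m X) * D) \<otimes>\<^sub>m ?I) * D" unfolding G.D_coassoc[symmetric] by (simp add: kron_mult_pull)
    also have "\<dots> = ?I" unfolding YX by (rule G.counit_left)
    finally show ?thesis .
  qed
  have \<tau>'\<tau>: "\<tau>' * \<tau> = ?I"
    by (rule left_inverse_square[OF _ _ \<tau>\<tau>']) (rule carrier_matI; simp)+
  have \<tau>m: "\<tau> * m = m * (\<tau> \<otimes>\<^sub>m \<tau>)"
  proof -
    have "\<tau> * m = (X \<otimes>\<^sub>m ?I) * ((m \<otimes>\<^sub>m m) * ((?I \<otimes>\<^sub>m swap a a \<otimes>\<^sub>m ?I) * (D \<otimes>\<^sub>m D)))"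
      by (simp add: \<tau>_def mat_assoc G.D_m)
    also have "\<dots> = ((X \<otimes>\<^sub>m X) \<otimes>\<^sub>m m) * ((?I \<otimes>\<^sub>m swap a a \<otimes>\<^sub>m ?I) * (D \<otimes>\<^sub>m D))"
      by (simp add: kron_mult_pull X(2) mult.assoc)
    also have "(X \<otimes>\<^sub>m X) \<otimes>\<^sub>m m = m * (X \<otimes>\<^sub>m ((X \<otimes>\<^sub>m ?I) \<otimes>\<^sub>m ?I))"
      using kron_vec(3)[of "X \<otimes>\<^sub>m X" m "a * a"] by (simp add: kron_assoc kron_one)
    also have "m * (X \<otimes>\<^sub>m ((X \<otimes>\<^sub>m ?I) \<otimes>\<^sub>m ?I)) * ((?I \<otimes>\<^sub>m swap a a \<otimes>\<^sub>m ?I) * (D \<otimes>\<^sub>m D)) =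
       m * ((X \<otimes>\<^sub>m (((X \<otimes>\<^sub>m ?I) * swap a a) \<otimes>\<^sub>m ?I)) * (D \<otimes>\<^sub>m D))"
      by (simp add: mat_assoc kron_mult_pull kron_mult mult.assoc)
    also have "(X \<otimes>\<^sub>m ?I) * swap a a = ?I \<otimes>\<^sub>m X"
      using swap_kron[of ?I X] by simp
    also have "(X \<otimes>\<^sub>m ((?I \<otimes>\<^sub>m X) \<otimes>\<^sub>m ?I)) * (D \<otimes>\<^sub>m D) = ((X \<otimes>\<^sub>m ?I) \<otimes>\<^sub>m (X \<otimes>\<^sub>m ?I)) * (D \<otimes>\<^sub>m D)"
      by (simp add: kron_assoc)
    also have "\<dots> = \<tau> \<otimes>\<^sub>m \<tau>" by (simp add: \<tau>_def kron_mult)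
    finally show ?thesis .
  qed
  \<comment> \<open>Translation of \<open>H\<close> by the image of \<open>Y\<close>. It is
    compatible with \<open>\<tau>'\<close> through \<open>f\<close> and moves \<open>\<chi>\<close>
    to the counit.\<close>
  define \<tau>H where "\<tau>H = ((Y * f) \<otimes>\<^sub>m 1\<^sub>m b) * comult H"
  have [simp]: "dim_row \<tau>H = b" "dim_col \<tau>H = b" by (simp_all add: \<tau>H_def)
  have \<tau>'f: "\<tau>' * f = f * \<tau>H"
  proof -
    have "\<tau>' * f = ((Y * f) \<otimes>\<^sub>m f) * comult H" by (simp add: \<tau>'_def mat_assoc f_eqs(4) kron_mult_pull)
    also have "(Y * f) \<otimes>\<^sub>m f = f * ((Y * f) \<otimes>\<^sub>m 1\<^sub>m b)" by (simp add: kron_vec)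
    finally show ?thesis by (simp add: \<tau>H_def mat_assoc)
  qed
  have \<chi>\<tau>H: "\<chi> * \<tau>H = counit H"
  proof -
    have "\<chi> * \<tau>H = X * (\<tau>' * f)" unfolding X(4)[symmetric] \<tau>'f by (simp add: mat_assoc)
    also have "\<dots> = (X * (Y \<otimes>\<^sub>m ?I)) * (D * f)" by (simp add: \<tau>'_def mat_assoc)
    also have "\<dots> = (Y \<otimes>\<^sub>m X) * D * f" by (simp add: kron_vec mat_assoc)
    also have "\<dots> = counit H" unfolding YX by (rule f_eqs(5))
    finally show ?thesis .
  qed
  have R\<tau>: "R * (\<tau> \<otimes>\<^sub>m 1\<^sub>m b) = \<tau> * (R * (?I \<otimes>\<^sub>m \<tau>H))"
  proof -
    have "f = \<tau> * (\<tau>' * f)" by (simp add: mult_pull[OF \<tau>\<tau>'])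
    hence "R * (\<tau> \<otimes>\<^sub>m 1\<^sub>m b) = m * (\<tau> \<otimes>\<^sub>m (\<tau> * (\<tau>' * f)))" by (simp add: R_def mat_assoc kron_mult)
    also have "\<dots> = m * (\<tau> \<otimes>\<^sub>m \<tau>) * (?I \<otimes>\<^sub>m (f * \<tau>H))" unfolding \<tau>'f by (simp add: mat_assoc kron_mult)
    also have "\<dots> = \<tau> * (R * (?I \<otimes>\<^sub>m \<tau>H))" unfolding \<tau>m[symmetric] by (simp add: R_def mat_assoc kron_mult)
    finally show ?thesis .
  qed
  have twist: "\<psi> * \<tau>' * R = (\<psi> * \<tau>') \<otimes>\<^sub>m counit H" if \<psi>: "\<psi> \<in> weight_space \<chi>" for \<psi>
  proof (rule right_cancel)
    have [simp]: "dim_row \<psi> = 1" "dim_col \<psi> = a" and \<psi>R: "\<psi> * R = \<psi> \<otimes>\<^sub>m \<chi>"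
      using \<psi> by (auto simp: weight_space_def)
    have "\<psi> * \<tau>' * R * (\<tau> \<otimes>\<^sub>m 1\<^sub>m b) = \<psi> * (\<tau>' * (\<tau> * (R * (?I \<otimes>\<^sub>m \<tau>H))))" by (simp add: mat_assoc R\<tau>)
    also have "\<dots> = (\<psi> * R) * (?I \<otimes>\<^sub>m \<tau>H)" by (simp add: mult_pull[OF \<tau>'\<tau>] mat_assoc)
    also have "\<dots> = \<psi> \<otimes>\<^sub>m counit H" unfolding \<psi>R by (simp add: kron_mult \<chi>\<tau>H)
    also have "\<dots> = ((\<psi> * \<tau>') \<otimes>\<^sub>m counit H) * (\<tau> \<otimes>\<^sub>m 1\<^sub>m b)" by (simp add: kron_mult mat_assoc \<tau>'\<tau>)
    finally show "\<psi> * \<tau>' * R * (\<tau> \<otimes>\<^sub>m 1\<^sub>m b) = ((\<psi> * \<tau>') \<otimes>\<^sub>m counit H) * (\<tau> \<otimes>\<^sub>m 1\<^sub>m b)" .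
    show "(\<tau> \<otimes>\<^sub>m 1\<^sub>m b) * (\<tau>' \<otimes>\<^sub>m 1\<^sub>m b) = 1\<^sub>m (a * b)" by (simp add: kron_mult \<tau>\<tau>' kron_one)
  qed (use \<psi> in \<open>auto simp: weight_space_def\<close>)
  \<comment> \<open>Functionals of weight the counit are exactly those vanishing on the extended
    augmentation ideal, hence those coming from O(K).\<close>
  have Jeq: "aug_ideal G H f = R - (?I \<otimes>\<^sub>m counit H)"
  proof -
    have "m * (?I \<otimes>\<^sub>m (u * counit H)) = (m * (?I \<otimes>\<^sub>m u)) * (?I \<otimes>\<^sub>m counit H)" by (simp add: mat_assoc kron_mult)
    hence "m * (?I \<otimes>\<^sub>m (u * counit H)) = ?I \<otimes>\<^sub>m counit H" by (simp add: G.unit_right)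
    thus ?thesis by (simp add: aug_ideal_def R_def kron_add_left mat_minus_distrib)
  qed
  have \<sigma>\<pi>': "\<sigma> * \<pi> = ?I - aug_ideal G H f * X\<^sub>0"
    by (rule minus_eq_swap[OF \<sigma>\<pi>]) (rule carrier_matI; simp)+
  show thesis
  proof (rule that[of "\<tau>' * \<sigma>"])
    show "\<tau>' * \<sigma> \<in> carrier_mat a c" by (rule carrier_matI) simp_all
    fix \<psi> assume \<psi>: "\<psi> \<in> weight_space \<chi>" and 0: "\<psi> * (\<tau>' * \<sigma>) = 0\<^sub>m 1 c"
    have [simp]: "dim_row \<psi> = 1" "dim_col \<psi> = a" using \<psi> by (auto simp: weight_space_def)
    have z: "(\<psi> * \<tau>') * aug_ideal G H f = 0\<^sub>m 1 (a * b)"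
      unfolding Jeq using twist[OF \<psi>] by (simp add: mat_minus_distrib kron_vec mat_minus_zero)
    have [simp]: "dim_row (aug_ideal G H f) = a" "dim_col (aug_ideal G H f) = a * b" by (simp_all add: Jeq)
    have "\<psi> * \<tau>' * (\<sigma> * \<pi>) = \<psi> * \<tau>'"
      unfolding \<sigma>\<pi>' using carrier_matD[OF X_carrier] mult_pull[OF z, of X\<^sub>0]
      by (simp add: mat_minus_distrib mat_minus_zero)
    moreover have "\<psi> * \<tau>' * (\<sigma> * \<pi>) = \<psi> * (\<tau>' * \<sigma>) * \<pi>" by (simp add: mat_assoc)
    ultimately have "\<psi> * \<tau>' = 0\<^sub>m 1 a" unfolding 0 by simp
    hence "\<psi> * \<tau>' * \<tau> = 0\<^sub>m 1 a" by simp
    thus "\<psi> = 0\<^sub>m 1 a" by (simp add: mat_assoc \<tau>'\<tau>)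
  qed
qed

text \<open>\<open>is_module d \<rho>\<close>: the matrix \<open>\<rho>\<close> makes \<open>k\<^sup>d\<close> a module over \<open>\<O>(H)\<close>. A row \<open>F\<close> is then balanced if it
  defines a functional on the tensor product of \<open>\<O>(G)\<close> and this module over \<open>\<O>(H)\<close>.\<close>

definition is_module :: "nat \<Rightarrow> 'k mat \<Rightarrow> bool" where
  "is_module d \<rho> \<longleftrightarrow> \<rho> \<in> carrier_mat d (b * d) \<and> \<rho> * (1\<^sub>m b \<otimes>\<^sub>m \<rho>) = \<rho> * (mult H \<otimes>\<^sub>m 1\<^sub>m d)"

definition balanced :: "nat \<Rightarrow> 'k mat \<Rightarrow> 'k mat set" where
  "balanced d \<rho> = {F \<in> carrier_mat 1 (a * d). F * (R \<otimes>\<^sub>m 1\<^sub>m d) = F * (1\<^sub>m a \<otimes>\<^sub>m \<rho>)}"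

text \<open>The hypothesis \<open>eq\<close> says that the kernel of \<open>q\<close> is a
  submodule. A balanced \<open>F\<close> fixed by \<open>1 \<otimes> s q\<close> vanishes on its
  tensor product with O(G), and so descends to the quotient module.\<close>

lemma quotient_module:
  assumes "is_module d \<rho>" and q: "q \<in> carrier_mat d' d" and s: "s \<in> carrier_mat d d'"
    and eq: "q * \<rho> * (1\<^sub>m b \<otimes>\<^sub>m (s * q)) = q * \<rho>"
  shows "is_module d' (q * \<rho> * (1\<^sub>m b \<otimes>\<^sub>m s))"
    "\<And>F. F \<in> balanced d \<rho> \<Longrightarrow> F * (1\<^sub>m a \<otimes>\<^sub>m (s * q)) = F \<Longrightarrow>
       F * (1\<^sub>m a \<otimes>\<^sub>m s) \<in> balanced d' (q * \<rho> * (1\<^sub>m b \<otimes>\<^sub>m s))"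
proof -
  have \<rho>: "\<rho> \<in> carrier_mat d (b * d)" and mod: "\<rho> * (1\<^sub>m b \<otimes>\<^sub>m \<rho>) = \<rho> * (mult H \<otimes>\<^sub>m 1\<^sub>m d)"
    using assms(1) by (auto simp: is_module_def)
  note [simp] = carrier_matD[OF \<rho>] carrier_matD[OF q] carrier_matD[OF s]
  define \<rho>' where "\<rho>' = q * \<rho> * (1\<^sub>m b \<otimes>\<^sub>m s)"
  have [simp]: "dim_row \<rho>' = d'" "dim_col \<rho>' = b * d'" by (simp_all add: \<rho>'_def)
  have eq': "\<rho>' * (1\<^sub>m b \<otimes>\<^sub>m q) = q * \<rho>" using eq by (simp add: \<rho>'_def mat_assoc kron_mult)
  have "\<rho>' * (1\<^sub>m b \<otimes>\<^sub>m \<rho>') = (\<rho>' * (1\<^sub>m b \<otimes>\<^sub>m q)) * (1\<^sub>m b \<otimes>\<^sub>m (\<rho> * (1\<^sub>m b \<otimes>\<^sub>m s)))"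
    by (simp add: \<rho>'_def[symmetric] mat_assoc kron_mult) (simp add: \<rho>'_def mat_assoc)
  also have "\<dots> = q * (\<rho> * (1\<^sub>m b \<otimes>\<^sub>m \<rho>)) * (1\<^sub>m b \<otimes>\<^sub>m (1\<^sub>m b \<otimes>\<^sub>m s))"
    unfolding eq' by (simp add: mat_assoc kron_mult)
  also have "1\<^sub>m b \<otimes>\<^sub>m (1\<^sub>m b \<otimes>\<^sub>m s) = 1\<^sub>m (b * b) \<otimes>\<^sub>m s" by (simp add: kron_assoc[symmetric] kron_one)
  also have "q * (\<rho> * (1\<^sub>m b \<otimes>\<^sub>m \<rho>)) * (1\<^sub>m (b * b) \<otimes>\<^sub>m s) = \<rho>' * (mult H \<otimes>\<^sub>m 1\<^sub>m d')"
    unfolding mod by (simp add: \<rho>'_def mat_assoc kron_mult mult.assoc)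
  finally have "is_module d' \<rho>'" by (auto simp: is_module_def intro!: carrier_matI)
  thus "is_module d' (q * \<rho> * (1\<^sub>m b \<otimes>\<^sub>m s))" unfolding \<rho>'_def .
  fix F assume F: "F \<in> balanced d \<rho>" and Fsq: "F * (1\<^sub>m a \<otimes>\<^sub>m (s * q)) = F"
  have [simp]: "dim_row F = 1" "dim_col F = a * d" and bal: "F * (R \<otimes>\<^sub>m 1\<^sub>m d) = F * (1\<^sub>m a \<otimes>\<^sub>m \<rho>)"
    using F by (auto simp: balanced_def)
  have "F * (1\<^sub>m a \<otimes>\<^sub>m s) * (R \<otimes>\<^sub>m 1\<^sub>m d') = F * (R \<otimes>\<^sub>m 1\<^sub>m d) * (1\<^sub>m (a * b) \<otimes>\<^sub>m s)"
    by (simp add: mat_assoc kron_mult mult.assoc)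
  also have "\<dots> = F * (1\<^sub>m a \<otimes>\<^sub>m \<rho>) * (1\<^sub>m a \<otimes>\<^sub>m (1\<^sub>m b \<otimes>\<^sub>m s))"
    unfolding bal by (simp add: kron_assoc[symmetric] kron_one)
  also have "\<dots> = (F * (1\<^sub>m a \<otimes>\<^sub>m (s * q))) * (1\<^sub>m a \<otimes>\<^sub>m (\<rho> * (1\<^sub>m b \<otimes>\<^sub>m s)))"
    unfolding Fsq by (simp add: mat_assoc kron_mult)
  also have "\<dots> = F * (1\<^sub>m a \<otimes>\<^sub>m s) * (1\<^sub>m a \<otimes>\<^sub>m \<rho>')"
    by (simp add: \<rho>'_def mat_assoc kron_mult)
  finally show "F * (1\<^sub>m a \<otimes>\<^sub>m s) \<in> balanced d' (q * \<rho> * (1\<^sub>m b \<otimes>\<^sub>m s))"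
    unfolding \<rho>'_def[symmetric] by (auto simp: balanced_def intro!: carrier_matI)
qed

text \<open>Induction along a composition series. The commuting action of O(H) has a common
  eigenvector \<open>v\<close>, spanning a one-dimensional submodule that contributes at most one
  weight space, of dimension at most \<open>c\<close>; functionals vanishing there come from the
  quotient module.\<close>

lemma balanced_dim:
  assumes "is_module d \<rho>"
  shows "\<exists>V \<in> carrier_mat (a * d) (c * d). \<forall>F \<in> balanced d \<rho>. F * V = 0\<^sub>m 1 (c * d) \<longrightarrow> F = 0\<^sub>m 1 (a * d)"
  using assms
proof (induction d arbitrary: \<rho>)
  case 0
  show ?case by (rule bexI[of _ "0\<^sub>m 0 0"]) (auto simp: balanced_def intro!: eq_matI)
next
  case (Suc d)
  let ?d = "Suc d"
  have \<rho>: "\<rho> \<in> carrier_mat ?d (b * ?d)" and mod: "\<rho> * (1\<^sub>m b \<otimes>\<^sub>m \<rho>) = \<rho> * (mult H \<otimes>\<^sub>m 1\<^sub>m ?d)"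
    using Suc.prems by (auto simp: is_module_def)
  note [simp] = carrier_matD[OF \<rho>] and [simp del] = mult_Suc_right mult_Suc
  define r where "r i = \<rho> * (unit_col b i \<otimes>\<^sub>m 1\<^sub>m ?d)" for i
  have [simp]: "dim_row (r i) = ?d" "dim_col (r i) = ?d" for i by (simp_all add: r_def)
  have rr: "r i * r j = \<rho> * ((mult H * (unit_col b i \<otimes>\<^sub>m unit_col b j)) \<otimes>\<^sub>m 1\<^sub>m ?d)" for i j
  proof -
    have "r i * r j = \<rho> * (unit_col b i \<otimes>\<^sub>m (\<rho> * (unit_col b j \<otimes>\<^sub>m 1\<^sub>m ?d)))"
      unfolding r_def by (simp add: mat_assoc kron_vec)
    also have "\<dots> = (\<rho> * (1\<^sub>m b \<otimes>\<^sub>m \<rho>)) * (unit_col b i \<otimes>\<^sub>m (unit_col b j \<otimes>\<^sub>m 1\<^sub>m ?d))"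
      by (simp add: mat_assoc kron_mult)
    also have "\<dots> = \<rho> * ((mult H * (unit_col b i \<otimes>\<^sub>m unit_col b j)) \<otimes>\<^sub>m 1\<^sub>m ?d)"
      unfolding mod by (simp add: mat_assoc kron_assoc[symmetric] kron_mult mult.assoc)
    finally show ?thesis .
  qed
  have "\<exists>v \<chi>. v \<in> carrier_mat ?d 1 \<and> v \<noteq> 0\<^sub>m ?d 1 \<and> (\<forall>i \<in> {..<b}. r i * v = \<chi> i \<cdot>\<^sub>m v)"
  proof (rule common_eigenvector)
    fix i j show "r i * r j = r j * r i"
      unfolding rr using H.m_comm_kron[of "unit_col b i" "unit_col b j"] by simp
  qed (auto intro!: carrier_matI)
  then obtain v \<chi> where v: "v \<in> carrier_mat ?d 1" "v \<noteq> 0\<^sub>m ?d 1" "\<And>i. i < b \<Longrightarrow> r i * v = \<chi> i \<cdot>\<^sub>m v" by blast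
  note [simp] = carrier_matD[OF v(1)]
  define X where "X = mat 1 b (\<lambda>(_, i). \<chi> i)"
  have X: "X \<in> carrier_mat 1 b" by (simp add: X_def)
  note [simp] = carrier_matD[OF X]
  have Xu: "X * unit_col b j = \<chi> j \<cdot>\<^sub>m 1\<^sub>m 1" if "j < b" for j
    using that by (intro eq_matI) (auto simp: mult_unit_col X_def simp del: index_mult_mat(1))
  have \<rho>v: "\<rho> * (1\<^sub>m b \<otimes>\<^sub>m v) = v * X"
  proof (rule mat_eq_by_cols[of _ ?d b])
    fix i assume i: "i < b"
    have "\<rho> * (1\<^sub>m b \<otimes>\<^sub>m v) * unit_col b i = \<rho> * (unit_col b i \<otimes>\<^sub>m v)" by (simp add: mat_assoc kron_vec)
    also have "\<dots> = r i * v" by (simp add: r_def mat_assoc kron_vec)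
    also have "\<dots> = v * X * unit_col b i"
      unfolding v(3)[OF i] using Xu[OF i] by (simp add: mat_assoc mat_smult_mult)
    finally show "\<rho> * (1\<^sub>m b \<otimes>\<^sub>m v) * unit_col b i = v * X * unit_col b i" .
  qed (rule carrier_matI; simp)+
  obtain q s \<phi> where q: "q \<in> carrier_mat d ?d" "s \<in> carrier_mat ?d d" "\<phi> \<in> carrier_mat 1 ?d"
    "q * s = 1\<^sub>m d" "s * q = 1\<^sub>m ?d - v * \<phi>" "q * v = 0\<^sub>m d 1"
    by (rule split_off_vector[OF v(1,2)]) simp
  note [simp] = carrier_matD[OF q(1)] carrier_matD[OF q(2)] carrier_matD[OF q(3)]
  have eq: "q * \<rho> * (1\<^sub>m b \<otimes>\<^sub>m (s * q)) = q * \<rho>"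
  proof -
    have "q * \<rho> * (1\<^sub>m b \<otimes>\<^sub>m (v * \<phi>)) = q * ((\<rho> * (1\<^sub>m b \<otimes>\<^sub>m v)) * (1\<^sub>m b \<otimes>\<^sub>m \<phi>))"
      by (simp add: mat_assoc kron_mult)
    also have "\<dots> = 0\<^sub>m d (b * ?d)" unfolding \<rho>v by (simp add: mat_assoc mult_pull[OF q(6)])
    finally show ?thesis unfolding q(5)
      by (simp add: kron_add_left mat_minus_distrib kron_one mat_minus_zero)
  qed
  note quot = quotient_module[OF Suc.prems q(1,2) eq]
  obtain V' where V': "V' \<in> carrier_mat (a * d) (c * d)"
    "\<And>F. F \<in> balanced d (q * \<rho> * (1\<^sub>m b \<otimes>\<^sub>m s)) \<Longrightarrow> F * V' = 0\<^sub>m 1 (c * d) \<Longrightarrow> F = 0\<^sub>m 1 (a * d)"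
    using Suc.IH[OF quot(1)] by blast
  obtain W where W: "W \<in> carrier_mat a c" "\<And>\<psi>. \<psi> \<in> weight_space X \<Longrightarrow> \<psi> * W = 0\<^sub>m 1 c \<Longrightarrow> \<psi> = 0\<^sub>m 1 a"
    by (rule weight_space_dim[OF X]) blast
  note [simp] = carrier_matD[OF V'(1)] carrier_matD[OF W(1)]
  \<comment> \<open>The block \<open>?A\<close> tests \<open>F\<close> on the line of
    \<open>v\<close> by \<open>c\<close> conditions; \<open>?B\<close> tests the functional induced
    on the quotient by \<open>c * d\<close> conditions.\<close>
  let ?A = "(1\<^sub>m a \<otimes>\<^sub>m v) * W" and ?B = "(1\<^sub>m a \<otimes>\<^sub>m s) * V'"
  have AB: "?A \<in> carrier_mat (a * ?d) c" "?B \<in> carrier_mat (a * ?d) (c * d)" by (rule carrier_matI; simp)+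
  have cd: "c * ?d = c + c * d" by (simp add: mult_Suc_right)
  show ?case
  proof (intro bexI[of _ "hcat ?A ?B"] ballI impI)
    show "hcat ?A ?B \<in> carrier_mat (a * ?d) (c * ?d)" unfolding cd by (rule carrier_matI) simp_all
    fix F assume F: "F \<in> balanced ?d \<rho>" and 0: "F * hcat ?A ?B = 0\<^sub>m 1 (c * ?d)"
    have Fc: "F \<in> carrier_mat 1 (a * ?d)" and bal: "F * (R \<otimes>\<^sub>m 1\<^sub>m ?d) = F * (1\<^sub>m a \<otimes>\<^sub>m \<rho>)"
      using F by (auto simp: balanced_def)
    note [simp] = carrier_matD[OF Fc]
    note z = hcat_eq_zero[OF Fc AB 0[unfolded cd]]
    define \<psi> where "\<psi> = F * (1\<^sub>m a \<otimes>\<^sub>m v)"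
    have [simp]: "dim_row \<psi> = 1" "dim_col \<psi> = a" by (simp_all add: \<psi>_def)
    have "\<psi> * R = F * (R \<otimes>\<^sub>m 1\<^sub>m ?d) * (1\<^sub>m (a * b) \<otimes>\<^sub>m v)"
      by (simp add: \<psi>_def mat_assoc kron_vec kron_mult)
    also have "\<dots> = F * (1\<^sub>m a \<otimes>\<^sub>m (\<rho> * (1\<^sub>m b \<otimes>\<^sub>m v)))"
      unfolding bal by (simp add: mat_assoc kron_one_split kron_assoc kron_mult)
    also have "\<dots> = \<psi> * (1\<^sub>m a \<otimes>\<^sub>m X)" unfolding \<rho>v by (simp add: \<psi>_def mat_assoc kron_mult)
    finally have "\<psi> \<in> weight_space X" by (auto simp: weight_space_def kron_vec intro!: carrier_matI)
    moreover have "\<psi> * W = 0\<^sub>m 1 c" using z(1) by (simp add: \<psi>_def mat_assoc)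
    ultimately have \<psi>0: "F * (1\<^sub>m a \<otimes>\<^sub>m v) = 0\<^sub>m 1 a" using W(2) by (simp add: \<psi>_def)
    have "F * (1\<^sub>m a \<otimes>\<^sub>m (v * \<phi>)) = (F * (1\<^sub>m a \<otimes>\<^sub>m v)) * (1\<^sub>m a \<otimes>\<^sub>m \<phi>)"
      by (simp add: mat_assoc kron_mult)
    hence "F * (1\<^sub>m a \<otimes>\<^sub>m (v * \<phi>)) = 0\<^sub>m 1 (a * ?d)" unfolding \<psi>0 by simp
    hence Fsq: "F * (1\<^sub>m a \<otimes>\<^sub>m (s * q)) = F"
      unfolding q(5) by (simp add: kron_add_left mat_minus_distrib kron_one mat_minus_zero)
    have "F * (1\<^sub>m a \<otimes>\<^sub>m s) * V' = 0\<^sub>m 1 (c * d)" using z(2) by (simp add: mat_assoc)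
    hence "F * (1\<^sub>m a \<otimes>\<^sub>m s) = 0\<^sub>m 1 (a * d)" using V'(2) quot(2)[OF F Fsq] by blast
    hence "F * (1\<^sub>m a \<otimes>\<^sub>m s) * (1\<^sub>m a \<otimes>\<^sub>m q) = 0\<^sub>m 1 (a * ?d)" by simp
    thus "F = 0\<^sub>m 1 (a * ?d)" using Fsq by (simp add: mat_assoc kron_mult)
  qed
qed

text \<open>A functional \<open>\<psi>\<close> on O(G) gives the balanced functional
  \<open>\<psi> * R\<close>, that is \<open>x \<otimes> y\<close> goes to
  \<open>\<psi>(x f(y))\<close>, and is recovered from it at \<open>y = 1\<close>. So the bound for
  the module O(H) applies to all of the dual of O(G).\<close>

lemma order_le: "a \<le> c * b"
proof -
  have "is_module b (mult H)" using H.m_carrier H.m_assoc by (auto simp: is_module_def)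
  then obtain V where V: "V \<in> carrier_mat (a * b) (c * b)"
    "\<And>F. F \<in> balanced b (mult H) \<Longrightarrow> F * V = 0\<^sub>m 1 (c * b) \<Longrightarrow> F = 0\<^sub>m 1 (a * b)"
    using balanced_dim by blast
  have RV: "R * V \<in> carrier_mat a (c * b)" using V by (intro carrier_matI) simp_all
  show ?thesis
  proof (rule separating_dim[OF RV])
    fix \<psi> assume \<psi>: "\<psi> \<in> carrier_mat 1 a" and 0: "\<psi> * (R * V) = 0\<^sub>m 1 (c * b)"
    note [simp] = carrier_matD[OF \<psi>] carrier_matD[OF V(1)]
    have "R * (R \<otimes>\<^sub>m 1\<^sub>m b) = m * (R \<otimes>\<^sub>m f)" by (simp add: R_def mat_assoc kron_mult)
    also have "\<dots> = m * (1\<^sub>m a \<otimes>\<^sub>m (m * (f \<otimes>\<^sub>m f)))" unfolding R_def by (rule G.m_assoc_kron) simp_all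
    also have "\<dots> = R * (1\<^sub>m a \<otimes>\<^sub>m mult H)" unfolding f_eqs(2)[symmetric] by (simp add: R_def mat_assoc kron_mult)
    finally have "\<psi> * R * (R \<otimes>\<^sub>m 1\<^sub>m b) = \<psi> * R * (1\<^sub>m a \<otimes>\<^sub>m mult H)" by (simp add: mat_assoc)
    hence "\<psi> * R \<in> balanced b (mult H)" by (auto simp: balanced_def intro!: carrier_matI)
    hence \<psi>R: "\<psi> * R = 0\<^sub>m 1 (a * b)" using V(2) 0 by (simp add: mat_assoc)
    have "\<psi> = \<psi> * R * (1\<^sub>m a \<otimes>\<^sub>m unit H)" by (simp add: mat_assoc R_unit)
    thus "\<psi> = 0\<^sub>m 1 a" unfolding \<psi>R by simp
  qed
qed

lemma complement_dim:
  obtains d q s Z where "q \<in> carrier_mat d a" "s \<in> carrier_mat a d" "Z \<in> carrier_mat b a"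
    "q * s = 1\<^sub>m d" "q * f = 0\<^sub>m d b" "1\<^sub>m a - s * q = f * Z" "b + d \<le> a"
proof -
  obtain d q s Z where q: "q \<in> carrier_mat d a" "s \<in> carrier_mat a d" "Z \<in> carrier_mat b a"
    "q * s = 1\<^sub>m d" "q * f = 0\<^sub>m d b" "1\<^sub>m a - s * q = f * Z"
    by (rule cokernel_mat[OF f_eqs(1)])
  note [simp] = carrier_matD[OF q(1)] carrier_matD[OF q(2)] carrier_matD[OF q(3)]
  have fZf: "f * (Z * f) = f * 1\<^sub>m b" 
    using q(5) by (simp add: mat_assoc[symmetric] q(6)[symmetric] mat_minus_distrib)
      (simp add: mat_assoc mat_minus_zero)
  have Zf: "Z * f = 1\<^sub>m b" by (rule left_cancel[OF fZf lf]) simp_all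
  have fZs: "f * (Z * s) = f * 0\<^sub>m b d"
    by (simp add: mat_assoc[symmetric] q(6)[symmetric] mat_minus_distrib)
      (simp add: mat_assoc q(4) mat_minus_zero)
  have Zs: "Z * s = 0\<^sub>m b d" by (rule left_cancel[OF fZs lf]) simp_all
  \<comment> \<open>The stacked rows of \<open>Z\<close> and \<open>q\<close> form a left inverse of
    \<open>f\<close> and \<open>s\<close> placed side by side, because \<open>Z * f = 1\<close> and
    \<open>Z * s = 0\<close>.\<close>
  define L where "L = mat (b + d) a (\<lambda>(i, k). if i < b then Z $$ (i, k) else q $$ (i - b, k))"
  have L: "L \<in> carrier_mat (b + d) a" by (simp add: L_def)
  have A: "hcat f s \<in> carrier_mat a (b + d)" by (rule carrier_matI) simp_all
  have "L * hcat f s = 1\<^sub>m (b + d)"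
  proof (rule eq_matI, goal_cases)
    case (1 i j)
    hence ij: "i < b + d" "j < b + d" by auto
    let ?P = "if i < b then Z else q" and ?Q = "if j < b then f else s"
    let ?i = "if i < b then i else i - b" and ?j = "if j < b then j else j - b"
    have "(L * hcat f s) $$ (i, j) = (\<Sum>k = 0..<a. L $$ (i, k) * hcat f s $$ (k, j))"
      using ij L by (simp add: mat_mult_index del: index_mult_mat(1))
    also have "\<dots> = (\<Sum>k = 0..<a. ?P $$ (?i, k) * ?Q $$ (k, ?j))"
      using ij by (intro sum.cong) (auto simp: L_def hcat_def)
    also have "\<dots> = (?P * ?Q) $$ (?i, ?j)"
      using ij by (subst mat_mult_index) auto
    also have "\<dots> = 1\<^sub>m (b + d) $$ (i, j)"
      using ij by (auto simp: Zf Zs q(4,5) simp del: index_mult_mat(1))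
    finally show ?case .
  qed (use L in auto)
  hence "b + d \<le> a" by (rule left_inverse_dim[OF A L])
  thus thesis using that q by blast
qed

text \<open>Functionals on O(G) tensor O(K), of total dimension \<open>a * c\<close>, pull back
  injectively along \<open>T\<close> to balanced ones on O(G) tensor O(G). Those vanishing on O(G)
  tensor 1 descend to O(G)/O(H), of dimension \<open>d\<close>, so
  \<open>a * c \<le> a + c * d\<close>; with \<open>b + d \<le> a\<close> the claim follows.\<close>

lemma order_ge: "c * b \<le> a"
proof -
  obtain d q s Z where q: "q \<in> carrier_mat d a" "s \<in> carrier_mat a d" "Z \<in> carrier_mat b a"
    "q * s = 1\<^sub>m d" "q * f = 0\<^sub>m d b" "1\<^sub>m a - s * q = f * Z" and bd: "b + d \<le> a"
    by (rule complement_dim)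
  note [simp] = carrier_matD[OF q(1)] carrier_matD[OF q(2)] carrier_matD[OF q(3)]
  have sq: "s * q = 1\<^sub>m a - f * Z" by (rule minus_eq_swap[OF q(6)]) (rule carrier_matI; simp)+
  let ?I = "1\<^sub>m a :: 'k mat"
  define \<rho> where "\<rho> = m * (f \<otimes>\<^sub>m ?I)"
  have [simp]: "dim_row \<rho> = a" "dim_col \<rho> = b * a" by (simp_all add: \<rho>_def)
  have mod: "is_module a \<rho>"
  proof -
    have "\<rho> * (1\<^sub>m b \<otimes>\<^sub>m \<rho>) = m * (f \<otimes>\<^sub>m (m * (f \<otimes>\<^sub>m ?I)))" by (simp add: \<rho>_def mat_assoc kron_mult)
    also have "\<dots> = m * ((m * (f \<otimes>\<^sub>m f)) \<otimes>\<^sub>m ?I)" by (rule G.m_assoc_kron[symmetric]) simp_all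
    also have "\<dots> = \<rho> * (mult H \<otimes>\<^sub>m ?I)" unfolding f_eqs(2)[symmetric] by (simp add: \<rho>_def mat_assoc kron_mult)
    finally show ?thesis by (auto simp: is_module_def intro!: carrier_matI)
  qed
  have eq: "q * \<rho> * (1\<^sub>m b \<otimes>\<^sub>m (s * q)) = q * \<rho>"
  proof -
    have "q * \<rho> * (1\<^sub>m b \<otimes>\<^sub>m (f * Z)) = q * ((m * (f \<otimes>\<^sub>m f)) * (1\<^sub>m b \<otimes>\<^sub>m Z))"
      by (simp add: \<rho>_def mat_assoc kron_mult)
    also have "\<dots> = 0\<^sub>m d (b * a)" unfolding f_eqs(2)[symmetric] by (simp add: mat_assoc mult_pull[OF q(5)])
    finally show ?thesis unfolding sq by (simp add: kron_add_left mat_minus_distrib kron_one mat_minus_zero)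
  qed
  note quot = quotient_module[OF mod q(1,2) eq]
  obtain V' where V': "V' \<in> carrier_mat (a * d) (c * d)"
    "\<And>F. F \<in> balanced d (q * \<rho> * (1\<^sub>m b \<otimes>\<^sub>m s)) \<Longrightarrow> F * V' = 0\<^sub>m 1 (c * d) \<Longrightarrow> F = 0\<^sub>m 1 (a * d)"
    using balanced_dim[OF quot(1)] by blast
  note [simp] = carrier_matD[OF V'(1)]
  \<comment> \<open>\<open>?A\<close> imposes the \<open>a\<close> conditions of vanishing on O(G)
    tensor 1, \<open>?B\<close> the \<open>c * d\<close> conditions on the quotient
    O(G)/O(H).\<close>
  let ?A = "?I \<otimes>\<^sub>m u" and ?B = "(?I \<otimes>\<^sub>m s) * V'"
  have AB: "?A \<in> carrier_mat (a * a) a" "?B \<in> carrier_mat (a * a) (c * d)" by (rule carrier_matI; simp)+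
  \<comment> \<open>The map sending \<open>x \<otimes> y\<close> to the sum of
    \<open>x y1 \<otimes> \<pi>(y2)\<close>; geometrically, \<open>(g, h) -> (g, g h)\<close> with
    \<open>h\<close> in \<open>K\<close>. It is surjective because the shear is invertible and
    \<open>\<pi>\<close> splits.\<close>
  define T where "T = (?I \<otimes>\<^sub>m \<pi>) * G.\<Psi>"
  have [simp]: "dim_row T = a * c" "dim_col T = a * a" by (simp_all add: T_def)
  obtain P where P: "P \<in> carrier_mat (a * a) (a * a)" "G.\<Psi> * P = 1\<^sub>m (a * a)" by (rule G.\<Psi>_invertible)
  note [simp] = carrier_matD[OF P(1)]
  have T_inv: "T * (P * (?I \<otimes>\<^sub>m \<sigma>)) = 1\<^sub>m (a * c)"
    by (simp add: T_def mat_assoc mult_pull[OF P(2)] kron_mult \<pi>\<sigma> kron_one)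
  have T_bal: "T * (R \<otimes>\<^sub>m ?I) = T * (?I \<otimes>\<^sub>m \<rho>)"
  proof -
    have \<Psi>': "(?I \<otimes>\<^sub>m \<pi>) * G.\<Psi> = (m \<otimes>\<^sub>m 1\<^sub>m c) * (?I \<otimes>\<^sub>m ((?I \<otimes>\<^sub>m \<pi>) * D))"
    proof -
      have "(?I \<otimes>\<^sub>m \<pi>) * G.\<Psi> = (m \<otimes>\<^sub>m \<pi>) * (?I \<otimes>\<^sub>m D)" by (simp add: G.\<Psi>_def kron_mult_pull)
      also have "m \<otimes>\<^sub>m \<pi> = (m \<otimes>\<^sub>m 1\<^sub>m c) * (?I \<otimes>\<^sub>m (?I \<otimes>\<^sub>m \<pi>))"
        by (simp add: kron_assoc[symmetric] kron_mult kron_one)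
      finally show ?thesis by (simp add: mat_assoc kron_mult)
    qed
    \<comment> \<open>Because \<open>\<pi> * f\<close> is trivial, a factor from O(H) contributes
      only to the first component of the coproduct. This is what makes \<open>T\<close>
      balanced.\<close>
    have D\<rho>: "(?I \<otimes>\<^sub>m \<pi>) * D * \<rho> = (m \<otimes>\<^sub>m 1\<^sub>m c) * (f \<otimes>\<^sub>m ((?I \<otimes>\<^sub>m \<pi>) * D))"
    proof -
      let ?W = "(?I \<otimes>\<^sub>m \<pi>) * D"
      have "?W * \<rho> = (m \<otimes>\<^sub>m (\<pi> * m)) * ((?I \<otimes>\<^sub>m swap a a \<otimes>\<^sub>m ?I) * ((D * f) \<otimes>\<^sub>m D))"
        by (simp add: \<rho>_def mat_assoc mult_pull[OF G.D_m] kron_mult kron_mult_pull mult.assoc)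
      also have "\<dots> = (m \<otimes>\<^sub>m mult K) * ((?I \<otimes>\<^sub>m (?I \<otimes>\<^sub>m (\<pi> \<otimes>\<^sub>m \<pi>))) * ((?I \<otimes>\<^sub>m swap a a \<otimes>\<^sub>m ?I) * ((D * f) \<otimes>\<^sub>m D)))"
      proof -
        have "(?I \<otimes>\<^sub>m (?I \<otimes>\<^sub>m (\<pi> \<otimes>\<^sub>m \<pi>))) = 1\<^sub>m (a * a) \<otimes>\<^sub>m (\<pi> \<otimes>\<^sub>m \<pi>)"
          by (simp add: kron_assoc[symmetric] kron_one)
        thus ?thesis by (simp add: kron_mult_pull \<pi>_eqs(2) mult.assoc)
      qed
      also have "(?I \<otimes>\<^sub>m (?I \<otimes>\<^sub>m (\<pi> \<otimes>\<^sub>m \<pi>))) = ?I \<otimes>\<^sub>m ((?I \<otimes>\<^sub>m \<pi>) \<otimes>\<^sub>m \<pi>)" by (simp add: kron_assoc)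
      also have "(?I \<otimes>\<^sub>m ((?I \<otimes>\<^sub>m \<pi>) \<otimes>\<^sub>m \<pi>)) * ((?I \<otimes>\<^sub>m swap a a \<otimes>\<^sub>m ?I) * ((D * f) \<otimes>\<^sub>m D)) =
        (?I \<otimes>\<^sub>m (swap c a \<otimes>\<^sub>m 1\<^sub>m c)) * ((?I \<otimes>\<^sub>m ((\<pi> \<otimes>\<^sub>m ?I) \<otimes>\<^sub>m \<pi>)) * ((D * f) \<otimes>\<^sub>m D))"
        using swap_kron[of \<pi> ?I] by (simp add: kron_mult_pull kron_mult mult.assoc)
      also have "?I \<otimes>\<^sub>m ((\<pi> \<otimes>\<^sub>m ?I) \<otimes>\<^sub>m \<pi>) = (?I \<otimes>\<^sub>m \<pi>) \<otimes>\<^sub>m (?I \<otimes>\<^sub>m \<pi>)" by (simp add: kron_assoc)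
      also have "((?I \<otimes>\<^sub>m \<pi>) \<otimes>\<^sub>m (?I \<otimes>\<^sub>m \<pi>)) * ((D * f) \<otimes>\<^sub>m D) = ((?I \<otimes>\<^sub>m \<pi>) * (D * f)) \<otimes>\<^sub>m ?W"
        by (simp add: kron_mult)
      also have "(?I \<otimes>\<^sub>m \<pi>) * (D * f) = f \<otimes>\<^sub>m unit K"
      proof -
        have "(?I \<otimes>\<^sub>m \<pi>) * (D * f) = (f \<otimes>\<^sub>m (unit K * counit H)) * comult H"
          by (simp add: f_eqs(4) kron_mult_pull \<pi>f)
        also have "\<dots> = (f \<otimes>\<^sub>m unit K) * ((1\<^sub>m b \<otimes>\<^sub>m counit H) * comult H)" by (simp add: kron_mult_pull)
        finally show ?thesis by (simp add: H.counit_right)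
      qed
      also have "(?I \<otimes>\<^sub>m (swap c a \<otimes>\<^sub>m 1\<^sub>m c)) * ((f \<otimes>\<^sub>m unit K) \<otimes>\<^sub>m ?W) =
        (?I \<otimes>\<^sub>m (swap c a \<otimes>\<^sub>m 1\<^sub>m c)) * ((f \<otimes>\<^sub>m (unit K \<otimes>\<^sub>m 1\<^sub>m (a * c))) * (1\<^sub>m b \<otimes>\<^sub>m ?W))"
        by (simp add: kron_mult kron_vec kron_assoc)
      also have "unit K \<otimes>\<^sub>m 1\<^sub>m (a * c) = (unit K \<otimes>\<^sub>m ?I) \<otimes>\<^sub>m 1\<^sub>m c" by (simp add: kron_assoc kron_one)
      also have "(?I \<otimes>\<^sub>m (swap c a \<otimes>\<^sub>m 1\<^sub>m c)) * ((f \<otimes>\<^sub>m ((unit K \<otimes>\<^sub>m ?I) \<otimes>\<^sub>m 1\<^sub>m c)) * (1\<^sub>m b \<otimes>\<^sub>m ?W)) =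
        (f \<otimes>\<^sub>m ((?I \<otimes>\<^sub>m unit K) \<otimes>\<^sub>m 1\<^sub>m c)) * (1\<^sub>m b \<otimes>\<^sub>m ?W)"
        using swap_kron[of "unit K" ?I] by (simp add: kron_mult kron_mult_pull mult.assoc)
      also have "f \<otimes>\<^sub>m ((?I \<otimes>\<^sub>m unit K) \<otimes>\<^sub>m 1\<^sub>m c) = (f \<otimes>\<^sub>m ?I) \<otimes>\<^sub>m (unit K \<otimes>\<^sub>m 1\<^sub>m c)" by (simp add: kron_assoc)
      also have "(m \<otimes>\<^sub>m mult K) * (((f \<otimes>\<^sub>m ?I) \<otimes>\<^sub>m (unit K \<otimes>\<^sub>m 1\<^sub>m c)) * (1\<^sub>m b \<otimes>\<^sub>m ?W)) =
         ((m * (f \<otimes>\<^sub>m ?I)) \<otimes>\<^sub>m 1\<^sub>m c) * (1\<^sub>m b \<otimes>\<^sub>m ?W)"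
        by (simp add: kron_mult_pull K.unit_left mult.assoc)
      also have "\<dots> = (m \<otimes>\<^sub>m 1\<^sub>m c) * ((f \<otimes>\<^sub>m 1\<^sub>m (a * c)) * (1\<^sub>m b \<otimes>\<^sub>m ?W))"
        by (simp add: kron_one_split[of a c] kron_assoc[symmetric] kron_mult_pull)
      also have "(f \<otimes>\<^sub>m 1\<^sub>m (a * c)) * (1\<^sub>m b \<otimes>\<^sub>m ?W) = f \<otimes>\<^sub>m ?W" by (simp add: kron_mult)
      finally show ?thesis .
    qed
    let ?W = "(?I \<otimes>\<^sub>m \<pi>) * D"
    have "T * (?I \<otimes>\<^sub>m \<rho>) = (m \<otimes>\<^sub>m 1\<^sub>m c) * (?I \<otimes>\<^sub>m ((m \<otimes>\<^sub>m 1\<^sub>m c) * (f \<otimes>\<^sub>m ?W)))"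
      unfolding T_def \<Psi>' D\<rho>[symmetric] by (simp add: mat_assoc kron_mult)
    also have "\<dots> = (m \<otimes>\<^sub>m 1\<^sub>m c) * (((?I \<otimes>\<^sub>m m) \<otimes>\<^sub>m 1\<^sub>m c) * (?I \<otimes>\<^sub>m (f \<otimes>\<^sub>m ?W)))"
      by (simp add: kron_assoc kron_mult)
    also have "\<dots> = (m \<otimes>\<^sub>m 1\<^sub>m c) * (((m \<otimes>\<^sub>m ?I) \<otimes>\<^sub>m 1\<^sub>m c) * (?I \<otimes>\<^sub>m (f \<otimes>\<^sub>m ?W)))"
      by (simp add: kron_mult_pull G.m_assoc[symmetric] mult.assoc)
    also have "((m \<otimes>\<^sub>m ?I) \<otimes>\<^sub>m 1\<^sub>m c) * (?I \<otimes>\<^sub>m (f \<otimes>\<^sub>m ?W)) = (m \<otimes>\<^sub>m 1\<^sub>m (a * c)) * ((?I \<otimes>\<^sub>m f) \<otimes>\<^sub>m ?W)"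
      by (simp add: kron_assoc kron_one)
    also have "\<dots> = (?I \<otimes>\<^sub>m ?W) * (R \<otimes>\<^sub>m ?I)" by (simp add: R_def kron_mult)
    also have "(m \<otimes>\<^sub>m 1\<^sub>m c) * ((?I \<otimes>\<^sub>m ?W) * (R \<otimes>\<^sub>m ?I)) = T * (R \<otimes>\<^sub>m ?I)"
      unfolding T_def \<Psi>' by (simp add: mat_assoc)
    finally show ?thesis by simp
  qed
  have TV: "T * hcat ?A ?B \<in> carrier_mat (a * c) (a + c * d)" by (rule carrier_matI) simp_all
  have "a * c \<le> a + c * d"
  proof (rule separating_dim[OF TV])
    fix E assume E: "E \<in> carrier_mat 1 (a * c)" and 0: "E * (T * hcat ?A ?B) = 0\<^sub>m 1 (a + c * d)"
    note [simp] = carrier_matD[OF E]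
    define F where "F = E * T"
    have Fc: "F \<in> carrier_mat 1 (a * a)" by (rule carrier_matI) (simp_all add: F_def)
    note [simp] = carrier_matD[OF Fc]
    have bal: "F * (R \<otimes>\<^sub>m ?I) = F * (?I \<otimes>\<^sub>m \<rho>)" using T_bal by (simp add: F_def mat_assoc)
    hence F: "F \<in> balanced a \<rho>" using Fc by (simp add: balanced_def)
    have "F * hcat ?A ?B = 0\<^sub>m 1 (a + c * d)" using 0 by (simp add: F_def mat_assoc)
    note z = hcat_eq_zero[OF Fc AB this]
    \<comment> \<open>Writing \<open>f(y)\<close> as \<open>f(y) 1\<close>, balancedness gives
      \<open>F(x \<otimes> f(y)) = F(x f(y) \<otimes> 1) = 0\<close>; so \<open>F\<close> vanishes
      on O(G) tensor the image of O(H).\<close>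
    have "f = \<rho> * (1\<^sub>m b \<otimes>\<^sub>m u)"
    proof -
      have "\<rho> * (1\<^sub>m b \<otimes>\<^sub>m u) = m * (f \<otimes>\<^sub>m u)" by (simp add: \<rho>_def mat_assoc kron_mult)
      also have "f \<otimes>\<^sub>m u = (?I \<otimes>\<^sub>m u) * f" by (simp add: kron_vec)
      finally show ?thesis by (simp add: mult_pull[OF G.unit_right])
    qed
    hence "F * (?I \<otimes>\<^sub>m f) = F * (?I \<otimes>\<^sub>m \<rho>) * (?I \<otimes>\<^sub>m (1\<^sub>m b \<otimes>\<^sub>m u))" by (simp add: mat_assoc kron_mult)
    also have "\<dots> = F * (R \<otimes>\<^sub>m ?I) * (1\<^sub>m (a * b) \<otimes>\<^sub>m u)"
      unfolding bal by (simp add: kron_assoc[symmetric] kron_one)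
    also have "\<dots> = F * (R \<otimes>\<^sub>m u)" by (simp add: mat_assoc kron_mult)
    also have "R \<otimes>\<^sub>m u = (?I \<otimes>\<^sub>m u) * R" by (simp add: kron_vec)
    also have "F * ((?I \<otimes>\<^sub>m u) * R) = 0\<^sub>m 1 (a * b)" by (simp add: mult_pull[OF z(1)])
    finally have Ff: "F * (?I \<otimes>\<^sub>m f) = 0\<^sub>m 1 (a * b)" .
    have "F * (?I \<otimes>\<^sub>m (f * Z)) = (F * (?I \<otimes>\<^sub>m f)) * (?I \<otimes>\<^sub>m Z)" by (simp add: mat_assoc kron_mult)
    hence "F * (?I \<otimes>\<^sub>m (f * Z)) = 0\<^sub>m 1 (a * a)" unfolding Ff by simp
    hence Fsq: "F * (?I \<otimes>\<^sub>m (s * q)) = F"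
      unfolding sq by (simp add: kron_add_left mat_minus_distrib kron_one mat_minus_zero)
    have "F * (?I \<otimes>\<^sub>m s) * V' = 0\<^sub>m 1 (c * d)" using z(2) by (simp add: mat_assoc)
    hence "F * (?I \<otimes>\<^sub>m s) = 0\<^sub>m 1 (a * d)" using V'(2) quot(2)[OF F Fsq] by blast
    hence "F * (?I \<otimes>\<^sub>m s) * (?I \<otimes>\<^sub>m q) = 0\<^sub>m 1 (a * a)" by simp
    hence "F = 0\<^sub>m 1 (a * a)" using Fsq by (simp add: mat_assoc kron_mult)
    hence "F * (P * (?I \<otimes>\<^sub>m \<sigma>)) = 0\<^sub>m 1 (a * c)" by simp
    thus "E = 0\<^sub>m 1 (a * c)" by (simp add: F_def mat_assoc T_inv)
  qed
  moreover have "c * (b + d) \<le> c * a" using bd by simp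
  ultimately show ?thesis by (simp add: algebra_simps)
qed

lemma order_eq: "a = c * b"
  using order_le order_ge by simp

end

section \<open>Kernels and cokernels\<close>

text \<open>A product \<open>f * g\<close> of comorphisms is the composite of \<open>f\<close> followed by \<open>g\<close>, so matrix products
  read as composites in diagrammatic order.\<close>

abbreviation fcgs :: "'k :: field hopf \<Rightarrow> bool" where
  "fcgs \<equiv> finite_comm_group_scheme"

lemma order_positive: "fcgs G \<Longrightarrow> order G > 0"
  by (rule scheme.order_pos[OF scheme.intro])

lemma hom_comp:
  "fcgs A \<Longrightarrow> fcgs B \<Longrightarrow> fcgs C \<Longrightarrow> f \<in> gs_hom A B \<Longrightarrow> g \<in> gs_hom B C \<Longrightarrow> f * g \<in> gs_hom A C"
  using gs_comp_hom[of A B C f g] by (simp add: gs_comp_def)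

lemma hom_assoc:
  "f \<in> gs_hom A B \<Longrightarrow> g \<in> gs_hom B C \<Longrightarrow> h \<in> gs_hom C E \<Longrightarrow> (f * g) * h = f * (g * h)"
  by (rule mat_assoc) (simp_all add: gs_hom_dims)

lemma zero_right:
  assumes "fcgs B" "fcgs C" "f \<in> gs_hom A B"
  shows "f * gs_zero B C = gs_zero A C"
proof -
  interpret B: scheme B + C: scheme C using assms by unfold_locales
  show ?thesis using gs_homD(3)[OF assms(3)] gs_hom_dims[OF assms(3)]
    by (simp add: gs_zero_def mat_assoc[symmetric])
qed

lemma zero_left:
  assumes "fcgs A" "fcgs B" "g \<in> gs_hom B C"
  shows "gs_zero A B * g = gs_zero A C"
proof -
  interpret A: scheme A + B: scheme B using assms by unfold_locales
  show ?thesis using gs_homD(5)[OF assms(3)] gs_hom_dims[OF assms(3)]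
    by (simp add: gs_zero_def mat_assoc)
qed

lemma closed_embD:
  assumes "closed_emb K G i"
  shows "i \<in> gs_hom K G"
    "\<And>s t. s \<in> carrier_mat n (order K) \<Longrightarrow> t \<in> carrier_mat n (order K) \<Longrightarrow> s * i = t * i \<Longrightarrow> s = t"
proof -
  obtain \<sigma> where \<sigma>: "\<sigma> \<in> carrier_mat (order G) (order K)" "i * \<sigma> = 1\<^sub>m (order K)" and i: "i \<in> gs_hom K G"
    using assms by (auto simp: closed_emb_def)
  show "i \<in> gs_hom K G" by (rule i)
  fix s t assume st: "s \<in> carrier_mat n (order K)" "t \<in> carrier_mat n (order K)" "s * i = t * i"
  show "s = t" by (rule right_cancel[OF st(3) \<sigma>(2)]) (use st \<sigma> gs_hom_dims[OF i] in auto)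
qed

lemma closed_emb_cancel:
  assumes "closed_emb K G i" "s \<in> gs_hom T K" "t \<in> gs_hom T K" "s * i = t * i"
  shows "s = t"
  using closed_embD(2)[OF assms(1)] gs_homD(1)[OF assms(2)] gs_homD(1)[OF assms(3)] assms(4) by blast

lemma quotient_mapD: "quotient_map G H f \<Longrightarrow> f \<in> gs_hom G H"
  by (simp add: quotient_map_def)

lemma quotient_map_cancel:
  assumes "quotient_map G H q" "s \<in> gs_hom H T" "t \<in> gs_hom H T" "q * s = q * t"
  shows "s = t"
proof -
  obtain l where l: "l \<in> carrier_mat (order H) (order G)" "l * q = 1\<^sub>m (order H)" and q: "q \<in> gs_hom G H"
    using assms by (auto simp: quotient_map_def)
  show ?thesis
    by (rule left_cancel[OF assms(4) l(2)]) (use l gs_hom_dims[OF q] assms(2,3) in \<open>auto simp: gs_hom_dims\<close>)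
qed

lemma closed_emb_comp:
  assumes "fcgs A" "fcgs B" "fcgs C" "closed_emb A B f" "closed_emb B C g"
  shows "closed_emb A C (f * g)"
proof -
  obtain s t where s: "s \<in> carrier_mat (order B) (order A)" "f * s = 1\<^sub>m (order A)"
    and t: "t \<in> carrier_mat (order C) (order B)" "g * t = 1\<^sub>m (order B)"
    using assms by (auto simp: closed_emb_def)
  have h: "f \<in> gs_hom A B" "g \<in> gs_hom B C" using assms closed_embD by blast+
  note [simp] = carrier_matD[OF s(1)] carrier_matD[OF t(1)] gs_hom_dims[OF h(1)] gs_hom_dims[OF h(2)]
  have "(f * g) * (t * s) = 1\<^sub>m (order A)" by (simp add: mat_assoc mult_pull[OF t(2)] s(2))
  thus ?thesis using hom_comp[OF assms(1-3) h] by (auto simp: closed_emb_def intro!: bexI[of _ "t * s"] carrier_matI)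
qed

lemma closed_emb_first:
  assumes "f \<in> gs_hom A B" "g \<in> gs_hom B C" "closed_emb A C (f * g)"
  shows "closed_emb A B f"
proof -
  obtain s where s: "s \<in> carrier_mat (order C) (order A)" "f * g * s = 1\<^sub>m (order A)"
    using assms by (auto simp: closed_emb_def)
  note [simp] = carrier_matD[OF s(1)] gs_hom_dims[OF assms(1)] gs_hom_dims[OF assms(2)]
  have "f * (g * s) = 1\<^sub>m (order A)" using s(2) by (simp add: mat_assoc)
  thus ?thesis using assms(1) by (auto simp: closed_emb_def intro!: bexI[of _ "g * s"] carrier_matI)
qed

lemma quotient_map_comp:
  assumes "fcgs A" "fcgs B" "fcgs C" "quotient_map A B f" "quotient_map B C g"
  shows "quotient_map A C (f * g)"
proof -
  obtain s t where s: "s \<in> carrier_mat (order B) (order A)" "s * f = 1\<^sub>m (order B)"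
    and t: "t \<in> carrier_mat (order C) (order B)" "t * g = 1\<^sub>m (order C)"
    using assms by (auto simp: quotient_map_def)
  have h: "f \<in> gs_hom A B" "g \<in> gs_hom B C" using assms quotient_mapD by blast+
  note [simp] = carrier_matD[OF s(1)] carrier_matD[OF t(1)] gs_hom_dims[OF h(1)] gs_hom_dims[OF h(2)]
  have "(t * s) * (f * g) = 1\<^sub>m (order C)" by (simp add: mat_assoc mult_pull[OF s(2)] t(2))
  thus ?thesis using hom_comp[OF assms(1-3) h] by (auto simp: quotient_map_def intro!: bexI[of _ "t * s"] carrier_matI)
qed

lemma quotient_map_second:
  assumes "f \<in> gs_hom A B" "g \<in> gs_hom B C" "quotient_map A C (f * g)"
  shows "quotient_map B C g"
proof -
  obtain s where s: "s \<in> carrier_mat (order C) (order A)" "s * (f * g) = 1\<^sub>m (order C)"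
    using assms by (auto simp: quotient_map_def)
  note [simp] = carrier_matD[OF s(1)] gs_hom_dims[OF assms(1)] gs_hom_dims[OF assms(2)]
  have "s * f * g = 1\<^sub>m (order C)" using s(2) by (simp add: mat_assoc)
  thus ?thesis using assms(2) by (auto simp: quotient_map_def intro!: bexI[of _ "s * f"] carrier_matI)
qed

lemma closed_emb_iso:
  assumes "fcgs G" "fcgs H" "closed_emb G H f" "order G = order H"
  obtains g where "g \<in> gs_hom H G" "f * g = gs_id G" "g * f = gs_id H"
proof -
  obtain s where s: "s \<in> carrier_mat (order H) (order G)" "f * s = 1\<^sub>m (order G)" and f: "f \<in> gs_hom G H"
    using assms by (auto simp: closed_emb_def)
  have sf: "s * f = 1\<^sub>m (order H)"
    using left_inverse_square[of s "order G" f] s gs_homD(1)[OF f] assms(4) by simp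
  have "s \<in> gs_hom H G"
    by (rule hom_cancel_mono[OF assms(2,1,2) f s(1) s(2) s(1)])
       (use sf gs_id_hom[OF assms(2)] in \<open>simp add: gs_id_def\<close>)
  thus thesis using that s(2) sf assms(4) by (simp add: gs_id_def)
qed

lemma quotient_map_iso:
  assumes "fcgs G" "fcgs H" "quotient_map G H f" "order G = order H"
  obtains g where "g \<in> gs_hom H G" "f * g = gs_id G" "g * f = gs_id H"
proof -
  obtain l where l: "l \<in> carrier_mat (order H) (order G)" "l * f = 1\<^sub>m (order H)" and f: "f \<in> gs_hom G H"
    using assms by (auto simp: quotient_map_def)
  have "f * l = 1\<^sub>m (order G)"
    using left_inverse_square[of f "order G" l] l gs_homD(1)[OF f] assms(4) by simp
  hence "closed_emb G H f" using f l by (auto simp: closed_emb_def)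
  thus thesis using closed_emb_iso[OF assms(1,2) _ assms(4)] that by blast
qed

lemma gs_id_comp: "f \<in> gs_hom G H \<Longrightarrow> gs_id G * f = f" "f \<in> gs_hom G H \<Longrightarrow> f * gs_id H = f"
  by (simp_all add: gs_id_def gs_hom_dims)

section \<open>Kernels and their universal property\<close>

lemma is_kernelD:
  assumes "is_kernel K i G H f"
  shows "fcgs K" "i \<in> gs_hom K G" "i * f = gs_zero K H"
    "\<And>T t. fcgs T \<Longrightarrow> t \<in> gs_hom T G \<Longrightarrow> t * f = gs_zero T H \<Longrightarrow> \<exists>s \<in> gs_hom T K. s * i = t"
  using assms unfolding is_kernel_def gs_comp_def by blast+

text \<open>Uniqueness of the factorization comes for free from the closed embedding, leaving only
  existence to be verified.\<close>

lemma is_kernelI: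
  assumes "fcgs K" "closed_emb K G i" "i * f = gs_zero K H"
    "\<And>T t. fcgs T \<Longrightarrow> t \<in> gs_hom T G \<Longrightarrow> t * f = gs_zero T H \<Longrightarrow> \<exists>s \<in> gs_hom T K. s * i = t"
  shows "is_kernel K i G H f"
  unfolding is_kernel_def gs_comp_def
proof (intro conjI allI impI)
  show "i \<in> gs_hom K G" using closed_embD(1)[OF assms(2)] .
  fix T t assume t: "fcgs T \<and> t \<in> gs_hom T G \<and> t * f = gs_zero T H"
  then obtain s where "s \<in> gs_hom T K" "s * i = t" using assms(4) by blast
  thus "\<exists>!s. s \<in> gs_hom T K \<and> s * i = t"
    using closed_emb_cancel[OF assms(2)] by blast
qed (use assms in auto)

lemma is_kernel_unique:
  assumes "is_kernel K i G H f" "s \<in> gs_hom T K" "t \<in> gs_hom T K" "s * i = t * i" 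
    "fcgs T" "fcgs G" "fcgs H" "f \<in> gs_hom G H"
  shows "s = t"
proof -
  note k = is_kernelD[OF assms(1)]
  have h: "t * i \<in> gs_hom T G" using hom_comp k assms by blast
  have "(t * i) * f = gs_zero T H"
    using hom_assoc[OF assms(3) k(2) assms(8)] zero_right[OF k(1) assms(7) assms(3)] k(3) by simp
  hence "\<exists>!s. s \<in> gs_hom T K \<and> s * i = t * i"
    using assms(1,5) h unfolding is_kernel_def gs_comp_def by blast
  thus ?thesis using assms by blast
qed

text \<open>The universal property alone does not mention matrices. Comparison with the kernel
  constructed as a quotient algebra transfers its linear splitting to any other kernel.\<close>

lemma kernel_closed_emb:
  assumes "is_kernel K i G H f" "fcgs G" "fcgs H" "f \<in> gs_hom G H"
  shows "closed_emb K G i"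
proof -
  obtain K0 \<pi> \<sigma> X where K0: "is_kernel K0 \<pi> G H f" and \<sigma>: "\<sigma> \<in> carrier_mat (order G) (order K0)"
      "\<pi> * \<sigma> = 1\<^sub>m (order K0)"
    by (rule kernel_exists[OF assms(2-4)])
  note k = is_kernelD[OF assms(1)] and k0 = is_kernelD[OF K0]
  obtain s where s: "s \<in> gs_hom K K0" "s * \<pi> = i" using k0(4)[OF k(1-3)] by blast
  obtain t where t: "t \<in> gs_hom K0 K" "t * i = \<pi>" using k(4)[OF k0(1-3)] by blast
  have "s * t * i = gs_id K * i"
    using hom_assoc[OF s(1) t(1) k(2)] s(2) t(2) gs_id_comp(1)[OF k(2)] by simp
  hence st: "s * t = gs_id K"
    using is_kernel_unique[OF assms(1) hom_comp[OF k(1) k0(1) k(1) s(1) t(1)] gs_id_hom[OF k(1)] _ k(1) assms(2-4)]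
    by blast
  note [simp] = gs_hom_dims[OF s(1)] gs_hom_dims[OF t(1)] gs_hom_dims[OF k0(2)] carrier_matD[OF \<sigma>(1)]
  have "i * (\<sigma> * t) = s * ((\<pi> * \<sigma>) * t)" unfolding s(2)[symmetric] by (simp add: mat_assoc)
  hence "i * (\<sigma> * t) = 1\<^sub>m (order K)" using st by (simp add: \<sigma>(2) gs_id_def)
  thus ?thesis using k(2) by (auto simp: closed_emb_def intro!: bexI[of _ "\<sigma> * t"] carrier_matI)
qed

lemma kernel_order_unique:
  assumes "is_kernel K i G H f" "is_kernel K' i' G H f" "fcgs G" "fcgs H" "f \<in> gs_hom G H"
  shows "order K \<le> order K'"
proof -
  note k = is_kernelD[OF assms(1)] and k' = is_kernelD[OF assms(2)]
  obtain s where s: "s \<in> gs_hom K K'" "s * i' = i" using k'(4)[OF k(1-3)] by blast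
  have "closed_emb K K' s"
    using closed_emb_first[OF s(1) k'(2)] kernel_closed_emb[OF assms(1,3-5)] s(2) by simp
  then obtain r where "r \<in> carrier_mat (order K') (order K)" "s * r = 1\<^sub>m (order K)"
    by (auto simp: closed_emb_def)
  thus ?thesis using left_inverse_dim gs_homD(1)[OF s(1)] by blast
qed

text \<open>A subgroup contained in a kernel and of the same order is the kernel. Kernels that are
  hard to reach by test maps are identified in this way.\<close>

lemma kernel_of_iso:
  assumes "is_kernel N \<nu> G H f" "fcgs K" "fcgs G" "fcgs H" "f \<in> gs_hom G H"
    and w: "w \<in> gs_hom K N" "closed_emb K G (w * \<nu>)" and ord: "order K = order N"
  shows "is_kernel K (w * \<nu>) G H f"
proof -
  note n = is_kernelD[OF assms(1)]
  have "closed_emb K N w" by (rule closed_emb_first[OF w(1) n(2) w(2)])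
  then obtain v where v: "v \<in> gs_hom N K" "w * v = gs_id K" "v * w = gs_id N"
    by (rule closed_emb_iso[OF assms(2) n(1) _ ord])
  show ?thesis
  proof (rule is_kernelI[OF assms(2) w(2)])
    show "w * \<nu> * f = gs_zero K H"
      using hom_assoc[OF w(1) n(2) assms(5)] zero_right[OF n(1) assms(4) w(1)] n(3) by simp
    fix T t assume "fcgs T" "t \<in> gs_hom T G" "t * f = gs_zero T H"
    then obtain s where s: "s \<in> gs_hom T N" "s * \<nu> = t" using n(4) by blast
    have "s * v * (w * \<nu>) = s * (v * w) * \<nu>"
      by (simp add: mat_assoc gs_hom_dims[OF s(1)] gs_hom_dims[OF v(1)] gs_hom_dims[OF w(1)] gs_hom_dims[OF n(2)])
    hence "s * v * (w * \<nu>) = t" using s v by (simp add: gs_id_comp)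
    thus "\<exists>s \<in> gs_hom T K. s * (w * \<nu>) = t" using hom_comp[OF \<open>fcgs T\<close> n(1) assms(2) s(1) v(1)] by blast
  qed
qed

lemma kernel_comp_closed_emb:
  assumes "fcgs G" "fcgs I" "fcgs H" "q \<in> gs_hom G I" "closed_emb I H i" "fcgs K"
  shows "is_kernel K \<kappa> G H (q * i) \<longleftrightarrow> is_kernel K \<kappa> G I q"
proof -
  note i = closed_embD(1)[OF assms(5)]
  have "t * (q * i) = gs_zero T H \<longleftrightarrow> t * q = gs_zero T I" if t: "t \<in> gs_hom T G" "fcgs T" for T t
  proof -
    have "t * (q * i) = gs_zero T H \<longleftrightarrow> t * q * i = gs_zero T I * i"
      using hom_assoc[OF t(1) assms(4) i] zero_left[OF t(2) assms(2) i] by simp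
    thus ?thesis
      using closed_emb_cancel[OF assms(5) hom_comp[OF t(2) assms(1,2) t(1) assms(4)] gs_zero_hom[OF t(2) assms(2)]]
      by auto
  qed
  thus ?thesis unfolding is_kernel_def gs_comp_def by (simp add: assms(6) cong: conj_cong)
qed

text \<open>The count in \<open>flat_cover\<close> concerns the constructed kernel; two kernels of
  one map embed in each other and so have equal orders.\<close>

theorem order_kernel_quotient:
  fixes G H :: "'k :: alg_closed_field hopf"
  assumes "fcgs G" "fcgs H" "quotient_map G H f" "is_kernel K i G H f"
  shows "order G = order K * order H"
proof -
  note f = quotient_mapD[OF assms(3)]
  obtain l where l: "l \<in> carrier_mat (order H) (order G)" "l * f = 1\<^sub>m (order H)"
    using assms(3) by (auto simp: quotient_map_def)
  obtain K0 \<pi> \<sigma> X where K0: "is_kernel K0 \<pi> G H f" "\<sigma> \<in> carrier_mat (order G) (order K0)"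
      "\<pi> * \<sigma> = 1\<^sub>m (order K0)" "X \<in> carrier_mat (order G * order H) (order G)"
      "1\<^sub>m (order G) - \<sigma> * \<pi> = aug_ideal G H f * X"
    by (rule kernel_exists[OF assms(1,2) f])
  interpret flat_cover G H f l K0 \<pi> \<sigma> X
    by unfold_locales (use assms f l K0 in auto)
  have "order K = order K0"
    using kernel_order_unique[OF assms(4) K0(1) assms(1,2) f] kernel_order_unique[OF K0(1) assms(4) assms(1,2) f]
    by simp
  thus ?thesis using order_eq by simp
qed

section \<open>Consequences of the multiplicativity of the order\<close>

lemma order_kernel_image:
  fixes G H :: "'k :: alg_closed_field hopf"
  assumes "fcgs G" "fcgs I" "fcgs H" "quotient_map G I q" "closed_emb I H i" "is_kernel K \<kappa> G H (q * i)"
  shows "order G = order K * order I"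
  using order_kernel_quotient[OF assms(1,2,4)] kernel_comp_closed_emb[OF assms(1-3) quotient_mapD[OF assms(4)] assms(5)]
    is_kernelD(1)[OF assms(6)] assms(6) by blast

text \<open>The image of \<open>f\<close> has order \<open>order G\<close> divided by
  \<open>order K\<close>, that is \<open>order H\<close>; hence its embedding in \<open>H\<close> is
  an isomorphism.\<close>

lemma quotient_map_of_order:
  fixes G H :: "'k :: alg_closed_field hopf"
  assumes "fcgs G" "fcgs H" "f \<in> gs_hom G H" "is_kernel K \<kappa> G H f" "order G = order K * order H"
  shows "quotient_map G H f"
proof -
  obtain I q i where I: "fcgs I" "quotient_map G I q" "closed_emb I H i" "f = q * i"
    using image_factorization[OF assms(1-3)] by (auto simp: gs_comp_def)
  have "order G = order K * order I" using order_kernel_image[OF assms(1) I(1) assms(2) I(2,3)] assms(4) I(4) by simp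
  moreover have "order K > 0" by (rule order_positive[OF is_kernelD(1)[OF assms(4)]])
  ultimately have ord: "order I = order H" using assms(5) by simp
  obtain r where r: "r \<in> gs_hom H I" "i * r = gs_id I" "r * i = gs_id H"
    by (rule closed_emb_iso[OF I(1) assms(2) I(3) ord])
  have "quotient_map I H i"
    using r gs_homD(1)[OF r(1)] closed_embD(1)[OF I(3)] by (auto simp: quotient_map_def gs_id_def)
  thus ?thesis unfolding I(4) by (rule quotient_map_comp[OF assms(1) I(1) assms(2) I(2)])
qed

text \<open>Cokernels are obtained from kernels by Cartier duality.\<close>

lemma cokernel_exists:
  fixes G K :: "'k :: alg_closed_field hopf"
  assumes K: "fcgs K" and G: "fcgs G" and emb: "closed_emb K G \<kappa>"
  obtains Q q where "fcgs Q" "quotient_map G Q q" "is_kernel K \<kappa> G Q q" "order G = order K * order Q"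
    "\<And>T t. fcgs T \<Longrightarrow> t \<in> gs_hom G T \<Longrightarrow> \<kappa> * t = gs_zero K T \<Longrightarrow> \<exists>s \<in> gs_hom Q T. q * s = t"
proof -
  interpret K: scheme K + G: scheme G using K G by unfold_locales
  note \<kappa> = closed_embD(1)[OF emb]
  obtain \<sigma> where \<sigma>: "\<sigma> \<in> carrier_mat (order G) (order K)" "\<kappa> * \<sigma> = 1\<^sub>m (order K)"
    using emb by (auto simp: closed_emb_def)
  note [simp] = gs_hom_dims[OF \<kappa>] carrier_matD[OF \<sigma>(1)]
  note dK = dual_scheme[OF K] and dG = dual_scheme[OF G] and d\<kappa> = dual_hom[OF K G \<kappa>]
  have "\<sigma>\<^sup>T * \<kappa>\<^sup>T = 1\<^sub>m (order K)" using arg_cong[OF \<sigma>(2), of transpose_mat] by (simp add: mat_transpose_mult)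
  hence qd: "quotient_map (dual_gs G) (dual_gs K) (\<kappa>\<^sup>T)"
    using d\<kappa> \<sigma> by (auto simp: quotient_map_def intro!: bexI[of _ "\<sigma>\<^sup>T"])
  obtain N \<nu> r X where N: "is_kernel N \<nu> (dual_gs G) (dual_gs K) (\<kappa>\<^sup>T)" and r: "r \<in> carrier_mat (order (dual_gs G)) (order N)"
    "\<nu> * r = 1\<^sub>m (order N)"
    by (rule kernel_exists[OF dG dK d\<kappa>])
  note n = is_kernelD[OF N]
  note [simp] = gs_hom_dims[OF n(2), simplified] carrier_matD[OF r(1), simplified]
  define Q q where "Q = dual_gs N" and "q = \<nu>\<^sup>T"
  have Q: "fcgs Q" unfolding Q_def by (rule dual_scheme[OF n(1)])
  have q: "q \<in> gs_hom G Q" using dual_hom[OF n(1) dG n(2)] by (simp add: Q_def q_def)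
  have "r\<^sup>T * q = 1\<^sub>m (order Q)" using arg_cong[OF r(2), of transpose_mat] by (simp add: mat_transpose_mult q_def Q_def)
  hence qm: "quotient_map G Q q" using q r by (auto simp: quotient_map_def Q_def intro!: bexI[of _ "r\<^sup>T"])
  have ord: "order G = order K * order Q"
    using order_kernel_quotient[OF dG dK qd N] by (simp add: Q_def)
  interpret N: scheme N using n(1) by unfold_locales
  have "(\<nu> * \<kappa>\<^sup>T)\<^sup>T = (gs_zero N (dual_gs K))\<^sup>T" using n(3) by simp
  hence \<kappa>q: "\<kappa> * q = gs_zero K Q"
    by (simp add: mat_transpose_mult q_def Q_def gs_zero_def)
  obtain M \<mu> where M: "is_kernel M \<mu> G Q q" using kernel_exists[OF G Q q] by metis
  note m = is_kernelD[OF M]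
  obtain s where s: "s \<in> gs_hom K M" "s * \<mu> = \<kappa>" using m(4)[OF K \<kappa> \<kappa>q] by blast
  \<comment> \<open>\<open>K\<close> lies in the kernel \<open>M\<close> of \<open>q\<close>, and
    multiplicativity on both sides of the duality gives them equal orders.\<close>
  have "order G = order M * order Q" by (rule order_kernel_quotient[OF G Q qm M])
  moreover have "order Q > 0" by (rule order_positive[OF Q])
  ultimately have "order K = order M" using ord by simp
  hence ker: "is_kernel K \<kappa> G Q q"
    using kernel_of_iso[OF M K G Q q s(1)] emb s(2) by simp
  show thesis
  proof (rule that[OF Q qm ker ord])
    fix T t assume T: "fcgs T" and t: "t \<in> gs_hom G T" and \<kappa>t: "\<kappa> * t = gs_zero K T"
    interpret T: scheme T using T by unfold_locales
    note [simp] = gs_hom_dims[OF t]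
    note dt = dual_hom[OF G T t]
    have "(\<kappa> * t)\<^sup>T = (gs_zero K T)\<^sup>T" using \<kappa>t by simp
    hence "t\<^sup>T * \<kappa>\<^sup>T = gs_zero (dual_gs T) (dual_gs K)" by (simp add: mat_transpose_mult gs_zero_def)
    then obtain v where v: "v \<in> gs_hom (dual_gs T) N" "v * \<nu> = t\<^sup>T" using n(4)[OF dual_scheme[OF T] dt] by blast
    have "v\<^sup>T \<in> gs_hom Q T" using dual_hom[OF dual_scheme[OF T] n(1) v(1)] by (simp add: Q_def)
    moreover have "(v * \<nu>)\<^sup>T = t" using v(2) by simp
    hence "q * v\<^sup>T = t" using gs_hom_dims[OF v(1)] by (simp add: mat_transpose_mult q_def)
    ultimately show "\<exists>s \<in> gs_hom Q T. q * s = t" by blast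
  qed
qed

text \<open>Any quotient map with kernel \<open>K\<close> is a cokernel of \<open>K\<close>: the
  constructed cokernel maps onto \<open>E\<close> and has the same order, so the two are
  isomorphic.\<close>

lemma quotient_factor:
  fixes P E T :: "'k :: alg_closed_field hopf"
  assumes "fcgs P" "fcgs E" "quotient_map P E q" "is_kernel K \<kappa> P E q"
    and "fcgs T" "t \<in> gs_hom P T" "\<kappa> * t = gs_zero K T"
  obtains s where "s \<in> gs_hom E T" "q * s = t"
proof -
  note q = quotient_mapD[OF assms(3)] and k = is_kernelD[OF assms(4)]
  obtain Q q0 where Q: "fcgs Q" "quotient_map P Q q0" "order P = order K * order Q"
    and fac: "\<And>T t. fcgs T \<Longrightarrow> t \<in> gs_hom P T \<Longrightarrow> \<kappa> * t = gs_zero K T \<Longrightarrow> \<exists>s \<in> gs_hom Q T. q0 * s = t"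
    using cokernel_exists[OF k(1) assms(1) kernel_closed_emb[OF assms(4,1,2) q]] by metis
  note q0 = quotient_mapD[OF Q(2)]
  obtain s0 where s0: "s0 \<in> gs_hom Q E" "q0 * s0 = q" using fac[OF assms(2) q k(3)] by blast
  obtain s1 where s1: "s1 \<in> gs_hom Q T" "q0 * s1 = t" using fac[OF assms(5-7)] by blast
  have "quotient_map Q E s0" using quotient_map_second[OF q0 s0(1)] s0(2) assms(3) by simp
  moreover have "order K > 0" by (rule order_positive[OF k(1)])
  hence "order Q = order E" using order_kernel_quotient[OF assms(1-4)] Q(3) by simp
  ultimately obtain g where g: "g \<in> gs_hom E Q" "s0 * g = gs_id Q" "g * s0 = gs_id E"
    using quotient_map_iso[OF Q(1) assms(2)] by blast
  have "q * (g * s1) = q0 * ((s0 * g) * s1)"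
    unfolding s0(2)[symmetric]
    by (simp add: mat_assoc gs_hom_dims[OF q0] gs_hom_dims[OF s0(1)] gs_hom_dims[OF g(1)] gs_hom_dims[OF s1(1)])
  hence "q * (g * s1) = t" using g s1 by (simp add: gs_id_comp)
  thus thesis using that hom_comp[OF assms(2) Q(1) assms(5) g(1) s1(1)] by blast
qed

text \<open>If \<open>e\<close> and \<open>e * f\<close> have the same kernel, then \<open>E\<close>
  and the image of \<open>f\<close> have the same order, so \<open>f\<close> loses nothing.\<close>

lemma closed_emb_of_kernel:
  fixes P E F :: "'k :: alg_closed_field hopf"
  assumes "fcgs P" "fcgs E" "fcgs F" "quotient_map P E e" "is_kernel K k P E e"
    and f: "f \<in> gs_hom E F" and ker: "is_kernel K k P F (e * f)"
  shows "closed_emb E F f"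
proof -
  obtain I q i where I: "fcgs I" "quotient_map E I q" "closed_emb I F i" "f = q * i"
    using image_factorization[OF assms(2,3) f] by (auto simp: gs_comp_def)
  note q = quotient_mapD[OF I(2)] and i = closed_embD(1)[OF I(3)] and e = quotient_mapD[OF assms(4)]
  have eq: "e * f = (e * q) * i" unfolding I(4) using hom_assoc[OF e q i] by simp
  have "quotient_map P I (e * q)" by (rule quotient_map_comp[OF assms(1,2) I(1) assms(4) I(2)])
  hence "order P = order K * order I"
    using order_kernel_image[OF assms(1) I(1) assms(3) _ I(3)] ker eq by simp
  moreover have "order P = order K * order E" by (rule order_kernel_quotient[OF assms(1,2,4,5)])
  moreover have "order K > 0" by (rule order_positive[OF is_kernelD(1)[OF ker]])
  ultimately have "order E = order I" by simp
  then obtain r where r: "r \<in> gs_hom I E" "q * r = gs_id E" "r * q = gs_id I"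
    using quotient_map_iso[OF assms(2) I(1,2)] by blast
  have "closed_emb E I q" using r gs_homD(1)[OF r(1)] q by (auto simp: closed_emb_def gs_id_def)
  thus ?thesis unfolding I(4) by (rule closed_emb_comp[OF assms(2) I(1) assms(3) _ I(3)])
qed

text \<open>Quotient maps stay quotient maps over a closed subgroup. The pullback \<open>Q\<close>
  is the kernel of \<open>G -> I -> I/E\<close>; it contains the kernel of \<open>e\<close>, and
  comparing orders shows that it maps onto \<open>E\<close>.\<close>

lemma pullback_quotient:
  fixes G I E :: "'k :: alg_closed_field hopf"
  assumes G: "fcgs G" and I: "fcgs I" and E: "fcgs E" and e: "quotient_map G I e" and s: "closed_emb E I s"
  obtains Q i f where "fcgs Q" "closed_emb Q G i" "quotient_map Q E f" "i * e = f * s"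
proof -
  note eh = quotient_mapD[OF e] and sh = closed_embD(1)[OF s]
  obtain C c where C: "fcgs C" "quotient_map I C c" "is_kernel E s I C c" "order I = order E * order C"
    using cokernel_exists[OF E I s] by metis
  note c = quotient_mapD[OF C(2)] and ks = is_kernelD[OF C(3)]
  have ec: "quotient_map G C (e * c)" by (rule quotient_map_comp[OF G I C(1) e C(2)])
  obtain Q i where Q: "is_kernel Q i G C (e * c)" using kernel_exists[OF G C(1) quotient_mapD[OF ec]] by metis
  note kq = is_kernelD[OF Q]
  have ci: "closed_emb Q G i" by (rule kernel_closed_emb[OF Q G C(1) quotient_mapD[OF ec]])
  obtain K k where K: "is_kernel K k G I e" using kernel_exists[OF G I eh] by metis
  note kk = is_kernelD[OF K]
  have ie: "i * e \<in> gs_hom Q I" by (rule hom_comp[OF kq(1) G I kq(2) eh])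
  have "i * e * c = gs_zero Q C" using hom_assoc[OF kq(2) eh c] kq(3) by simp
  then obtain f where f: "f \<in> gs_hom Q E" "f * s = i * e" using ks(4)[OF kq(1) ie] by blast
  have "k * (e * c) = gs_zero K C"
    using hom_assoc[OF kk(2) eh c] kk(3) zero_left[OF kk(1) I c] by simp
  then obtain w where w: "w \<in> gs_hom K Q" "w * i = k" using kq(4)[OF kk(1,2)] by blast
  have "is_kernel K w Q I (f * s)"
  proof (rule is_kernelI[OF kk(1)])
    show "closed_emb K Q w"
      using closed_emb_first[OF w(1) kq(2)] kernel_closed_emb[OF K G I eh] w(2) by simp
    show "w * (f * s) = gs_zero K I"
      unfolding f(2) using hom_assoc[OF w(1) kq(2) eh] w(2) kk(3) by simp
    fix T t assume T: "fcgs T" and t: "t \<in> gs_hom T Q" and 0: "t * (f * s) = gs_zero T I"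
    have ti: "t * i \<in> gs_hom T G" by (rule hom_comp[OF T kq(1) G t kq(2)])
    have "t * i * e = gs_zero T I" using 0 unfolding f(2) using hom_assoc[OF t kq(2) eh] by simp
    then obtain v where v: "v \<in> gs_hom T K" "v * k = t * i" using kk(4)[OF T ti] by blast
    have "v * w * i = t * i" using hom_assoc[OF v(1) w(1) kq(2)] w(2) v(2) by simp
    hence "v * w = t" using closed_emb_cancel[OF ci hom_comp[OF T kk(1) kq(1) v(1) w(1)] t] by blast
    thus "\<exists>v \<in> gs_hom T K. v * w = t" using v(1) by blast
  qed
  hence kw: "is_kernel K w Q E f" using kernel_comp_closed_emb[OF kq(1) E I f(1) s kk(1)] by simp
  have "order C > 0" by (rule order_positive[OF C(1)])
  moreover have "order K * order E * order C = order Q * order C"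
    using order_kernel_quotient[OF G I e K] order_kernel_quotient[OF G C(1) ec Q] C(4) by (metis mult.assoc)
  ultimately have "order Q = order K * order E" by simp
  hence "quotient_map Q E f" by (rule quotient_map_of_order[OF kq(1) E f(1) kw])
  thus thesis using that kq(1) ci f(2) by metis
qed

section \<open>Multiplication by integers and \<open>p\<close>-divisible groups\<close>

text \<open>Exchanging the inner two of four factors does not change their product. This is the
  commutativity that makes a sum of homomorphisms compatible with multiplication.\<close>

lemma (in bialg) m_interchange:
  "m * ((m \<otimes>\<^sub>m m) * (1\<^sub>m n \<otimes>\<^sub>m swap n n \<otimes>\<^sub>m 1\<^sub>m n)) = m * (m \<otimes>\<^sub>m m)"
proof -
  let ?I = "1\<^sub>m n :: 'k mat"
  have mm: "m * (m \<otimes>\<^sub>m m) = m * (?I \<otimes>\<^sub>m (m * (m \<otimes>\<^sub>m ?I)))"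
  proof -
    have "m \<otimes>\<^sub>m m = (m \<otimes>\<^sub>m ?I) * (?I \<otimes>\<^sub>m (?I \<otimes>\<^sub>m m))"
      by (simp add: kron_assoc[symmetric] kron_mult kron_one)
    hence "m * (m \<otimes>\<^sub>m m) = (m * (m \<otimes>\<^sub>m ?I)) * (?I \<otimes>\<^sub>m (?I \<otimes>\<^sub>m m))" by (simp add: mat_assoc mult.assoc)
    also have "\<dots> = m * (?I \<otimes>\<^sub>m (m * (?I \<otimes>\<^sub>m m)))" unfolding m_assoc by (simp add: mat_assoc kron_mult mult.assoc)
    finally show ?thesis by (simp add: m_assoc)
  qed
  have "m * ((m \<otimes>\<^sub>m m) * (?I \<otimes>\<^sub>m swap n n \<otimes>\<^sub>m ?I)) = (m * (m \<otimes>\<^sub>m m)) * (?I \<otimes>\<^sub>m (swap n n \<otimes>\<^sub>m ?I))"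
    by (simp add: mat_assoc mult.assoc)
  also have "\<dots> = m * (m \<otimes>\<^sub>m m)" unfolding mm by (simp add: mat_assoc kron_mult m_comm mult.assoc)
  finally show ?thesis .
qed

definition conv :: "'k :: field hopf \<Rightarrow> 'k hopf \<Rightarrow> 'k mat \<Rightarrow> 'k mat \<Rightarrow> 'k mat" where
  "conv G H f g = mult G * (f \<otimes>\<^sub>m g) * comult H"

lemma conv_mult_unit:
  assumes "fcgs G" "fcgs H" and f: "f \<in> gs_hom G H" and g: "g \<in> gs_hom G H"
  shows "conv G H f g * mult H = mult G * (conv G H f g \<otimes>\<^sub>m conv G H f g)"
    "conv G H f g * unit H = unit G"
proof -
  interpret G: scheme G + H: scheme H using assms by unfold_locales
  note [simp] = gs_hom_dims[OF f] gs_hom_dims[OF g]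
  note F = gs_homD[OF f] and g_eqs = gs_homD[OF g]
  let ?I = "1\<^sub>m (order G)" and ?J = "1\<^sub>m (order H)"
  let ?sG = "swap (order G) (order G) :: 'a mat" and ?sH = "swap (order H) (order H) :: 'a mat"
  have "conv G H f g * mult H =
    mult G * ((f \<otimes>\<^sub>m g) * ((mult H \<otimes>\<^sub>m mult H) * ((?J \<otimes>\<^sub>m ?sH \<otimes>\<^sub>m ?J) * (comult H \<otimes>\<^sub>m comult H))))"
    by (simp add: conv_def mat_assoc H.D_m)
  also have "\<dots> = mult G * ((mult G \<otimes>\<^sub>m mult G) *
      (((f \<otimes>\<^sub>m f) \<otimes>\<^sub>m (g \<otimes>\<^sub>m g)) * ((?J \<otimes>\<^sub>m ?sH \<otimes>\<^sub>m ?J) * (comult H \<otimes>\<^sub>m comult H))))"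
    by (simp add: kron_mult_pull F(2) g_eqs(2) mult.assoc)
  also have "(f \<otimes>\<^sub>m f) \<otimes>\<^sub>m (g \<otimes>\<^sub>m g) = f \<otimes>\<^sub>m ((f \<otimes>\<^sub>m g) \<otimes>\<^sub>m g)" by (simp add: kron_assoc)
  also have "(f \<otimes>\<^sub>m ((f \<otimes>\<^sub>m g) \<otimes>\<^sub>m g)) * ((?J \<otimes>\<^sub>m ?sH \<otimes>\<^sub>m ?J) * (comult H \<otimes>\<^sub>m comult H)) =
     (?I \<otimes>\<^sub>m ?sG \<otimes>\<^sub>m ?I) * ((f \<otimes>\<^sub>m ((g \<otimes>\<^sub>m f) \<otimes>\<^sub>m g)) * (comult H \<otimes>\<^sub>m comult H))"
    using swap_kron[of g f] by (simp add: kron_mult_pull kron_mult mult.assoc)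
  also have "f \<otimes>\<^sub>m ((g \<otimes>\<^sub>m f) \<otimes>\<^sub>m g) = (f \<otimes>\<^sub>m g) \<otimes>\<^sub>m (f \<otimes>\<^sub>m g)" by (simp add: kron_assoc)
  also have "((f \<otimes>\<^sub>m g) \<otimes>\<^sub>m (f \<otimes>\<^sub>m g)) * (comult H \<otimes>\<^sub>m comult H) = ((f \<otimes>\<^sub>m g) * comult H) \<otimes>\<^sub>m ((f \<otimes>\<^sub>m g) * comult H)"
    by (simp add: kron_mult)
  also have "mult G * ((mult G \<otimes>\<^sub>m mult G) * ((?I \<otimes>\<^sub>m ?sG \<otimes>\<^sub>m ?I) * \<dots>)) =
    (mult G * ((mult G \<otimes>\<^sub>m mult G) * (?I \<otimes>\<^sub>m ?sG \<otimes>\<^sub>m ?I))) * (((f \<otimes>\<^sub>m g) * comult H) \<otimes>\<^sub>m ((f \<otimes>\<^sub>m g) * comult H))"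
    by (simp add: mat_assoc mult.assoc)
  also have "\<dots> = mult G * (conv G H f g \<otimes>\<^sub>m conv G H f g)"
    unfolding G.m_interchange by (simp add: conv_def mat_assoc kron_mult)
  finally show "conv G H f g * mult H = mult G * (conv G H f g \<otimes>\<^sub>m conv G H f g)" .
  have "unit G \<otimes>\<^sub>m unit G = (unit G \<otimes>\<^sub>m ?I) * unit G" by (simp add: kron_vec)
  thus "conv G H f g * unit H = unit G"
    by (simp add: conv_def mat_assoc H.D_u kron_mult F(3) g_eqs(3) mult_pull[OF G.unit_left])
qed

text \<open>Transposing a sum gives the sum of the transposes on the Cartier duals, so the coalgebra
  half of the claim is the algebra half for the duals.\<close>

lemma conv_hom:
  assumes "fcgs G" "fcgs H" and f: "f \<in> gs_hom G H" and g: "g \<in> gs_hom G H"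
  shows "conv G H f g \<in> gs_hom G H"
proof -
  interpret G: scheme G + H: scheme H using assms by unfold_locales
  note [simp] = gs_hom_dims[OF f] gs_hom_dims[OF g]
  have d: "(conv G H f g)\<^sup>T = conv (dual_gs H) (dual_gs G) (f\<^sup>T) (g\<^sup>T)"
    by (simp add: conv_def mat_transpose_mult kron_transpose mat_assoc)
  have [simp]: "dim_row (conv G H f g) = order G" "dim_col (conv G H f g) = order H" by (simp_all add: conv_def)
  note c = conv_mult_unit[OF dual_scheme[OF assms(2)] dual_scheme[OF assms(1)] dual_hom[OF assms(1,2) f] dual_hom[OF assms(1,2) g], folded d]
  show ?thesis
    by (rule gs_homI)
      (use conv_mult_unit[OF assms] arg_cong[OF c(1), of transpose_mat] arg_cong[OF c(2), of transpose_mat] in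
        \<open>simp_all add: mat_transpose_mult kron_transpose carrier_matI\<close>)
qed

lemma times_hom:
  assumes "fcgs G"
  shows "gs_times G n \<in> gs_hom G G"
proof (induction n)
  case (Suc n)
  thus ?case using conv_hom[OF assms assms gs_id_hom[OF assms] Suc] by (simp add: conv_def)
qed (simp add: gs_zero_hom assms)

lemma times_natural:
  assumes "fcgs G" "fcgs H" and f: "f \<in> gs_hom G H"
  shows "f * gs_times H n = gs_times G n * f"
proof (induction n)
  case 0
  show ?case using zero_right[OF assms(2,2) f] zero_left[OF assms(1,1) f] by simp
next
  case (Suc n)
  interpret G: scheme G + H: scheme H using assms by unfold_locales
  note [simp] = gs_hom_dims[OF f] gs_hom_dims[OF times_hom[OF assms(1)]] gs_hom_dims[OF times_hom[OF assms(2)]]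
  note F = gs_homD[OF f]
  have "f * gs_times H (Suc n) = mult G * ((f \<otimes>\<^sub>m (f * gs_times H n)) * comult H)"
    by (simp add: gs_id_def mat_assoc mult_pull[OF F(2)] kron_mult_pull)
  also have "\<dots> = gs_times G (Suc n) * f"
    unfolding Suc by (simp add: gs_id_def mat_assoc F(4) kron_mult_pull)
  finally show ?case .
qed

lemma times_add:
  assumes "fcgs G"
  shows "gs_times G (x + y) = conv G G (gs_times G x) (gs_times G y)"
proof (induction x)
  case 0
  interpret G: scheme G using assms by unfold_locales
  note [simp] = gs_hom_dims[OF times_hom[OF assms]]
  let ?I = "1\<^sub>m (order G)" and ?y = "gs_times G y"
  have "conv G G (gs_zero G G) ?y = mult G * ((unit G * counit G) \<otimes>\<^sub>m (?I * (?y * ?I))) * comult G"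
    by (simp add: conv_def gs_zero_def)
  also have "\<dots> = mult G * ((unit G \<otimes>\<^sub>m ?I) * ((1\<^sub>m 1 \<otimes>\<^sub>m ?y) * ((counit G \<otimes>\<^sub>m ?I) * comult G)))"
    by (simp add: mat_assoc kron_mult_pull del: kron_one1)
  also have "\<dots> = ?y" by (simp add: G.counit_left mult_pull[OF G.unit_left])
  finally show ?case by simp
next
  case (Suc x)
  interpret G: scheme G using assms by unfold_locales
  note [simp] = gs_hom_dims[OF times_hom[OF assms]]
  let ?I = "1\<^sub>m (order G)" and ?x = "gs_times G x" and ?y = "gs_times G y"
  have "gs_times G (Suc x + y) = mult G * (?I \<otimes>\<^sub>m conv G G ?x ?y) * comult G" by (simp add: Suc gs_id_def)
  also have "\<dots> = mult G * ((?I \<otimes>\<^sub>m mult G) * ((?I \<otimes>\<^sub>m (?x \<otimes>\<^sub>m ?y)) * ((?I \<otimes>\<^sub>m comult G) * comult G)))"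
    by (simp add: conv_def mat_assoc kron_mult_pull)
  also have "\<dots> = (mult G * (mult G \<otimes>\<^sub>m ?I)) * ((?I \<otimes>\<^sub>m (?x \<otimes>\<^sub>m ?y)) * ((comult G \<otimes>\<^sub>m ?I) * comult G))"
    unfolding G.D_coassoc G.m_assoc by (simp add: mat_assoc mult.assoc)
  also have "\<dots> = mult G * ((mult G * ((?I \<otimes>\<^sub>m ?x) * comult G)) \<otimes>\<^sub>m ?y) * comult G"
    by (simp add: mat_assoc kron_assoc[symmetric] kron_mult_pull mult.assoc)
  also have "\<dots> = conv G G (gs_times G (Suc x)) ?y" by (simp add: conv_def gs_id_def mat_assoc)
  finally show ?case .
qed

lemma times_mult:
  assumes "fcgs G"
  shows "gs_times G (x * y) = gs_times G x * gs_times G y"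
proof (induction x)
  case 0
  show ?case using zero_left[OF assms assms times_hom[OF assms]] by simp
next
  case (Suc x)
  interpret G: scheme G using assms by unfold_locales
  note [simp] = gs_hom_dims[OF times_hom[OF assms]]
  note Y = gs_homD[OF times_hom[OF assms, of y]]
  have "gs_times G (Suc x * y) = conv G G (gs_times G y) (gs_times G x * gs_times G y)"
    using times_add[OF assms, of y "x * y"] Suc by simp
  also have "\<dots> = gs_times G (Suc x) * gs_times G y"
    by (simp add: conv_def gs_id_def mat_assoc Y(4) kron_mult_pull)
  finally show ?case .
qed

lemma times_power_add: "fcgs G \<Longrightarrow> gs_times G (p ^ (x + y)) = gs_times G (p ^ x) * gs_times G (p ^ y)"
  by (simp add: power_add times_mult)

lemma times_zero_mono:
  assumes "fcgs G" "gs_times G (p ^ x) = gs_zero G G" "x \<le> y"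
  shows "gs_times G (p ^ y) = gs_zero G G"
proof -
  have "gs_times G (p ^ y) = gs_times G (p ^ x) * gs_times G (p ^ (y - x))"
    using times_power_add[OF assms(1), of p x "y - x"] assms(3) by simp
  thus ?thesis using zero_left[OF assms(1,1) times_hom[OF assms(1)]] assms(2) by simp
qed

lemma killed_of_quotient:
  assumes "fcgs G" "fcgs Q" "quotient_map G Q q" "q * gs_times Q x = gs_zero G Q"
  shows "gs_times Q x = gs_zero Q Q"
  by (rule quotient_map_cancel[OF assms(3) times_hom[OF assms(2)] gs_zero_hom[OF assms(2,2)]])
     (use assms(4) zero_right[OF assms(2,2) quotient_mapD[OF assms(3)]] in simp)

section \<open>Torsion subgroups of a p-divisible group\<close>

locale pdivisible =
  fixes p :: nat and D :: "'k :: alg_closed_field pdiv" and h :: nat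
  assumes T_scheme: "fcgs (torsion D n)"
    and T_order: "order (torsion D n) = p ^ (h * n)"
    and incl_kernel: "is_kernel (torsion D n) (incl D n) (torsion D (Suc n)) (torsion D (Suc n))
           (gs_times (torsion D (Suc n)) (p ^ n))"

lemma pdivisible_iff: "p_divisible_group p D \<longleftrightarrow> (\<exists>h. pdivisible p D h)"
  by (auto simp: p_divisible_group_def pdivisible_def)

context pdivisible
begin

abbreviation "T \<equiv> torsion D"
abbreviation "i \<equiv> incl D"
abbreviation "ii \<equiv> incl_iter D"

lemma incl_hom: "i n \<in> gs_hom (T n) (T (Suc n))"
  using is_kernelD(2)[OF incl_kernel] .

lemma incl_emb: "closed_emb (T n) (T (Suc n)) (i n)"
  by (rule kernel_closed_emb[OF incl_kernel T_scheme T_scheme times_hom[OF T_scheme]])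

text \<open>The kernel condition annihilates \<open>T n\<close> only inside
  \<open>T (Suc n)\<close>; naturality of multiplication and the embedding bring this back to
  \<open>T n\<close>.\<close>

lemma T_killed: "n \<le> m \<Longrightarrow> gs_times (T n) (p ^ m) = gs_zero (T n) (T n)"
proof (rule times_zero_mono[OF T_scheme])
  show "gs_times (T n) (p ^ n) = gs_zero (T n) (T n)"
  proof (rule closed_emb_cancel[OF incl_emb times_hom[OF T_scheme] gs_zero_hom[OF T_scheme T_scheme]])
    show "gs_times (T n) (p ^ n) * i n = gs_zero (T n) (T n) * i n"
      using times_natural[OF T_scheme T_scheme incl_hom, of n "p ^ n"] is_kernelD(3)[OF incl_kernel[of n]]
        zero_left[OF T_scheme T_scheme incl_hom, of n n] by simp
  qed
qed

lemma ii_Suc: "ii n (Suc r) = ii n r * i (n + r)"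
  by (simp add: gs_comp_def)

lemma ii_emb: "closed_emb (T n) (T (n + r)) (ii n r)"
proof (induction r)
  case 0
  have "gs_id (T n) * gs_id (T n) = gs_id (T n)" by (simp add: gs_id_def)
  thus ?case using gs_id_hom[OF T_scheme[of n]] by (auto simp: closed_emb_def gs_id_def intro!: bexI[of _ "1\<^sub>m (order (T n))"])
next
  case (Suc r)
  show ?case using closed_emb_comp[OF T_scheme T_scheme T_scheme Suc incl_emb[of "n + r"]] by (simp add: gs_comp_def)
qed

lemma ii_hom: "ii n r \<in> gs_hom (T n) (T (n + r))"
  using closed_embD(1)[OF ii_emb] .

lemma ii_add: "ii n (r + s) = ii n r * ii (n + r) s"
proof (induction s)
  case 0
  show ?case using gs_id_comp(2)[OF ii_hom[of n r]] by simp
next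
  case (Suc s)
  have "ii n (r + Suc s) = (ii n r * ii (n + r) s) * i (n + r + s)"
    using Suc by (simp add: gs_comp_def add.assoc)
  also have "\<dots> = ii n r * (ii (n + r) s * i (n + r + s))"
    by (rule hom_assoc[OF ii_hom ii_hom incl_hom])
  finally show ?case by (simp add: gs_comp_def)
qed

lemma ii_1: "ii n 1 = i n"
  using gs_id_comp(1)[OF incl_hom[of n]] by (simp add: gs_comp_def)

lemma ii_Suc_left: "ii n (Suc r) = i n * ii (Suc n) r"
  using ii_add[of n 1 r] ii_1 by simp

text \<open>Induction on \<open>r\<close>: a map killed by \<open>p ^ n\<close> is killed by
  \<open>p ^ (n + r)\<close>, hence factors one level down, where it is still killed by
  \<open>p ^ n\<close>.\<close>

lemma ii_kernel: "is_kernel (T n) (ii n r) (T (n + r)) (T (n + r)) (gs_times (T (n + r)) (p ^ n))"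
proof (rule is_kernelI[OF T_scheme ii_emb])
  show "ii n r * gs_times (T (n + r)) (p ^ n) = gs_zero (T n) (T (n + r))"
    using times_natural[OF T_scheme T_scheme ii_hom] T_killed[of n n] zero_left[OF T_scheme T_scheme ii_hom] by simp
  fix S :: "'k hopf" and t assume S: "fcgs S"
  show "t \<in> gs_hom S (T (n + r)) \<Longrightarrow> t * gs_times (T (n + r)) (p ^ n) = gs_zero S (T (n + r)) \<Longrightarrow>
    \<exists>s \<in> gs_hom S (T n). s * ii n r = t"
  proof (induction r arbitrary: t)
    case 0
    thus ?case using gs_id_comp(2)[of t S "T n"] by auto
  next
    case (Suc r)
    let ?N = "Suc (n + r)"
    have t: "t \<in> gs_hom S (T ?N)" and 0: "t * gs_times (T ?N) (p ^ n) = gs_zero S (T ?N)" using Suc.prems by auto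
    have "t * gs_times (T ?N) (p ^ (n + r)) = (t * gs_times (T ?N) (p ^ n)) * gs_times (T ?N) (p ^ r)"
      unfolding times_power_add[OF T_scheme] by (rule hom_assoc[OF t times_hom[OF T_scheme] times_hom[OF T_scheme], symmetric])
    also have "\<dots> = gs_zero S (T ?N)" unfolding 0 by (rule zero_left[OF S T_scheme times_hom[OF T_scheme]])
    finally obtain s where s: "s \<in> gs_hom S (T (n + r))" "s * i (n + r) = t"
      using is_kernelD(4)[OF incl_kernel S t] by blast
    have "s * gs_times (T (n + r)) (p ^ n) = gs_zero S (T (n + r))"
    proof (rule closed_emb_cancel[OF incl_emb hom_comp[OF S T_scheme T_scheme s(1) times_hom[OF T_scheme]] gs_zero_hom[OF S T_scheme]])
      have "s * gs_times (T (n + r)) (p ^ n) * i (n + r) = s * (gs_times (T (n + r)) (p ^ n) * i (n + r))"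
        by (rule hom_assoc[OF s(1) times_hom[OF T_scheme] incl_hom])
      also have "\<dots> = s * i (n + r) * gs_times (T ?N) (p ^ n)"
        unfolding times_natural[OF T_scheme T_scheme incl_hom, symmetric]
        by (rule hom_assoc[OF s(1) incl_hom times_hom[OF T_scheme], symmetric])
      also have "\<dots> = gs_zero S (T (n + r)) * i (n + r)"
        unfolding s(2) 0 by (rule zero_left[OF S T_scheme incl_hom, symmetric])
      finally show "s * gs_times (T (n + r)) (p ^ n) * i (n + r) = gs_zero S (T (n + r)) * i (n + r)" .
    qed
    then obtain v where v: "v \<in> gs_hom S (T n)" "v * ii n r = s" using Suc.IH[OF s(1)] by blast
    have "v * ii n (Suc r) = t"
      unfolding ii_Suc using hom_assoc[OF v(1) ii_hom[of n r] incl_hom] v(2) s(2) by simp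
    thus ?case using v(1) by blast
  qed
qed

text \<open>Divisibility in the usual sense. Multiplication by \<open>p ^ r\<close> lands in
  \<open>T n\<close> and has kernel \<open>T r\<close>; since orders are powers of \<open>p\<close>
  with exponents linear in the level, it is onto.\<close>

lemma multiplication_quotient:
  obtains j where "quotient_map (T (n + r)) (T n) j" "j * ii n r = gs_times (T (n + r)) (p ^ r)"
proof -
  let ?N = "n + r"
  have "gs_times (T ?N) (p ^ r) * gs_times (T ?N) (p ^ n) = gs_zero (T ?N) (T ?N)"
    using times_power_add[OF T_scheme[of ?N], of p r n] T_killed[of ?N "r + n"] by (simp add: add.commute)
  then obtain j where j: "j \<in> gs_hom (T ?N) (T n)" "j * ii n r = gs_times (T ?N) (p ^ r)"
    using is_kernelD(4)[OF ii_kernel T_scheme times_hom[OF T_scheme]] by blast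
  have "is_kernel (T r) (ii r n) (T ?N) (T ?N) (j * ii n r)"
    using ii_kernel[of r n] j(2) by (simp add: add.commute)
  hence "is_kernel (T r) (ii r n) (T ?N) (T n) j"
    using kernel_comp_closed_emb[OF T_scheme T_scheme T_scheme j(1) ii_emb T_scheme] by simp
  hence "quotient_map (T ?N) (T n) j"
    by (rule quotient_map_of_order[OF T_scheme T_scheme j(1)])
       (simp add: T_order power_add[symmetric] distrib_left add.commute)
  thus thesis using that j(2) by blast
qed

end

lemma pdiv_homD:
  assumes "g \<in> pdiv_hom D E"
  shows "g n \<in> gs_hom (torsion D n) (torsion E n)" "incl D n * g (Suc n) = g n * incl E n"
  using assms by (auto simp: pdiv_hom_def gs_comp_def)

lemma pdiv_hom_iter:
  assumes "pdivisible p D h" "pdivisible p E h'" and g: "g \<in> pdiv_hom D E"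
  shows "incl_iter D n r * g (n + r) = g n * incl_iter E n r"
proof (induction r)
  case 0
  show ?case using gs_id_comp[OF pdiv_homD(1)[OF g]] by simp
next
  case (Suc r)
  interpret D: pdivisible p D h by fact
  interpret E: pdivisible p E h' by fact
  have "D.ii n (Suc r) * g (n + Suc r) = D.ii n r * (D.i (n + r) * g (Suc (n + r)))"
    unfolding D.ii_Suc using hom_assoc[OF D.ii_hom D.incl_hom pdiv_homD(1)[OF g]] by simp
  also have "\<dots> = (D.ii n r * g (n + r)) * E.i (n + r)"
    unfolding pdiv_homD(2)[OF g] by (rule hom_assoc[OF D.ii_hom pdiv_homD(1)[OF g] E.incl_hom, symmetric])
  also have "\<dots> = g n * E.ii n (Suc r)"
    unfolding Suc E.ii_Suc by (rule hom_assoc[OF pdiv_homD(1)[OF g] E.ii_hom E.incl_hom])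
  finally show ?case .
qed

section \<open>Quotients of \<open>p\<close>-divisible groups\<close>

lemma times_dims: "fcgs G \<Longrightarrow> dim_row (gs_times G x) = order G" "fcgs G \<Longrightarrow> dim_col (gs_times G x) = order G"
  by (simp_all add: gs_hom_dims[OF times_hom])

lemma zero_dims: "fcgs G \<Longrightarrow> fcgs H \<Longrightarrow> dim_row (gs_zero G H) = order G"
  "fcgs G \<Longrightarrow> fcgs H \<Longrightarrow> dim_col (gs_zero G H) = order H"
  by (simp_all add: gs_hom_dims[OF gs_zero_hom])

lemma mat_mult_zero_vec: "A \<in> carrier_mat r n \<Longrightarrow> A *\<^sub>v 0\<^sub>v n = (0\<^sub>v r :: 'a :: semiring_0 vec)"
  by (intro eq_vecI) (auto simp: scalar_prod_def)

text \<open>It suffices that some cover \<open>Q n\<close> of \<open>E[p^n]\<close> maps to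
  \<open>D[p^(n+r)]\<close> over \<open>E\<close>: functions on \<open>E[p^n]\<close> inject into
  those on the cover, so one killed by \<open>g\<close> must vanish.\<close>

lemma pdiv_surjI:
  assumes g: "g \<in> pdiv_hom D E" and "\<And>n. fcgs (torsion E n)"
    and "\<And>n. incl_iter E n (r n) \<in> gs_hom (torsion E n) (torsion E (n + r n))"
    and y: "\<And>n. quotient_map (Q n) (torsion E n) (y n)" and z: "\<And>n. z n \<in> gs_hom (Q n) (torsion D (n + r n))"
    and eq: "\<And>n. z n * g (n + r n) = y n * incl_iter E n (r n)"
  shows "pdiv_surj D E g"
  unfolding pdiv_surj_def
proof (intro allI exI[of _ "r n" for n] ballI impI)
  fix n x
  let ?N = "n + r n"
  assume x: "x \<in> carrier_vec (order (torsion E ?N))" and 0: "g ?N *\<^sub>v x = 0\<^sub>v (order (torsion D ?N))"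
  obtain l where l: "l \<in> carrier_mat (order (torsion E n)) (order (Q n))" "l * y n = 1\<^sub>m (order (torsion E n))"
    using y[of n] by (auto simp: quotient_map_def)
  have yc: "y n \<in> carrier_mat (order (Q n)) (order (torsion E n))" using gs_homD(1)[OF quotient_mapD[OF y]] .
  have gc: "g ?N \<in> carrier_mat (order (torsion D ?N)) (order (torsion E ?N))" using gs_homD(1)[OF pdiv_homD(1)[OF g]] .
  have zc: "z n \<in> carrier_mat (order (Q n)) (order (torsion D ?N))" using gs_homD(1)[OF z] .
  have ic: "incl_iter E n (r n) \<in> carrier_mat (order (torsion E n)) (order (torsion E ?N))" using gs_homD(1)[OF assms(3)] .
  have "incl_iter E n (r n) *\<^sub>v x = (l * y n) *\<^sub>v (incl_iter E n (r n) *\<^sub>v x)" unfolding l(2) using ic x by simp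
  also have "\<dots> = l *\<^sub>v ((y n * incl_iter E n (r n)) *\<^sub>v x)"
    using l(1) yc ic x by (simp add: assoc_mult_mat_vec[of _ _ "order (Q n)" _ "order (torsion E n)"]
      assoc_mult_mat_vec[of _ _ "order (torsion E n)" _ "order (torsion E ?N)"])
  also have "(y n * incl_iter E n (r n)) *\<^sub>v x = z n *\<^sub>v (g ?N *\<^sub>v x)"
    unfolding eq[symmetric] by (rule assoc_mult_mat_vec[OF zc gc x])
  also have "l *\<^sub>v (z n *\<^sub>v (g ?N *\<^sub>v x)) = 0\<^sub>v (order (torsion E n))" unfolding 0 using l(1) zc by (simp add: mat_mult_zero_vec)
  finally show "incl_iter E n (r n) *\<^sub>v x = 0\<^sub>v (order (torsion E n))" .
qed

text \<open>Reformulates the vector condition as \<open>E[p^n]\<close> lying in the image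
  \<open>I\<close> of \<open>g\<close> at a higher level. The level is raised once more, to
  \<open>n + Suc r\<close>, so that it is at least \<open>n + 1\<close> even for
  \<open>r = 0\<close>.\<close>

lemma pdiv_surjD:
  assumes "pdivisible p D h" "pdivisible p E h'" and g: "g \<in> pdiv_hom D E" and surj: "pdiv_surj D E g"
  obtains r I q m s where "fcgs I" "quotient_map (torsion D (n + Suc r)) I q"
    "closed_emb I (torsion E (n + Suc r)) m" "g (n + Suc r) = q * m"
    "closed_emb (torsion E n) I s" "s * m = incl_iter E n (Suc r)"
proof -
  interpret D: pdivisible p D h by fact
  interpret E: pdivisible p E h' by fact
  obtain r where r: "\<And>x. x \<in> carrier_vec (order (E.T (n + r))) \<Longrightarrow>
      g (n + r) *\<^sub>v x = 0\<^sub>v (order (D.T (n + r))) \<Longrightarrow> E.ii n r *\<^sub>v x = 0\<^sub>v (order (E.T n))"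
    using surj unfolding pdiv_surj_def by blast
  let ?N = "n + Suc r"
  note gh = pdiv_homD(1)[OF g]
  have gi: "D.i (n + r) * g ?N = g (n + r) * E.i (n + r)" using pdiv_homD(2)[OF g, of "n + r"] by simp
  have ih: "E.i (n + r) \<in> gs_hom (E.T (n + r)) (E.T ?N)" "D.i (n + r) \<in> gs_hom (D.T (n + r)) (D.T ?N)"
    using E.incl_hom[of "n + r"] D.incl_hom[of "n + r"] by simp_all
  note car = gs_homD(1)[OF gh[of "n + r"]] gs_homD(1)[OF gh[of ?N]] gs_homD(1)[OF ih(1)] gs_homD(1)[OF ih(2)]
    gs_homD(1)[OF E.ii_hom[of n r]]
  have r': "E.ii n (Suc r) *\<^sub>v x = 0\<^sub>v (order (E.T n))"
    if x: "x \<in> carrier_vec (order (E.T ?N))" and 0: "g ?N *\<^sub>v x = 0\<^sub>v (order (D.T ?N))" for x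
  proof -
    have "g (n + r) *\<^sub>v (E.i (n + r) *\<^sub>v x) = (g (n + r) * E.i (n + r)) *\<^sub>v x"
      by (rule assoc_mult_mat_vec[OF car(1,3) x, symmetric])
    also have "\<dots> = D.i (n + r) *\<^sub>v (g ?N *\<^sub>v x)" unfolding gi[symmetric] by (rule assoc_mult_mat_vec[OF car(4,2) x])
    also have "\<dots> = 0\<^sub>v (order (D.T (n + r)))" unfolding 0 using car(4) by (simp add: mat_mult_zero_vec)
    finally have "E.ii n r *\<^sub>v (E.i (n + r) *\<^sub>v x) = 0\<^sub>v (order (E.T n))"
      using r[of "E.i (n + r) *\<^sub>v x"] car(3) x by simp
    thus ?thesis unfolding E.ii_Suc by (subst assoc_mult_mat_vec[OF car(5,3) x])
  qed
  obtain I q m where I: "fcgs I" "quotient_map (D.T ?N) I q" "closed_emb I (E.T ?N) m" "g ?N = q * m"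
    using image_factorization[OF D.T_scheme E.T_scheme gh[of ?N]] by (auto simp: gs_comp_def)
  note qh = quotient_mapD[OF I(2)] and mh = closed_embD(1)[OF I(3)]
  obtain \<sigma> where \<sigma>: "\<sigma> \<in> carrier_mat (order (E.T ?N)) (order I)" "m * \<sigma> = 1\<^sub>m (order I)"
    using I(3) by (auto simp: closed_emb_def)
  note iih = E.ii_hom[of n "Suc r"]
  note [simp] = gs_hom_dims[OF qh] gs_hom_dims[OF mh] carrier_matD[OF \<sigma>(1)] gs_hom_dims[OF iih]
  \<comment> \<open>Its columns lie in the kernel of the comorphism of \<open>g\<close>; as the
    inclusion of \<open>E[p^n]\<close> kills them too, it factors through \<open>m\<close>.\<close>
  let ?Z = "1\<^sub>m (order (E.T ?N)) - \<sigma> * m"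
  have Zc: "?Z \<in> carrier_mat (order (E.T ?N)) (order (E.T ?N))" by (rule carrier_matI) simp_all
  have gZ: "g ?N * ?Z = 0\<^sub>m (order (D.T ?N)) (order (E.T ?N))"
    unfolding I(4) by (simp add: mat_assoc mat_minus_distrib mult_pull[OF \<sigma>(2)] mat_minus_zero del: add_Suc_right)
  have "E.ii n (Suc r) * ?Z = 0\<^sub>m (order (E.T n)) (order (E.T ?N))"
  proof (rule eq_matI)
    fix a b assume "a < dim_row (0\<^sub>m (order (E.T n)) (order (E.T ?N)))" "b < dim_col (0\<^sub>m (order (E.T n)) (order (E.T ?N)))"
    hence ab: "a < order (E.T n)" "b < order (E.T ?N)" by auto
    have c: "col ?Z b \<in> carrier_vec (order (E.T ?N))" using Zc ab by auto
    have "g ?N *\<^sub>v col ?Z b = col (g ?N * ?Z) b" using ab Zc car(2) by (simp add: col_mult2[OF car(2) Zc ab(2)])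
    also have "\<dots> = 0\<^sub>v (order (D.T ?N))" unfolding gZ using ab by simp
    finally have "E.ii n (Suc r) *\<^sub>v col ?Z b = 0\<^sub>v (order (E.T n))" using r'[OF c] by blast
    hence "col (E.ii n (Suc r) * ?Z) b = 0\<^sub>v (order (E.T n))" using col_mult2[OF gs_homD(1)[OF iih] Zc ab(2)] by simp
    hence "col (E.ii n (Suc r) * ?Z) b $ a = 0" using ab by simp
    thus "(E.ii n (Suc r) * ?Z) $$ (a, b) = 0\<^sub>m (order (E.T n)) (order (E.T ?N)) $$ (a, b)"
      using ab gs_hom_dims[OF iih] by (simp del: incl_iter.simps index_mult_mat(1))
  qed (simp_all del: incl_iter.simps)
  hence "E.ii n (Suc r) - E.ii n (Suc r) * \<sigma> * m = 0\<^sub>m (order (E.T n)) (order (E.T ?N))"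
    using gs_hom_dims[OF iih] by (simp add: mat_assoc mat_minus_distrib del: incl_iter.simps)
  hence fac: "E.ii n (Suc r) = E.ii n (Suc r) * \<sigma> * m"
    by (rule mat_minus_eq_zero) (rule carrier_matI; simp del: incl_iter.simps)+
  have s: "E.ii n (Suc r) * \<sigma> \<in> gs_hom (E.T n) I"
    by (rule hom_cancel_mono[OF E.T_scheme I(1) E.T_scheme mh \<sigma>])
       (use fac iih in \<open>auto simp del: incl_iter.simps intro!: carrier_matI\<close>)
  have "closed_emb (E.T n) I (E.ii n (Suc r) * \<sigma>)"
    using closed_emb_first[OF s mh] E.ii_emb[of n "Suc r"] fac by simp
  thus thesis using that[OF I(1-4)] fac by simp
qed

text \<open>For \<open>K \<subseteq> D[p]\<close> the data are \<open>C = D[p]/K\<close>, the epimorphism \<open>j n : D[p\<^bsup>n+1\<^esup>] \<rightarrow> D[p]\<close> given by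
  multiplication by \<open>p\<^sup>n\<close>, the subgroup \<open>P n = {x \<in> D[p\<^bsup>n+1\<^esup>]. p\<^sup>n x \<in> K}\<close> with its inclusion \<open>\<iota> n\<close>, and
  the inclusion \<open>k n\<close> of \<open>K\<close> in \<open>P n\<close>.\<close>

locale subgroup_data = pdivisible p D h for p and D :: "'k :: alg_closed_field pdiv" and h +
  fixes K :: "'k hopf" and \<kappa> and C :: "'k hopf" and c and j and P :: "nat \<Rightarrow> 'k hopf" and \<iota> k
  assumes K_scheme [simp]: "fcgs K" and \<kappa>_emb: "closed_emb K (T (Suc 0)) \<kappa>"
    and C_scheme [simp]: "fcgs C" and c_quot: "quotient_map (T (Suc 0)) C c"
    and c_ker: "is_kernel K \<kappa> (T (Suc 0)) C c" and C_order: "order (T (Suc 0)) = order K * order C"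
    and j_quot: "quotient_map (T (Suc n)) (T (Suc 0)) (j n)"
    and j_ii: "j n * ii (Suc 0) n = gs_times (T (Suc n)) (p ^ n)"
    and P_ker: "is_kernel (P n) (\<iota> n) (T (Suc n)) C (j n * c)"
    and k_hom: "k n \<in> gs_hom K (P n)" and k_\<iota>: "k n * \<iota> n = \<kappa> * ii (Suc 0) n"

section \<open>The preimages \<open>P n\<close> of \<open>K\<close> and their inclusions\<close>

context pdivisible
begin

lemma ii1_hom: "ii (Suc 0) n \<in> gs_hom (T (Suc 0)) (T (Suc n))"
  using ii_hom[of "Suc 0" n] by simp

lemma ii1_emb: "closed_emb (T (Suc 0)) (T (Suc n)) (ii (Suc 0) n)"
  using ii_emb[of "Suc 0" n] by simp

lemma ii1_Suc: "ii (Suc 0) (Suc n) = ii (Suc 0) n * i (Suc n)"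
  using ii_Suc[of "Suc 0" n] by simp

lemma subgroup_data_exists:
  assumes K: "fcgs K" and \<kappa>: "closed_emb K (T (Suc 0)) \<kappa>"
  obtains C c j P \<iota> k where "subgroup_data p D h K \<kappa> C c j P \<iota> k"
proof -
  obtain C c where C: "fcgs C" "quotient_map (T (Suc 0)) C c" "is_kernel K \<kappa> (T (Suc 0)) C c"
      "order (T (Suc 0)) = order K * order C"
    using cokernel_exists[OF K T_scheme \<kappa>] by metis
  note ch = quotient_mapD[OF C(2)] and \<kappa>h = closed_embD(1)[OF \<kappa>]
  have "\<exists>j. quotient_map (T (Suc n)) (T (Suc 0)) j \<and> j * ii (Suc 0) n = gs_times (T (Suc n)) (p ^ n)" for n
    using multiplication_quotient[of "Suc 0" n] by auto
  then obtain j where j: "\<And>n. quotient_map (T (Suc n)) (T (Suc 0)) (j n)"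
    "\<And>n. j n * ii (Suc 0) n = gs_times (T (Suc n)) (p ^ n)" by metis
  note jh = quotient_mapD[OF j(1)]
  have jc: "j n * c \<in> gs_hom (T (Suc n)) C" for n by (rule hom_comp[OF T_scheme T_scheme C(1) jh ch])
  have "\<exists>P \<iota>. is_kernel P \<iota> (T (Suc n)) C (j n * c)" for n using kernel_exists[OF T_scheme C(1) jc] by metis
  then obtain P \<iota> where P: "\<And>n. is_kernel (P n) (\<iota> n) (T (Suc n)) C (j n * c)" by metis
  note [simp] = gs_hom_dims[OF jh] gs_hom_dims[OF ch] gs_hom_dims[OF \<kappa>h] gs_hom_dims[OF ii1_hom]
    times_dims[OF T_scheme] times_dims[OF K]
  have "\<exists>k. k \<in> gs_hom K (P n) \<and> k * \<iota> n = \<kappa> * ii (Suc 0) n" for n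
  proof -
    have kii: "\<kappa> * ii (Suc 0) n \<in> gs_hom K (T (Suc n))" by (rule hom_comp[OF K T_scheme T_scheme \<kappa>h ii1_hom])
    \<comment> \<open>On \<open>K\<close> the map \<open>j n\<close> is multiplication by
      \<open>p ^ n\<close>, which preserves \<open>K\<close>; so it becomes zero in \<open>C\<close>
      and \<open>K\<close> lies in \<open>P n\<close>, uniformly in \<open>n\<close>.\<close>
    have "\<kappa> * ii (Suc 0) n * j n = gs_times K (p ^ n) * \<kappa>"
    proof (rule closed_emb_cancel[OF ii1_emb[of n]])
      show "\<kappa> * ii (Suc 0) n * j n \<in> gs_hom K (T (Suc 0))" by (rule hom_comp[OF K T_scheme T_scheme kii jh])
      show "gs_times K (p ^ n) * \<kappa> \<in> gs_hom K (T (Suc 0))" by (rule hom_comp[OF K K T_scheme times_hom[OF K] \<kappa>h])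
      show "\<kappa> * ii (Suc 0) n * j n * ii (Suc 0) n = gs_times K (p ^ n) * \<kappa> * ii (Suc 0) n"
        using times_natural[OF K T_scheme kii, of "p ^ n"] by (simp add: mat_assoc j(2))
    qed
    hence "\<kappa> * ii (Suc 0) n * (j n * c) = gs_times K (p ^ n) * (\<kappa> * c)" by (simp add: mat_assoc[symmetric])
    also have "\<dots> = gs_zero K C"
      using is_kernelD(3)[OF C(3)] zero_right[OF K C(1) times_hom[OF K]] by simp
    finally show ?thesis using is_kernelD(4)[OF P K kii] by blast
  qed
  then obtain k where k: "\<And>n. k n \<in> gs_hom K (P n)" "\<And>n. k n * \<iota> n = \<kappa> * ii (Suc 0) n" by metis
  have "subgroup_data p D h K \<kappa> C c j P \<iota> k"
    by unfold_locales (use K \<kappa> C j P k in auto)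
  thus thesis by (rule that)
qed

end

context subgroup_data
begin

declare T_scheme [simp]

lemma P_scheme [simp]: "fcgs (P n)"
  using is_kernelD(1)[OF P_ker] .

lemma j_hom: "j n \<in> gs_hom (T (Suc n)) (T (Suc 0))" using quotient_mapD[OF j_quot] .
lemma c_hom: "c \<in> gs_hom (T (Suc 0)) C" using quotient_mapD[OF c_quot] .
lemma \<kappa>_hom: "\<kappa> \<in> gs_hom K (T (Suc 0))" using closed_embD(1)[OF \<kappa>_emb] .
lemma \<iota>_hom: "\<iota> n \<in> gs_hom (P n) (T (Suc n))" using is_kernelD(2)[OF P_ker] .

lemma jc_quot: "quotient_map (T (Suc n)) C (j n * c)"
  by (rule quotient_map_comp[OF _ _ _ j_quot c_quot]) simp_all

lemma \<iota>_emb: "closed_emb (P n) (T (Suc n)) (\<iota> n)"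
  by (rule kernel_closed_emb[OF P_ker _ _ quotient_mapD[OF jc_quot]]) simp_all

lemmas hom_dims [simp] = gs_hom_dims[OF j_hom] gs_hom_dims[OF c_hom] gs_hom_dims[OF \<kappa>_hom] gs_hom_dims[OF \<iota>_hom]
  gs_hom_dims[OF k_hom] gs_hom_dims[OF ii1_hom] gs_hom_dims[OF incl_hom] times_dims zero_dims

lemma \<kappa>ii_emb: "closed_emb K (T (Suc n)) (\<kappa> * ii (Suc 0) n)"
  by (rule closed_emb_comp[OF _ _ _ \<kappa>_emb ii1_emb]) simp_all

lemma \<kappa>ii_killed: "\<kappa> * ii (Suc 0) n * gs_times (T (Suc n)) (p ^ 1) = gs_zero K (T (Suc n))"
proof -
  have "\<kappa> * ii (Suc 0) n * gs_times (T (Suc n)) (p ^ 1) = \<kappa> * (gs_times (T (Suc 0)) (p ^ 1) * ii (Suc 0) n)"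
    using times_natural[OF _ _ ii1_hom, of n "p ^ 1"] by (simp add: mat_assoc del: power_one_right)
  also have "\<dots> = \<kappa> * gs_zero (T (Suc 0)) (T (Suc n))"
    using T_killed[of "Suc 0" 1] zero_left[OF _ _ ii1_hom, of "T (Suc 0)" n] by simp
  finally show ?thesis using zero_right[OF _ _ \<kappa>_hom, of "T (Suc n)"] by simp
qed

lemma k_emb: "closed_emb K (P n) (k n)"
  using closed_emb_first[OF k_hom \<iota>_hom] \<kappa>ii_emb by (simp add: k_\<iota>)

lemma K_pos: "order K > 0" by (rule order_positive) simp

text \<open>\<open>P n\<close> is the kernel of a quotient map from \<open>T (Suc n)\<close> to
  \<open>C\<close>, and \<open>C\<close> has order \<open>order (T 1) / order K\<close>.\<close>

lemma P_order: "order (P n) = order K * order (T n)"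
proof -
  have "order (P n) * order C = order (T (Suc n))"
    using order_kernel_quotient[OF _ _ jc_quot P_ker] by simp
  also have "\<dots> = order (T n) * order (T (Suc 0))" by (simp add: T_order power_add[symmetric] mult.commute)
  finally have "order (P n) * order C = order K * order (T n) * order C" unfolding C_order by (simp add: mult_ac)
  moreover have "order C > 0" by (rule order_positive) simp
  ultimately show ?thesis by simp
qed

text \<open>A membership test for \<open>P n\<close> without \<open>j\<close> or \<open>C\<close>:
  \<open>p ^ n\<close> times the point must lie in \<open>K\<close>, with \<open>K\<close> viewed
  inside \<open>T (Suc n)\<close>. The converse is \<open>\<iota>_power\<close>.\<close>

lemma factor_P:
  assumes S: "fcgs S" and t: "t \<in> gs_hom S (T (Suc n))" and v: "v \<in> gs_hom S K"
    and eq: "t * gs_times (T (Suc n)) (p ^ n) = v * (\<kappa> * ii (Suc 0) n)"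
  obtains s where "s \<in> gs_hom S (P n)" "s * \<iota> n = t"
proof -
  note [simp] = gs_hom_dims[OF t] gs_hom_dims[OF v]
  have "t * j n = v * \<kappa>"
  proof (rule closed_emb_cancel[OF ii1_emb[of n]])
    show "t * j n \<in> gs_hom S (T (Suc 0))" by (rule hom_comp[OF S _ _ t j_hom]) simp_all
    show "v * \<kappa> \<in> gs_hom S (T (Suc 0))" by (rule hom_comp[OF S _ _ v \<kappa>_hom]) simp_all
    show "t * j n * ii (Suc 0) n = v * \<kappa> * ii (Suc 0) n" using eq by (simp add: mat_assoc j_ii)
  qed
  hence "t * (j n * c) = v * (\<kappa> * c)" by (simp add: mat_assoc[symmetric])
  also have "\<dots> = gs_zero S C" using is_kernelD(3)[OF c_ker] zero_right[OF _ _ v, of C] by simp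
  finally show thesis using is_kernelD(4)[OF P_ker S t] that by blast
qed

lemma \<iota>_power:
  obtains v where "v \<in> gs_hom (P n) K" "\<iota> n * gs_times (T (Suc n)) (p ^ n) = v * (\<kappa> * ii (Suc 0) n)"
proof -
  have "\<iota> n * j n * c = gs_zero (P n) C" using is_kernelD(3)[OF P_ker] by (simp add: mat_assoc)
  then obtain v where v: "v \<in> gs_hom (P n) K" "v * \<kappa> = \<iota> n * j n"
    using is_kernelD(4)[OF c_ker _ hom_comp[OF _ _ _ \<iota>_hom j_hom]] P_scheme T_scheme by metis
  have "v * (\<kappa> * ii (Suc 0) n) = \<iota> n * (j n * ii (Suc 0) n)"
    using gs_hom_dims[OF v(1)] by (simp add: mult_pull[OF v(2)] mat_assoc)
  thus thesis using that[OF v(1)] by (simp add: j_ii)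
qed

text \<open>The inclusion of \<open>D[p^n]\<close> in \<open>P n\<close>, which exists because
  \<open>p ^ n\<close> takes it to \<open>0\<close>. The choice is unambiguous,
  \<open>\<iota> n\<close> being a closed embedding.\<close>

definition a :: "nat \<Rightarrow> 'k mat" where
  "a n = (SOME s. s \<in> gs_hom (T n) (P n) \<and> s * \<iota> n = i n)"

lemma a_hom: "a n \<in> gs_hom (T n) (P n)" and a_\<iota>: "a n * \<iota> n = i n"
proof -
  have "i n * gs_times (T (Suc n)) (p ^ n) = gs_zero (T n) K * (\<kappa> * ii (Suc 0) n)"
    using is_kernelD(3)[OF incl_kernel[of n]] zero_left[of "T n" K "\<kappa> * ii (Suc 0) n" "T (Suc n)"]
      closed_embD(1)[OF \<kappa>ii_emb] by simp
  hence "\<exists>s. s \<in> gs_hom (T n) (P n) \<and> s * \<iota> n = i n"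
    using factor_P[OF T_scheme incl_hom gs_zero_hom[OF T_scheme K_scheme]] by metis
  hence "a n \<in> gs_hom (T n) (P n) \<and> a n * \<iota> n = i n" unfolding a_def by (rule someI_ex)
  thus "a n \<in> gs_hom (T n) (P n)" "a n * \<iota> n = i n" by auto
qed

lemmas a_dims [simp] = gs_hom_dims[OF a_hom]

lemma a_emb: "closed_emb (T n) (P n) (a n)"
  using closed_emb_first[OF a_hom \<iota>_hom] incl_emb by (simp add: a_\<iota>)

lemma \<kappa>a: "\<kappa> * (ii (Suc 0) n * a (Suc n)) = k (Suc n)"
proof (rule closed_emb_cancel[OF \<iota>_emb])
  show "\<kappa> * (ii (Suc 0) n * a (Suc n)) \<in> gs_hom K (P (Suc n))"
    by (rule hom_comp[OF _ _ _ \<kappa>_hom hom_comp[OF _ _ _ ii1_hom a_hom]]) simp_all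
  show "\<kappa> * (ii (Suc 0) n * a (Suc n)) * \<iota> (Suc n) = k (Suc n) * \<iota> (Suc n)"
    unfolding k_\<iota> ii1_Suc by (simp add: mat_assoc a_\<iota>)
qed (rule k_hom)

text \<open>The inclusion of \<open>P n\<close> in \<open>P (n + 1)\<close>, passing through
  \<open>D[p^(n+1)]\<close>.\<close>

definition s :: "nat \<Rightarrow> 'k mat" where "s n = \<iota> n * a (Suc n)"

lemma s_hom: "s n \<in> gs_hom (P n) (P (Suc n))"
  unfolding s_def by (rule hom_comp[OF _ _ _ \<iota>_hom a_hom]) simp_all

lemmas s_dims [simp] = gs_hom_dims[OF s_hom]

lemma s_\<iota>: "s n * \<iota> (Suc n) = \<iota> n * i (Suc n)"
  by (simp add: s_def mat_assoc a_\<iota>)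

lemma s_emb: "closed_emb (P n) (P (Suc n)) (s n)"
  unfolding s_def by (rule closed_emb_comp[OF _ _ _ \<iota>_emb a_emb]) simp_all

lemma k_s: "k n * s n = k (Suc n)"
  unfolding s_def by (simp add: mult_pull[OF k_\<iota>] mat_assoc \<kappa>a)

end

text \<open>The quotients \<open>E n\<close> of \<open>P n\<close> by \<open>K\<close> are
  parameters rather than a fixed construction, so the locale serves both a newly built
  \<open>D/K\<close> and the torsion of the target of a given isogeny.\<close>

locale quotient_data = subgroup_data p D h K \<kappa> C c j P \<iota> k
  for p and D :: "'k :: alg_closed_field pdiv" and h and K :: "'k hopf" and \<kappa> C c j P \<iota> k +
  fixes E :: "nat \<Rightarrow> 'k hopf" and e
  assumes E_scheme [simp]: "fcgs (E n)" and e_quot: "quotient_map (P n) (E n) (e n)"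
    and e_ker: "is_kernel K (k n) (P n) (E n) (e n)"

lemma (in subgroup_data) quotient_data_exists:
  obtains E e where "quotient_data p D h K \<kappa> C c j P \<iota> k E e"
proof -
  have "\<exists>E e. fcgs E \<and> quotient_map (P n) E e \<and> is_kernel K (k n) (P n) E e" for n
    using cokernel_exists[OF K_scheme P_scheme k_emb] by metis
  then obtain E e where "\<And>n. fcgs (E n) \<and> quotient_map (P n) (E n) (e n) \<and> is_kernel K (k n) (P n) (E n) (e n)"
    by metis
  thus thesis by (intro that[of E e]) (unfold_locales, auto)
qed

section \<open>The quotients \<open>E n\<close> form a p-divisible group\<close>

context quotient_data
begin

lemma e_hom: "e n \<in> gs_hom (P n) (E n)" using quotient_mapD[OF e_quot] .

lemmas e_dims [simp] = gs_hom_dims[OF e_hom]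

lemma E_order: "order (E n) = order (T n)"
  using order_kernel_quotient[OF _ _ e_quot e_ker] P_order[of n] K_pos by simp

lemma k_e: "k n * e n = gs_zero K (E n)"
  using is_kernelD(3)[OF e_ker] .

lemma k_e_Suc: "k n * (s n * e (Suc n)) = gs_zero K (E (Suc n))"
  by (simp add: mult_pull[OF k_s] k_e)

lemma inc_exists: "\<exists>f \<in> gs_hom (E n) (E (Suc n)). e n * f = s n * e (Suc n)"
  using quotient_factor[OF _ _ e_quot e_ker _ hom_comp[OF _ _ _ s_hom e_hom] k_e_Suc] P_scheme E_scheme by metis

definition f :: "nat \<Rightarrow> 'k mat" where
  "f n = (SOME f. f \<in> gs_hom (E n) (E (Suc n)) \<and> e n * f = s n * e (Suc n))"

lemma f_hom: "f n \<in> gs_hom (E n) (E (Suc n))" and e_f: "e n * f n = s n * e (Suc n)"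
  using someI_ex[OF inc_exists[unfolded Bex_def]] by (simp_all add: f_def)

lemmas f_dims [simp] = gs_hom_dims[OF f_hom]

text \<open>The kernel of \<open>P n -> P (n + 1) -> E (n + 1)\<close> is again \<open>K\<close>,
  since a point of \<open>P n\<close> lying in \<open>K\<close> one level up already lies in
  \<open>K\<close>.\<close>

lemma f_emb: "closed_emb (E n) (E (Suc n)) (f n)"
proof (rule closed_emb_of_kernel[OF _ _ _ e_quot e_ker f_hom])
  show "is_kernel K (k n) (P n) (E (Suc n)) (e n * f n)"
  proof (rule is_kernelI[OF _ k_emb])
    show "k n * (e n * f n) = gs_zero K (E (Suc n))" by (simp add: e_f k_e_Suc)
    fix S :: "'k hopf" and t assume S: "fcgs S" and t: "t \<in> gs_hom S (P n)" and 0: "t * (e n * f n) = gs_zero S (E (Suc n))"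
    note [simp] = gs_hom_dims[OF t]
    have ts: "t * s n \<in> gs_hom S (P (Suc n))" by (rule hom_comp[OF S _ _ t s_hom]) simp_all
    have "t * s n * e (Suc n) = gs_zero S (E (Suc n))" using 0 by (simp add: e_f mat_assoc)
    then obtain v where v: "v \<in> gs_hom S K" "v * k (Suc n) = t * s n" using is_kernelD(4)[OF e_ker S ts] by blast
    have "v * k n = t"
    proof (rule closed_emb_cancel[OF s_emb _ t])
      show "v * k n \<in> gs_hom S (P n)" by (rule hom_comp[OF S _ _ v(1) k_hom]) simp_all
      show "v * k n * s n = t * s n" using gs_hom_dims[OF v(1)] by (simp add: mat_assoc k_s v(2))
    qed
    thus "\<exists>v \<in> gs_hom S K. v * k n = t" using v(1) by blast
  qed simp
qed simp_all

text \<open>Multiplication by \<open>p ^ n\<close> maps \<open>P n\<close> into \<open>K\<close>,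
  which vanishes in the quotient.\<close>

lemma E_killed: "gs_times (E n) (p ^ n) = gs_zero (E n) (E n)"
proof (rule killed_of_quotient[OF _ _ e_quot])
  obtain v where v: "v \<in> gs_hom (P n) K" "\<iota> n * gs_times (T (Suc n)) (p ^ n) = v * (\<kappa> * ii (Suc 0) n)"
    by (rule \<iota>_power)
  note [simp] = gs_hom_dims[OF v(1)]
  have "gs_times (P n) (p ^ n) = v * k n"
  proof (rule closed_emb_cancel[OF \<iota>_emb times_hom])
    show "v * k n \<in> gs_hom (P n) (P n)" by (rule hom_comp[OF _ _ _ v(1) k_hom]) simp_all
    show "gs_times (P n) (p ^ n) * \<iota> n = v * k n * \<iota> n"
      using times_natural[OF _ _ \<iota>_hom, of n "p ^ n"] v(2) by (simp add: mat_assoc k_\<iota>)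
  qed simp
  hence "e n * gs_times (E n) (p ^ n) = v * (k n * e n)"
    using times_natural[OF _ _ e_hom, of n "p ^ n"] by (simp add: mat_assoc)
  thus "e n * gs_times (E n) (p ^ n) = gs_zero (P n) (E n)"
    using zero_right[OF _ _ v(1), of "E n"] by (simp add: k_e)
qed simp_all

text \<open>Test maps into \<open>E (n + 1)\<close> need not lift to \<open>P (n + 1)\<close>, so
  the kernel is computed on \<open>P (n + 1)\<close>, where it is \<open>P n\<close>. Orders then
  show that the kernel of \<open>p ^ n\<close> on \<open>E (n + 1)\<close> is as large as
  \<open>E n\<close>.\<close>

lemma f_kernel: "is_kernel (E n) (f n) (E (Suc n)) (E (Suc n)) (gs_times (E (Suc n)) (p ^ n))"
proof -
  let ?E = "E (Suc n)" and ?P = "P (Suc n)" and ?e = "e (Suc n)" and ?\<iota> = "\<iota> (Suc n)"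
  let ?w = "gs_times ?E (p ^ n)"
  have w: "?w \<in> gs_hom ?E ?E" by (rule times_hom) simp
  have fw: "f n * ?w = gs_zero (E n) ?E"
    using times_natural[OF _ _ f_hom, of n "p ^ n"] zero_left[OF _ _ f_hom, of "E n" n] by (simp add: E_killed)
  have se: "s n * (?e * ?w) = gs_zero (P n) ?E"
  proof -
    have "s n * (?e * ?w) = e n * (f n * ?w)" by (simp add: mult_pull[OF e_f] mat_assoc)
    thus ?thesis unfolding fw using zero_right[OF _ _ e_hom, of n ?E] by simp
  qed
  have ker: "is_kernel (P n) (s n) ?P ?E (?e * ?w)"
  proof (rule is_kernelI[OF _ s_emb se])
    fix S :: "'k hopf" and t assume S: "fcgs S" and t: "t \<in> gs_hom S ?P" and 0: "t * (?e * ?w) = gs_zero S ?E"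
    note [simp] = gs_hom_dims[OF t]
    let ?wP = "gs_times ?P (p ^ n)"
    have tw: "t * ?wP \<in> gs_hom S ?P" by (rule hom_comp[OF S _ _ t times_hom]) simp_all
    have "t * ?wP * ?e = gs_zero S ?E" using 0 times_natural[OF _ _ e_hom, of "Suc n" "p ^ n"] by (simp add: mat_assoc)
    then obtain v where v: "v \<in> gs_hom S K" "v * k (Suc n) = t * ?wP" using is_kernelD(4)[OF e_ker S tw] by blast
    note [simp] = gs_hom_dims[OF v(1)]
    let ?T = "T (Suc (Suc n))"
    define y0 where "y0 = t * ?\<iota>"
    have y0: "y0 \<in> gs_hom S ?T" unfolding y0_def by (rule hom_comp[OF S _ _ t \<iota>_hom]) simp_all
    note [simp] = gs_hom_dims[OF y0]
    have y0w: "y0 * gs_times ?T (p ^ n) = v * (\<kappa> * ii (Suc 0) (Suc n))"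
    proof -
      have "y0 * gs_times ?T (p ^ n) = (t * ?wP) * ?\<iota>"
        using times_natural[OF _ _ \<iota>_hom, of "Suc n" "p ^ n"] by (simp add: y0_def mat_assoc)
      also have "\<dots> = v * (\<kappa> * ii (Suc 0) (Suc n))" unfolding v(2)[symmetric] by (simp add: mat_assoc k_\<iota> del: incl_iter.simps)
      finally show ?thesis .
    qed
    \<comment> \<open>The point \<open>p^n y0\<close> lies in \<open>K\<close>, hence in
      \<open>D[p]\<close>; one more factor \<open>p\<close> kills it, so \<open>y0\<close> lies in
      \<open>D[p^(n+1)]\<close>, where \<open>p^n y\<close> in \<open>K\<close> means membership in
      \<open>P n\<close>.\<close>
    have "y0 * gs_times ?T (p ^ Suc n) = (y0 * gs_times ?T (p ^ n)) * gs_times ?T (p ^ 1)"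
      using times_power_add[of ?T p n 1] by (simp add: mat_assoc del: power_Suc)
    also have "\<dots> = v * (\<kappa> * ii (Suc 0) (Suc n) * gs_times ?T (p ^ 1))"
      unfolding y0w by (simp add: mat_assoc del: incl_iter.simps)
    also have "\<dots> = gs_zero S ?T" unfolding \<kappa>ii_killed using zero_right[OF _ _ v(1), of ?T] by simp
    finally obtain y where y: "y \<in> gs_hom S (T (Suc n))" "y * i (Suc n) = y0"
      using is_kernelD(4)[OF incl_kernel S y0] by blast
    note [simp] = gs_hom_dims[OF y(1)]
    have "y * gs_times (T (Suc n)) (p ^ n) = v * (\<kappa> * ii (Suc 0) n)"
    proof (rule closed_emb_cancel[OF incl_emb[of "Suc n"]])
      show "y * gs_times (T (Suc n)) (p ^ n) \<in> gs_hom S (T (Suc n))"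
        by (rule hom_comp[OF S _ _ y(1) times_hom]) simp_all
      show "v * (\<kappa> * ii (Suc 0) n) \<in> gs_hom S (T (Suc n))"
        by (rule hom_comp[OF S _ _ v(1) closed_embD(1)[OF \<kappa>ii_emb]]) simp_all
      have "y * gs_times (T (Suc n)) (p ^ n) * i (Suc n) = (y * i (Suc n)) * gs_times ?T (p ^ n)"
        using times_natural[OF _ _ incl_hom, of "Suc n" "p ^ n"] by (simp add: mat_assoc)
      also have "\<dots> = v * (\<kappa> * ii (Suc 0) n) * i (Suc n)" unfolding y(2) y0w ii1_Suc by (simp add: mat_assoc)
      finally show "y * gs_times (T (Suc n)) (p ^ n) * i (Suc n) = v * (\<kappa> * ii (Suc 0) n) * i (Suc n)" .
    qed
    then obtain z where z: "z \<in> gs_hom S (P n)" "z * \<iota> n = y" by (rule factor_P[OF S y(1) v(1)])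
    have "z * s n = t"
    proof (rule closed_emb_cancel[OF \<iota>_emb _ t])
      show "z * s n \<in> gs_hom S ?P" by (rule hom_comp[OF S _ _ z(1) s_hom]) simp_all
      show "z * s n * ?\<iota> = t * ?\<iota>"
        using gs_hom_dims[OF z(1)] y(2) by (simp add: mat_assoc s_\<iota> mult_pull[OF z(2)] y0_def)
    qed
    thus "\<exists>z \<in> gs_hom S (P n). z * s n = t" using z(1) by blast
  qed simp
  obtain N \<nu> where N: "is_kernel N \<nu> ?E ?E ?w" using kernel_exists[OF _ _ w] by (metis E_scheme)
  obtain I q m where I: "fcgs I" "quotient_map ?E I q" "closed_emb I ?E m" "?w = q * m"
    using image_factorization[OF _ _ w] by (auto simp: gs_comp_def)
  have "order ?E = order N * order I"
    using order_kernel_image[OF _ I(1) _ I(2,3)] N I(4) by simp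
  moreover have "order ?P = order (P n) * order I"
  proof (rule order_kernel_image[OF _ I(1) _ _ I(3)])
    show "quotient_map ?P I (?e * q)" by (rule quotient_map_comp[OF _ _ I(1) e_quot I(2)]) simp_all
    show "is_kernel (P n) (s n) ?P ?E (?e * q * m)"
      using ker hom_assoc[OF e_hom quotient_mapD[OF I(2)] closed_embD(1)[OF I(3)]] I(4) by simp
  qed simp_all
  moreover have "order I > 0" by (rule order_positive[OF I(1)])
  ultimately have ord: "order (E n) = order N"
    using K_pos by (simp add: P_order E_order)
  obtain u where u: "u \<in> gs_hom (E n) N" "u * \<nu> = f n" using is_kernelD(4)[OF N _ f_hom fw] by auto
  show ?thesis using kernel_of_iso[OF N _ _ _ w u(1) _ ord] f_emb u(2) by simp
qed

definition quotient_pdiv :: "'k pdiv" where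
  "quotient_pdiv = \<lparr>torsion = E, incl = f\<rparr>"

lemma quotient_pdiv_simps [simp]: "torsion quotient_pdiv = E" "incl quotient_pdiv = f"
  by (simp_all add: quotient_pdiv_def)

sublocale Q: pdivisible p quotient_pdiv h
  by unfold_locales (simp_all add: E_order T_order f_kernel)

text \<open>Surjectivity needs one extra level, because \<open>E n\<close> is covered by
  \<open>P n\<close>, a subgroup of \<open>D[p^(n+1)]\<close>.\<close>

lemma quotient_isogeny: "isogeny D quotient_pdiv (\<lambda>n. a n * e n)"
  unfolding isogeny_def
proof (intro conjI)
  let ?g = "\<lambda>n. a n * e n"
  show hom: "?g \<in> pdiv_hom D quotient_pdiv"
    unfolding pdiv_hom_def gs_comp_def
  proof (intro CollectI allI conjI)
    fix n
    show "a n * e n \<in> gs_hom (T n) (torsion quotient_pdiv n)"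
      using hom_comp[OF _ _ _ a_hom e_hom, of n] by simp
    show "i n * (a (Suc n) * e (Suc n)) = a n * e n * incl quotient_pdiv n"
      by (simp add: mat_assoc e_f s_def mult_pull[OF a_\<iota>])
  qed
  show "pdiv_surj D quotient_pdiv ?g"
  proof (rule pdiv_surjI[OF hom, of "\<lambda>_. 1" P e \<iota>])
    show "\<iota> n * (a (n + 1) * e (n + 1)) = e n * incl_iter quotient_pdiv n 1" for n
      unfolding Q.ii_1 by (simp add: e_f s_def mat_assoc)
    show "incl_iter quotient_pdiv n 1 \<in> gs_hom (torsion quotient_pdiv n) (torsion quotient_pdiv (n + 1))" for n
      by (rule Q.ii_hom)
  qed (use e_quot \<iota>_hom in auto)
  have "finite_kernel D quotient_pdiv ?g K (Suc 0) \<kappa>"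
    unfolding finite_kernel_def gs_comp_def
  proof (intro conjI allI)
    fix r
    have "is_kernel K (\<kappa> * ii (Suc 0) r) (T (Suc r)) (E (Suc r)) (a (Suc r) * e (Suc r))"
    proof (rule is_kernelI[OF _ \<kappa>ii_emb])
      show "\<kappa> * ii (Suc 0) r * (a (Suc r) * e (Suc r)) = gs_zero K (E (Suc r))"
        using k_e[of "Suc r"] \<kappa>a[of r, symmetric] by (simp add: mat_assoc)
      fix S :: "'k hopf" and t assume S: "fcgs S" and t: "t \<in> gs_hom S (T (Suc r))"
        and 0: "t * (a (Suc r) * e (Suc r)) = gs_zero S (E (Suc r))"
      note [simp] = gs_hom_dims[OF t]
      have ta: "t * a (Suc r) \<in> gs_hom S (P (Suc r))" by (rule hom_comp[OF S _ _ t a_hom]) simp_all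
      have "t * a (Suc r) * e (Suc r) = gs_zero S (E (Suc r))" using 0 by (simp add: mat_assoc)
      then obtain v where v: "v \<in> gs_hom S K" "v * k (Suc r) = t * a (Suc r)"
        using is_kernelD(4)[OF e_ker S ta] by blast
      have "v * (\<kappa> * ii (Suc 0) r) = t"
      proof (rule closed_emb_cancel[OF a_emb _ t])
        show "v * (\<kappa> * ii (Suc 0) r) \<in> gs_hom S (T (Suc r))"
          by (rule hom_comp[OF S _ _ v(1) closed_embD(1)[OF \<kappa>ii_emb]]) simp_all
        show "v * (\<kappa> * ii (Suc 0) r) * a (Suc r) = t * a (Suc r)"
          using gs_hom_dims[OF v(1)] v(2) by (simp add: mat_assoc \<kappa>a)
      qed
      thus "\<exists>v \<in> gs_hom S K. v * (\<kappa> * ii (Suc 0) r) = t" using v(1) by blast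
    qed simp
    thus "is_kernel K (\<kappa> * ii (Suc 0) r) (T (Suc 0 + r)) (torsion quotient_pdiv (Suc 0 + r)) (a (Suc 0 + r) * e (Suc 0 + r))"
      by simp
  qed (rule \<kappa>_hom)
  thus "\<exists>K n \<kappa>. finite_kernel D quotient_pdiv ?g K n \<kappa>" by blast
qed

end

section \<open>Dual isogenies\<close>

text \<open>\<open>finite_kernel\<close> allows \<open>K\<close> to sit at any level, whereas the
  quotient construction wants it in \<open>D[p]\<close>. Being killed by \<open>p\<close>, it
  factors through \<open>D[p]\<close>; the kernel property at low levels is inherited by pushing
  test maps up to levels where it is given.\<close>

lemma finite_kernel_level_1:
  assumes "pdivisible p D h" "pdivisible p E h'" and g: "g \<in> pdiv_hom D E"
    and fk: "finite_kernel D E g K n \<kappa>" and K0: "gs_times K p = gs_zero K K"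
  obtains \<kappa>' where "finite_kernel D E g K (Suc 0) \<kappa>'"
proof (cases n)
  case 0
  interpret D: pdivisible p D h by fact
  have \<kappa>: "\<kappa> \<in> gs_hom K (D.T 0)" using fk 0 by (simp add: finite_kernel_def)
  have K: "fcgs K" using fk is_kernelD(1) unfolding finite_kernel_def by blast
  have "\<kappa> * D.i 0 \<in> gs_hom K (D.T (Suc 0))" by (rule hom_comp[OF K D.T_scheme D.T_scheme \<kappa> D.incl_hom])
  moreover have "is_kernel K (\<kappa> * D.i 0 * D.ii (Suc 0) r) (D.T (Suc 0 + r)) (torsion E (Suc 0 + r)) (g (Suc 0 + r))" for r
  proof -
    have "\<kappa> * D.ii 0 (Suc r) = \<kappa> * D.i 0 * D.ii (Suc 0) r"
      unfolding D.ii_Suc_left using hom_assoc[OF \<kappa> D.incl_hom D.ii1_hom] by simp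
    moreover have "is_kernel K (\<kappa> * D.ii 0 (Suc r)) (D.T (0 + Suc r)) (torsion E (0 + Suc r)) (g (0 + Suc r))"
      using fk unfolding 0 finite_kernel_def gs_comp_def by blast
    ultimately show ?thesis by simp
  qed
  ultimately show thesis by (intro that[of "\<kappa> * D.i 0"]) (simp add: finite_kernel_def gs_comp_def)
next
  case (Suc m)
  interpret D: pdivisible p D h by fact
  interpret E: pdivisible p E h' by fact
  note gh = pdiv_homD(1)[OF g]
  have \<kappa>: "\<kappa> \<in> gs_hom K (D.T (Suc m))" using fk Suc by (simp add: finite_kernel_def)
  have ker: "is_kernel K (\<kappa> * D.ii (Suc m) r) (D.T (Suc m + r)) (E.T (Suc m + r)) (g (Suc m + r))" for r
    using fk unfolding Suc finite_kernel_def gs_comp_def by blast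
  have K: "fcgs K" using is_kernelD(1)[OF ker] .
  have "\<kappa> * gs_times (D.T (Suc m)) (p ^ Suc 0) = gs_zero K (D.T (Suc m))"
    using times_natural[OF K D.T_scheme \<kappa>, of p] K0 zero_left[OF K K \<kappa>] by simp
  then obtain \<kappa>' where \<kappa>': "\<kappa>' \<in> gs_hom K (D.T (Suc 0))" "\<kappa>' * D.ii (Suc 0) m = \<kappa>"
    using is_kernelD(4)[OF D.ii_kernel[of "Suc 0" m] K] \<kappa> by auto
  note [simp] = gs_hom_dims[OF \<kappa>'(1)] gs_hom_dims[OF D.ii1_hom] gs_hom_dims[OF E.ii1_hom] gs_hom_dims[OF gh]
  have iiD: "D.ii (Suc r) m \<in> gs_hom (D.T (Suc r)) (D.T (Suc m + r))" for r
    using D.ii_hom[of "Suc r" m] by (simp add: add.commute)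
  have iiE: "closed_emb (E.T (Suc r)) (E.T (Suc m + r)) (E.ii (Suc r) m)" for r
    using E.ii_emb[of "Suc r" m] by (simp add: add.commute)
  note [simp] = gs_hom_dims[OF iiD] gs_hom_dims[OF closed_embD(1)[OF iiE]]
  have nat: "D.ii (Suc r) m * g (Suc m + r) = g (Suc r) * E.ii (Suc r) m" for r
    using pdiv_hom_iter[OF assms(1-3), of "Suc r" m] by (simp add: add.commute)
  have big: "\<kappa>' * D.ii (Suc 0) r * D.ii (Suc r) m = \<kappa> * D.ii (Suc m) r" for r
  proof -
    have "D.ii (Suc 0) r * D.ii (Suc r) m = D.ii (Suc 0) m * D.ii (Suc m) r"
      using D.ii_add[of "Suc 0" r m] D.ii_add[of "Suc 0" m r] by (simp add: add.commute)
    thus ?thesis using hom_assoc[OF \<kappa>'(1) D.ii1_hom D.ii_hom[of "Suc m" r]]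
      by (simp add: mat_assoc \<kappa>'(2)[symmetric] gs_hom_dims[OF D.ii_hom[of "Suc m" r]])
  qed
  have \<kappa>ii: "\<kappa>' * D.ii (Suc 0) r \<in> gs_hom K (D.T (Suc r))" for r
    by (rule hom_comp[OF K D.T_scheme D.T_scheme \<kappa>'(1) D.ii1_hom])
  have iiD_emb: "closed_emb (D.T (Suc r)) (D.T (Suc m + r)) (D.ii (Suc r) m)" for r
    using D.ii_emb[of "Suc r" m] by (simp add: add.commute)
  have "is_kernel K (\<kappa>' * D.ii (Suc 0) r) (D.T (Suc r)) (E.T (Suc r)) (g (Suc r))" for r
  proof (rule is_kernelI[OF K])
    have "closed_emb K (D.T (Suc m + r)) (\<kappa>' * D.ii (Suc 0) r * D.ii (Suc r) m)"
      unfolding big by (rule kernel_closed_emb[OF ker D.T_scheme E.T_scheme gh])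
    thus "closed_emb K (D.T (Suc r)) (\<kappa>' * D.ii (Suc 0) r)" by (rule closed_emb_first[OF \<kappa>ii iiD])
    show "\<kappa>' * D.ii (Suc 0) r * g (Suc r) = gs_zero K (E.T (Suc r))"
    proof (rule closed_emb_cancel[OF iiE])
      show "\<kappa>' * D.ii (Suc 0) r * g (Suc r) \<in> gs_hom K (E.T (Suc r))" by (rule hom_comp[OF K D.T_scheme E.T_scheme \<kappa>ii gh])
      show "gs_zero K (E.T (Suc r)) \<in> gs_hom K (E.T (Suc r))" by (rule gs_zero_hom[OF K E.T_scheme])
      have "\<kappa>' * D.ii (Suc 0) r * g (Suc r) * E.ii (Suc r) m = (\<kappa>' * D.ii (Suc 0) r * D.ii (Suc r) m) * g (Suc m + r)"
        using nat[of r] by (simp add: mat_assoc)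
      also have "\<dots> = gs_zero K (E.T (Suc m + r))" unfolding big by (rule is_kernelD(3)[OF ker])
      finally show "\<kappa>' * D.ii (Suc 0) r * g (Suc r) * E.ii (Suc r) m = gs_zero K (E.T (Suc r)) * E.ii (Suc r) m"
        using zero_left[OF K E.T_scheme closed_embD(1)[OF iiE]] by simp
    qed
    fix S :: "'a hopf" and t assume S: "fcgs S" and t: "t \<in> gs_hom S (D.T (Suc r))" and 0: "t * g (Suc r) = gs_zero S (E.T (Suc r))"
    note [simp] = gs_hom_dims[OF t]
    have ti: "t * D.ii (Suc r) m \<in> gs_hom S (D.T (Suc m + r))" by (rule hom_comp[OF S D.T_scheme D.T_scheme t iiD])
    have "t * D.ii (Suc r) m * g (Suc m + r) = (t * g (Suc r)) * E.ii (Suc r) m" using nat[of r] by (simp add: mat_assoc)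
    also have "\<dots> = gs_zero S (E.T (Suc m + r))"
      unfolding 0 by (rule zero_left[OF S E.T_scheme closed_embD(1)[OF iiE]])
    finally obtain v where v: "v \<in> gs_hom S K" "v * (\<kappa> * D.ii (Suc m) r) = t * D.ii (Suc r) m"
      using is_kernelD(4)[OF ker S ti] by blast
    have "v * (\<kappa>' * D.ii (Suc 0) r) = t"
    proof (rule closed_emb_cancel[OF iiD_emb _ t])
      show "v * (\<kappa>' * D.ii (Suc 0) r) \<in> gs_hom S (D.T (Suc r))" by (rule hom_comp[OF S K D.T_scheme v(1) \<kappa>ii])
      have "v * (\<kappa>' * D.ii (Suc 0) r) * D.ii (Suc r) m = v * (\<kappa>' * D.ii (Suc 0) r * D.ii (Suc r) m)"
        using gs_hom_dims[OF v(1)] by (simp add: mat_assoc)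
      thus "v * (\<kappa>' * D.ii (Suc 0) r) * D.ii (Suc r) m = t * D.ii (Suc r) m" unfolding big v(2) .
    qed
    thus "\<exists>v \<in> gs_hom S K. v * (\<kappa>' * D.ii (Suc 0) r) = t" using v(1) by blast
  qed
  thus thesis by (intro that[of \<kappa>']) (simp add: finite_kernel_def gs_comp_def \<kappa>'(1))
qed

context subgroup_data
begin

text \<open>Every isogeny with kernel \<open>K\<close> in \<open>D[p]\<close> is the quotient by
  \<open>K\<close>: \<open>g\<close> maps \<open>P n\<close> onto \<open>E[p^n]\<close>.
  \<open>pdiv_surj\<close> gives a cover only from some large level, so the main point is that this
  cover already factors through \<open>P n\<close>.\<close>

lemma isogeny_quotient:
  assumes "pdivisible p E h'" and g: "g \<in> pdiv_hom D E" and surj: "pdiv_surj D E g"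
    and fk: "finite_kernel D E g K (Suc 0) \<kappa>"
  obtains q where "quotient_data p D h K \<kappa> C c j P \<iota> k (torsion E) q"
    "\<And>n. q n * incl E n = \<iota> n * g (Suc n)"
proof -
  interpret E: pdivisible p E h' by fact
  note gh = pdiv_homD(1)[OF g]
  note [simp] = gs_hom_dims[OF gh] gs_hom_dims[OF E.incl_hom] E.T_scheme
  have ker: "is_kernel K (\<kappa> * ii (Suc 0) r) (T (Suc r)) (E.T (Suc r)) (g (Suc r))" for r
    using fk unfolding finite_kernel_def gs_comp_def by simp
  have "\<exists>q. quotient_map (P n) (E.T n) q \<and> is_kernel K (k n) (P n) (E.T n) q \<and> q * E.i n = \<iota> n * g (Suc n)" for n
  proof -
    have \<iota>g: "\<iota> n * g (Suc n) \<in> gs_hom (P n) (E.T (Suc n))" by (rule hom_comp[OF _ _ _ \<iota>_hom gh]) simp_all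
    obtain v where v: "v \<in> gs_hom (P n) K" "\<iota> n * gs_times (T (Suc n)) (p ^ n) = v * (\<kappa> * ii (Suc 0) n)"
      by (rule \<iota>_power)
    note [simp] = gs_hom_dims[OF v(1)]
    have "\<iota> n * g (Suc n) * gs_times (E.T (Suc n)) (p ^ n) = (\<iota> n * gs_times (T (Suc n)) (p ^ n)) * g (Suc n)"
      using times_natural[OF T_scheme E.T_scheme gh, of "Suc n" "p ^ n"] by (simp add: mat_assoc)
    also have "\<dots> = v * (\<kappa> * ii (Suc 0) n * g (Suc n))" unfolding v(2) by (simp add: mat_assoc)
    also have "\<dots> = gs_zero (P n) (E.T (Suc n))"
      unfolding is_kernelD(3)[OF ker] by (rule zero_right[OF _ _ v(1)]) simp_all
    finally obtain q where q: "q \<in> gs_hom (P n) (E.T n)" "q * E.i n = \<iota> n * g (Suc n)"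
      using is_kernelD(4)[OF E.incl_kernel P_scheme \<iota>g] by blast
    note [simp] = gs_hom_dims[OF q(1)]
    have "is_kernel K (k n) (P n) (E.T (Suc n)) (q * E.i n)"
    proof (rule is_kernelI[OF _ k_emb])
      show "k n * (q * E.i n) = gs_zero K (E.T (Suc n))"
        unfolding q(2) using is_kernelD(3)[OF ker[of n]] by (simp add: mult_pull[OF k_\<iota>])
      fix S :: "'k hopf" and t assume S: "fcgs S" and t: "t \<in> gs_hom S (P n)" and 0: "t * (q * E.i n) = gs_zero S (E.T (Suc n))"
      note [simp] = gs_hom_dims[OF t]
      have t\<iota>: "t * \<iota> n \<in> gs_hom S (T (Suc n))" by (rule hom_comp[OF S _ _ t \<iota>_hom]) simp_all
      have "t * \<iota> n * g (Suc n) = gs_zero S (E.T (Suc n))" using 0 unfolding q(2) by (simp add: mat_assoc)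
      then obtain w where w: "w \<in> gs_hom S K" "w * (\<kappa> * ii (Suc 0) n) = t * \<iota> n"
        using is_kernelD(4)[OF ker S t\<iota>] by blast
      have "w * k n = t"
      proof (rule closed_emb_cancel[OF \<iota>_emb _ t])
        show "w * k n \<in> gs_hom S (P n)" by (rule hom_comp[OF S _ _ w(1) k_hom]) simp_all
        show "w * k n * \<iota> n = t * \<iota> n" using gs_hom_dims[OF w(1)] w(2) by (simp add: mat_assoc k_\<iota>)
      qed
      thus "\<exists>w \<in> gs_hom S K. w * k n = t" using w(1) by blast
    qed simp
    hence qk: "is_kernel K (k n) (P n) (E.T n) q"
      using kernel_comp_closed_emb[OF P_scheme E.T_scheme E.T_scheme q(1) E.incl_emb K_scheme] by simp
    obtain r I \<alpha> m s where I: "fcgs I" "quotient_map (T (n + Suc r)) I \<alpha>"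
      "closed_emb I (E.T (n + Suc r)) m" "g (n + Suc r) = \<alpha> * m" "closed_emb (E.T n) I s" "s * m = E.ii n (Suc r)"
      by (rule pdiv_surjD[OF pdivisible_axioms assms(1) g surj])
    let ?N = "Suc (n + r)"
    \<comment> \<open>\<open>Q\<close> is the preimage of \<open>E[p^n]\<close> in the large torsion
      group \<open>D[p^N]\<close> with \<open>N = n + r + 1\<close>.\<close>
    obtain Q \<beta> \<phi> where Q: "fcgs Q" "closed_emb Q (T ?N) \<beta>" "quotient_map Q (E.T n) \<phi>" "\<beta> * \<alpha> = \<phi> * s"
      using pullback_quotient[OF T_scheme I(1) E.T_scheme I(2,5)] by auto
    note \<beta>h = closed_embD(1)[OF Q(2)] and \<phi>h = quotient_mapD[OF Q(3)]
    have iiE: "E.ii (Suc n) r \<in> gs_hom (E.T (Suc n)) (E.T ?N)" using E.ii_hom[of "Suc n" r] by simp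
    have iiT: "closed_emb (T (Suc n)) (T ?N) (ii (Suc n) r)" using ii_emb[of "Suc n" r] by simp
    have \<alpha>h: "\<alpha> \<in> gs_hom (T ?N) I" and mh: "m \<in> gs_hom I (E.T ?N)" and sh: "s \<in> gs_hom (E.T n) I"
      using quotient_mapD[OF I(2)] closed_embD(1)[OF I(3)] closed_embD(1)[OF I(5)] by simp_all
    note [simp] = gs_hom_dims[OF \<beta>h] gs_hom_dims[OF \<phi>h] gs_hom_dims[OF iiE] gs_hom_dims[OF closed_embD(1)[OF iiT]]
      gs_hom_dims[OF \<alpha>h] gs_hom_dims[OF mh] gs_hom_dims[OF sh] times_dims[OF E.T_scheme]
    have iiE_eq: "s * m = E.i n * E.ii (Suc n) r" unfolding I(6) by (rule E.ii_Suc_left)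
    have g_eq: "g ?N = \<alpha> * m" using I(4) by simp
    have \<beta>g: "\<beta> * g ?N = \<phi> * (E.i n * E.ii (Suc n) r)"
      unfolding g_eq by (simp add: mult_pull[OF Q(4)] mat_assoc iiE_eq)
    have \<beta>w: "\<beta> * gs_times (T ?N) (p ^ n) \<in> gs_hom Q (T ?N)" by (rule hom_comp[OF Q(1) _ _ \<beta>h times_hom]) simp_all
    have "\<beta> * gs_times (T ?N) (p ^ n) * g ?N = (\<beta> * g ?N) * gs_times (E.T ?N) (p ^ n)"
      using times_natural[OF T_scheme E.T_scheme gh, of ?N "p ^ n"] by (simp add: mat_assoc)
    also have "\<dots> = \<phi> * (E.i n * E.ii (Suc n) r * gs_times (E.T ?N) (p ^ n))" unfolding \<beta>g by (simp add: mat_assoc)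
    also have "E.i n * E.ii (Suc n) r * gs_times (E.T ?N) (p ^ n) = gs_zero (E.T n) (E.T ?N)"
      using is_kernelD(3)[OF E.ii_kernel[of n "Suc r"]] by (simp add: E.ii_Suc_left[symmetric] del: incl_iter.simps)
    also have "\<phi> * gs_zero (E.T n) (E.T ?N) = gs_zero Q (E.T ?N)" by (rule zero_right[OF _ _ \<phi>h]) simp_all
    finally obtain w where w: "w \<in> gs_hom Q K" "w * (\<kappa> * ii (Suc 0) (n + r)) = \<beta> * gs_times (T ?N) (p ^ n)"
      using is_kernelD(4)[OF ker[of "n + r"] Q(1) \<beta>w] by blast
    note [simp] = gs_hom_dims[OF w(1)]
    \<comment> \<open>Multiplication by \<open>p ^ n\<close> sends \<open>Q\<close> into
      \<open>K\<close>, and \<open>K\<close> is killed by \<open>p\<close>; hence \<open>Q\<close>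
      lies in \<open>D[p^(n+1)]\<close>, and then in \<open>P n\<close>.\<close>
    have "\<beta> * gs_times (T ?N) (p ^ Suc n) = (\<beta> * gs_times (T ?N) (p ^ n)) * gs_times (T ?N) (p ^ 1)"
      using times_power_add[of "T ?N" p n 1] by (simp add: mat_assoc del: power_Suc)
    also have "\<dots> = w * (\<kappa> * ii (Suc 0) (n + r) * gs_times (T ?N) (p ^ 1))"
      unfolding w(2)[symmetric] by (simp add: mat_assoc)
    also have "\<dots> = gs_zero Q (T ?N)" unfolding \<kappa>ii_killed by (rule zero_right[OF _ _ w(1)]) simp_all
    finally have "\<exists>y \<in> gs_hom Q (T (Suc n)). y * ii (Suc n) r = \<beta>"
      using is_kernelD(4)[OF ii_kernel[of "Suc n" r] Q(1)] \<beta>h by simp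
    then obtain y where y: "y \<in> gs_hom Q (T (Suc n))" "y * ii (Suc n) r = \<beta>" by blast
    note [simp] = gs_hom_dims[OF y(1)]
    have "y * gs_times (T (Suc n)) (p ^ n) = w * (\<kappa> * ii (Suc 0) n)"
    proof (rule closed_emb_cancel[OF iiT])
      show "y * gs_times (T (Suc n)) (p ^ n) \<in> gs_hom Q (T (Suc n))"
        by (rule hom_comp[OF Q(1) _ _ y(1) times_hom]) simp_all
      show "w * (\<kappa> * ii (Suc 0) n) \<in> gs_hom Q (T (Suc n))"
        by (rule hom_comp[OF Q(1) _ _ w(1) closed_embD(1)[OF \<kappa>ii_emb]]) simp_all
      have "y * gs_times (T (Suc n)) (p ^ n) * ii (Suc n) r = (y * ii (Suc n) r) * gs_times (T ?N) (p ^ n)"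
        using times_natural[OF _ _ closed_embD(1)[OF iiT], of "p ^ n"] by (simp add: mat_assoc)
      also have "\<dots> = w * (\<kappa> * ii (Suc 0) n) * ii (Suc n) r"
        unfolding y(2) w(2)[symmetric] using ii_add[of "Suc 0" n r] by (simp add: mat_assoc)
      finally show "y * gs_times (T (Suc n)) (p ^ n) * ii (Suc n) r = w * (\<kappa> * ii (Suc 0) n) * ii (Suc n) r" .
    qed
    then obtain z where z: "z \<in> gs_hom Q (P n)" "z * \<iota> n = y" by (rule factor_P[OF Q(1) y(1) w(1)])
    note [simp] = gs_hom_dims[OF z(1)]
    have "z * q = \<phi>"
    proof (rule closed_emb_cancel[OF E.incl_emb _ \<phi>h])
      show zq: "z * q \<in> gs_hom Q (E.T n)" by (rule hom_comp[OF Q(1) _ _ z(1) q(1)]) simp_all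
      show "z * q * E.i n = \<phi> * E.i n"
      proof (rule closed_emb_cancel)
        show "closed_emb (E.T (Suc n)) (E.T ?N) (E.ii (Suc n) r)" using E.ii_emb[of "Suc n" r] by simp
        show "z * q * E.i n \<in> gs_hom Q (E.T (Suc n))" by (rule hom_comp[OF Q(1) _ _ zq E.incl_hom]) simp_all
        show "\<phi> * E.i n \<in> gs_hom Q (E.T (Suc n))" by (rule hom_comp[OF Q(1) _ _ \<phi>h E.incl_hom]) simp_all
        have "z * q * E.i n * E.ii (Suc n) r = y * (g (Suc n) * E.ii (Suc n) r)"
          by (simp add: mat_assoc mult_pull[OF q(2)] mult_pull[OF z(2)])
        also have "g (Suc n) * E.ii (Suc n) r = ii (Suc n) r * g ?N"
          using pdiv_hom_iter[OF pdivisible_axioms assms(1) g, of "Suc n" r] by simp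
        also have "y * (ii (Suc n) r * g ?N) = \<phi> * E.i n * E.ii (Suc n) r"
          by (simp add: mult_pull[OF y(2)] \<beta>g mat_assoc)
        finally show "z * q * E.i n * E.ii (Suc n) r = \<phi> * E.i n * E.ii (Suc n) r" .
      qed
    qed
    hence "quotient_map (P n) (E.T n) q" using quotient_map_second[OF z(1) q(1)] Q(3) by simp
    thus ?thesis using qk q(2) by blast
  qed
  then obtain q where q: "\<And>n. quotient_map (P n) (E.T n) (q n)" "\<And>n. is_kernel K (k n) (P n) (E.T n) (q n)"
    "\<And>n. q n * E.i n = \<iota> n * g (Suc n)" by metis
  show thesis by (rule that[of q]) (unfold_locales, use q in auto)
qed

text \<open>Multiplication by \<open>p\<close> maps \<open>P n\<close> to \<open>D[p^n]\<close> and
  kills \<open>K\<close>, so it induces \<open>b\<close> on \<open>E[p^n]\<close> with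
  \<open>g\<close> followed by \<open>b\<close> equal to \<open>p\<close>. The kernel is the image
  under \<open>g\<close> of \<open>D[p]\<close>, that is \<open>C\<close>.\<close>

lemma dual_isogeny:
  assumes "pdivisible p E h'" and g: "g \<in> pdiv_hom D E"
    and qd: "quotient_data p D h K \<kappa> C c j P \<iota> k (torsion E) q"
    and q\<iota>: "\<And>n. q n * incl E n = \<iota> n * g (Suc n)"
    and fk: "finite_kernel D E g K (Suc 0) \<kappa>"
  obtains b \<mu> where "isogeny E D b" "finite_kernel E D b C (Suc 0) \<mu>"
proof -
  interpret E: pdivisible p E h' by fact
  interpret quotient_data p D h K \<kappa> C c j P \<iota> k "torsion E" q by fact
  note gh = pdiv_homD(1)[OF g]
  note [simp] = gs_hom_dims[OF gh] gs_hom_dims[OF E.incl_hom] gs_hom_dims[OF E.ii1_hom]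
  have ker: "is_kernel K (\<kappa> * ii (Suc 0) r) (T (Suc r)) (E.T (Suc r)) (g (Suc r))" for r
    using fk unfolding finite_kernel_def gs_comp_def by simp
  \<comment> \<open>\<open>d n\<close> is multiplication by \<open>p\<close> regarded as a map onto
    \<open>D[p^n]\<close>.\<close>
  have "\<exists>d. quotient_map (T (Suc n)) (T n) d \<and> d * i n = gs_times (T (Suc n)) p" for n
    using multiplication_quotient[of n 1] ii_1[of n] by auto
  then obtain d where d: "\<And>n. quotient_map (T (Suc n)) (T n) (d n)" "\<And>n. d n * i n = gs_times (T (Suc n)) p" by metis
  note dh = quotient_mapD[OF d(1)]
  note [simp] = gs_hom_dims[OF dh]
  have T1p: "gs_times (T (Suc 0)) p = gs_zero (T (Suc 0)) (T (Suc 0))" using T_killed[of "Suc 0" 1] by simp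
  have iip: "ii (Suc 0) n * gs_times (T (Suc n)) p = gs_zero (T (Suc 0)) (T (Suc n))" for n
    using times_natural[OF _ _ ii1_hom, of n p] zero_left[OF _ _ ii1_hom, of "T (Suc 0)" n] by (simp add: T1p)
  have \<iota>d: "\<iota> n * d n \<in> gs_hom (P n) (T n)" for n by (rule hom_comp[OF _ _ _ \<iota>_hom dh]) simp_all
  have k\<iota>d: "k n * (\<iota> n * d n) = gs_zero K (T n)" for n
  proof (rule closed_emb_cancel[OF incl_emb])
    show "k n * (\<iota> n * d n) \<in> gs_hom K (T n)" by (rule hom_comp[OF _ _ _ k_hom \<iota>d]) simp_all
    have "k n * (\<iota> n * d n) * i n = \<kappa> * gs_zero (T (Suc 0)) (T (Suc n))"
      by (simp add: mat_assoc d(2) mult_pull[OF k_\<iota>] iip)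
    thus "k n * (\<iota> n * d n) * i n = gs_zero K (T n) * i n"
      using zero_right[OF _ _ \<kappa>_hom, of "T (Suc n)"] zero_left[OF _ _ incl_hom, of K n] by simp
  qed (rule gs_zero_hom; simp)
  have "\<exists>b \<in> gs_hom (E.T n) (T n). q n * b = \<iota> n * d n" for n
    using quotient_factor[OF _ _ e_quot e_ker _ \<iota>d k\<iota>d] P_scheme E_scheme T_scheme by metis
  then obtain b where b: "\<And>n. b n \<in> gs_hom (E.T n) (T n)" "\<And>n. q n * b n = \<iota> n * d n" by metis
  note [simp] = gs_hom_dims[OF b(1)]
  have aq: "a n * q n = g n" for n
  proof (rule closed_emb_cancel[OF E.incl_emb _ gh])
    show "a n * q n \<in> gs_hom (T n) (E.T n)" by (rule hom_comp[OF _ _ _ a_hom e_hom]) simp_all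
    show "a n * q n * E.i n = g n * E.i n"
      using pdiv_homD(2)[OF g, of n] by (simp add: mat_assoc q\<iota> mult_pull[OF a_\<iota>])
  qed
  have id: "i n * d n = gs_times (T n) p" for n
  proof (rule closed_emb_cancel[OF incl_emb _ times_hom])
    show "i n * d n \<in> gs_hom (T n) (T n)" by (rule hom_comp[OF _ _ _ incl_hom dh]) simp_all
    show "i n * d n * i n = gs_times (T n) p * i n"
      using times_natural[OF _ _ incl_hom, of n p] by (simp add: mat_assoc d(2))
  qed simp
  have gb: "g n * b n = gs_times (T n) p" for n
    unfolding aq[symmetric] by (simp add: mat_assoc b(2) mult_pull[OF a_\<iota>] id)
  have bhom: "b \<in> pdiv_hom E D"
    unfolding pdiv_hom_def gs_comp_def
  proof (intro CollectI allI conjI)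
    fix n
    show "b n \<in> gs_hom (E.T n) (T n)" by (rule b(1))
    show "E.i n * b (Suc n) = b n * i n"
    proof (rule quotient_map_cancel[OF e_quot])
      show "E.i n * b (Suc n) \<in> gs_hom (E.T n) (T (Suc n))" by (rule hom_comp[OF _ _ _ E.incl_hom b(1)]) simp_all
      show "b n * i n \<in> gs_hom (E.T n) (T (Suc n))" by (rule hom_comp[OF _ _ _ b(1) incl_hom]) simp_all
      have "q n * (E.i n * b (Suc n)) = \<iota> n * gs_times (T (Suc n)) p" by (simp add: mult_pull[OF q\<iota>] mat_assoc gb)
      also have "\<dots> = q n * (b n * i n)" by (simp add: mult_pull[OF b(2)] mat_assoc d(2))
      finally show "q n * (E.i n * b (Suc n)) = q n * (b n * i n)" .
    qed
  qed
  have bsurj: "pdiv_surj E D b"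
  proof (rule pdiv_surjI[OF bhom, of "\<lambda>_. 1" "\<lambda>n. T (Suc n)" d "\<lambda>n. g (Suc n)"])
    show "g (Suc n) * b (n + 1) = d n * ii n 1" for n unfolding ii_1 by (simp add: gb d(2))
    show "ii n 1 \<in> gs_hom (T n) (T (n + 1))" for n by (rule ii_hom)
    show "g (Suc n) \<in> gs_hom (T (Suc n)) (E.T (n + 1))" for n using gh[of "Suc n"] by simp
  qed (use d(1) in auto)
  have \<kappa>g: "\<kappa> * g (Suc 0) = gs_zero K (E.T (Suc 0))"
    using is_kernelD(3)[OF ker[of 0]] gs_id_comp(2)[OF \<kappa>_hom] by simp
  \<comment> \<open>\<open>g\<close> on \<open>D[p]\<close> has kernel \<open>K\<close>, so it
    factors through \<open>C\<close>; this realises \<open>C\<close> inside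
    \<open>E[p]\<close>.\<close>
  obtain \<mu> where \<mu>: "\<mu> \<in> gs_hom C (E.T (Suc 0))" "c * \<mu> = g (Suc 0)"
    using quotient_factor[OF _ _ c_quot c_ker _ gh \<kappa>g] T_scheme C_scheme E.T_scheme by metis
  note [simp] = gs_hom_dims[OF \<mu>(1)]
  have gii: "g (Suc 0) * E.ii (Suc 0) r = ii (Suc 0) r * g (Suc r)" for r
    using pdiv_hom_iter[OF pdivisible_axioms assms(1) g, of "Suc 0" r] by simp
  have "is_kernel C (\<mu> * E.ii (Suc 0) r) (E.T (Suc r)) (T (Suc r)) (b (Suc r))" for r
  proof -
    let ?n = "Suc r"
    have \<mu>ii: "\<mu> * E.ii (Suc 0) r \<in> gs_hom C (E.T ?n)" by (rule hom_comp[OF _ _ _ \<mu>(1) E.ii1_hom]) simp_all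
    have c\<mu>: "c * (\<mu> * E.ii (Suc 0) r) = ii (Suc 0) r * g ?n" by (simp add: mult_pull[OF \<mu>(2)] gii)
    have zero: "\<mu> * E.ii (Suc 0) r * b ?n = gs_zero C (T ?n)"
    proof (rule quotient_map_cancel[OF c_quot])
      show "\<mu> * E.ii (Suc 0) r * b ?n \<in> gs_hom C (T ?n)" by (rule hom_comp[OF _ _ _ \<mu>ii b(1)]) simp_all
      have "c * (\<mu> * E.ii (Suc 0) r * b ?n) = (c * (\<mu> * E.ii (Suc 0) r)) * b ?n" by (simp add: mat_assoc)
      also have "\<dots> = gs_zero (T (Suc 0)) (T ?n)" unfolding c\<mu> by (simp add: mat_assoc gb iip)
      finally show "c * (\<mu> * E.ii (Suc 0) r * b ?n) = c * gs_zero C (T ?n)"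
        using zero_right[OF _ _ c_hom, of "T ?n"] by simp
    qed (rule gs_zero_hom; simp)
    have emb: "closed_emb C (E.T ?n) (\<mu> * E.ii (Suc 0) r)"
    proof (rule closed_emb_of_kernel[OF _ _ _ c_quot c_ker \<mu>ii])
      show "is_kernel K \<kappa> (T (Suc 0)) (E.T ?n) (c * (\<mu> * E.ii (Suc 0) r))"
      proof (rule is_kernelI[OF _ \<kappa>_emb])
        show "\<kappa> * (c * (\<mu> * E.ii (Suc 0) r)) = gs_zero K (E.T ?n)"
          unfolding c\<mu> using is_kernelD(3)[OF ker[of r]] by (simp add: mat_assoc)
        fix S :: "'k hopf" and t assume S: "fcgs S" and t: "t \<in> gs_hom S (T (Suc 0))"
          and 0: "t * (c * (\<mu> * E.ii (Suc 0) r)) = gs_zero S (E.T ?n)"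
        note [simp] = gs_hom_dims[OF t]
        have tii: "t * ii (Suc 0) r \<in> gs_hom S (T ?n)" by (rule hom_comp[OF S _ _ t ii1_hom]) simp_all
        have "t * ii (Suc 0) r * g ?n = gs_zero S (E.T ?n)" using 0 unfolding c\<mu> by (simp add: mat_assoc)
        then obtain v where v: "v \<in> gs_hom S K" "v * (\<kappa> * ii (Suc 0) r) = t * ii (Suc 0) r"
          using is_kernelD(4)[OF ker S tii] by blast
        have "v * \<kappa> = t"
        proof (rule closed_emb_cancel[OF ii1_emb _ t])
          show "v * \<kappa> \<in> gs_hom S (T (Suc 0))" by (rule hom_comp[OF S _ _ v(1) \<kappa>_hom]) simp_all
          show "v * \<kappa> * ii (Suc 0) r = t * ii (Suc 0) r" using gs_hom_dims[OF v(1)] v(2) by (simp add: mat_assoc)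
        qed
        thus "\<exists>v \<in> gs_hom S K. v * \<kappa> = t" using v(1) by blast
      qed simp
    qed simp_all
    text \<open>The kernel of \<open>b\<close> has the order of \<open>C\<close> because \<open>\<iota> * d\<close> on \<open>P\<close> has kernel \<open>D[p]\<close>.\<close>
    obtain N \<nu> where N: "is_kernel N \<nu> (E.T ?n) (T ?n) (b ?n)" using kernel_exists[OF _ _ b(1)] E.T_scheme T_scheme by metis
    obtain I \<alpha> m where I: "fcgs I" "quotient_map (E.T ?n) I \<alpha>" "closed_emb I (T ?n) m" "b ?n = \<alpha> * m"
      using image_factorization[OF _ _ b(1)] by (metis E.T_scheme T_scheme gs_comp_def)
    have oE: "order (E.T ?n) = order N * order I"
      using order_kernel_image[OF _ I(1) _ I(2,3)] N I(4) by simp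
    have "gs_times (T (Suc 0)) (p ^ Suc r) = gs_zero (T (Suc 0)) (T (Suc 0))" by (rule T_killed) simp
    hence "ii (Suc 0) ?n * gs_times (T (Suc ?n)) (p ^ ?n) = gs_zero (T (Suc 0)) K * (\<kappa> * ii (Suc 0) ?n)"
      using times_natural[OF _ _ ii1_hom, of ?n "p ^ ?n"] zero_left[OF _ _ ii1_hom, of "T (Suc 0)" ?n]
        zero_left[OF _ _ closed_embD(1)[OF \<kappa>ii_emb], of "T (Suc 0)" ?n] by (simp del: incl_iter.simps power_Suc)
    then obtain w where w: "w \<in> gs_hom (T (Suc 0)) (P ?n)" "w * \<iota> ?n = ii (Suc 0) ?n"
      using factor_P[OF T_scheme ii1_hom gs_zero_hom[OF T_scheme K_scheme]] by metis
    note [simp] = gs_hom_dims[OF w(1)]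
    have "is_kernel (T (Suc 0)) w (P ?n) (T (Suc ?n)) (\<iota> ?n * d ?n * i ?n)"
    proof (rule is_kernelI)
      show "closed_emb (T (Suc 0)) (P ?n) w" using closed_emb_first[OF w(1) \<iota>_hom] ii1_emb[of ?n] unfolding w(2) .
      show "w * (\<iota> ?n * d ?n * i ?n) = gs_zero (T (Suc 0)) (T (Suc ?n))"
        using iip[of ?n] by (simp add: mat_assoc d(2) mult_pull[OF w(2)] del: incl_iter.simps)
      fix S :: "'k hopf" and t assume S: "fcgs S" and t: "t \<in> gs_hom S (P ?n)"
        and 0: "t * (\<iota> ?n * d ?n * i ?n) = gs_zero S (T (Suc ?n))"
      note [simp] = gs_hom_dims[OF t]
      have t\<iota>: "t * \<iota> ?n \<in> gs_hom S (T (Suc ?n))" by (rule hom_comp[OF S _ _ t \<iota>_hom]) simp_all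
      have "t * \<iota> ?n * gs_times (T (Suc ?n)) p = gs_zero S (T (Suc ?n))" using 0 by (simp add: mat_assoc d(2))
      hence "\<exists>y \<in> gs_hom S (T (Suc 0)). y * ii (Suc 0) ?n = t * \<iota> ?n"
        using is_kernelD(4)[OF ii_kernel[of "Suc 0" ?n] S, of "t * \<iota> ?n"] t\<iota> by (simp del: incl_iter.simps)
      then obtain y where y: "y \<in> gs_hom S (T (Suc 0))" "y * ii (Suc 0) ?n = t * \<iota> ?n" by blast
      have "y * w = t"
      proof (rule closed_emb_cancel[OF \<iota>_emb _ t])
        show "y * w \<in> gs_hom S (P ?n)" by (rule hom_comp[OF S _ _ y(1) w(1)]) simp_all
        show "y * w * \<iota> ?n = t * \<iota> ?n" using gs_hom_dims[OF y(1)] y(2) by (simp add: mat_assoc w(2) del: incl_iter.simps)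
      qed
      thus "\<exists>y \<in> gs_hom S (T (Suc 0)). y * w = t" using y(1) by blast
    qed simp
    hence "is_kernel (T (Suc 0)) w (P ?n) (T ?n) (\<iota> ?n * d ?n)"
      using kernel_comp_closed_emb[OF P_scheme T_scheme T_scheme \<iota>d incl_emb T_scheme] by simp
    hence kw: "is_kernel (T (Suc 0)) w (P ?n) (T ?n) (q ?n * \<alpha> * m)"
      using b(2)[of ?n] hom_assoc[OF e_hom quotient_mapD[OF I(2)] closed_embD(1)[OF I(3)]] I(4) by simp
    have "quotient_map (P ?n) I (q ?n * \<alpha>)" by (rule quotient_map_comp[OF _ _ I(1) e_quot I(2)]) simp_all
    hence oP: "order (P ?n) = order (T (Suc 0)) * order I"
      using order_kernel_image[OF _ I(1) _ _ I(3) kw] by simp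
    have "order K * (order N * order I) = order K * order C * order I"
      using oP P_order[of ?n] E_order[of ?n] oE C_order by simp
    moreover have "order I > 0" by (rule order_positive[OF I(1)])
    ultimately have ord: "order C = order N" using K_pos by simp
    obtain u where u: "u \<in> gs_hom C N" "u * \<nu> = \<mu> * E.ii (Suc 0) r"
      using is_kernelD(4)[OF N C_scheme \<mu>ii zero] by blast
    show ?thesis using kernel_of_iso[OF N _ _ _ b(1) u(1) _ ord] emb u(2) by simp
  qed
  hence fkb: "finite_kernel E D b C (Suc 0) \<mu>" using \<mu>(1) by (simp add: finite_kernel_def gs_comp_def)
  moreover have "isogeny E D b" using bhom bsurj fkb unfolding isogeny_def by blast
  ultimately show thesis using that by blast
qed

end

section \<open>Isogeny cutoffs\<close>

text \<open>If the kernels sit at levels \<open>\<alpha>\<close> and \<open>\<beta>\<close>, that of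
  the composite is killed by \<open>p ^ (\<alpha> + \<beta>)\<close>, so computing it at level
  \<open>\<alpha> + \<beta>\<close> suffices.\<close>

lemma isogeny_comp:
  assumes "pdivisible p D h" "pdivisible p E h'" "pdivisible p F h''"
    and "isogeny D E g" "isogeny E F g'"
  shows "isogeny D F (\<lambda>n. g n * g' n)"
proof -
  interpret D: pdivisible p D h by fact
  interpret E: pdivisible p E h' by fact
  interpret F: pdivisible p F h'' by fact
  have g: "g \<in> pdiv_hom D E" and g': "g' \<in> pdiv_hom E F" using assms by (auto simp: isogeny_def)
  note gh = pdiv_homD(1)[OF g] and gh' = pdiv_homD(1)[OF g']
  note [simp] = D.T_scheme E.T_scheme F.T_scheme gs_hom_dims[OF gh] gs_hom_dims[OF gh']
    gs_hom_dims[OF D.incl_hom] gs_hom_dims[OF E.incl_hom] gs_hom_dims[OF F.incl_hom]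
    gs_hom_dims[OF F.ii_hom] times_dims zero_dims
  define gg where "gg n = g n * g' n" for n
  have ggh: "gg n \<in> gs_hom (D.T n) (F.T n)" for n unfolding gg_def by (rule hom_comp[OF _ _ _ gh gh']) simp_all
  note [simp] = gs_hom_dims[OF ggh]
  have hom: "gg \<in> pdiv_hom D F"
    unfolding pdiv_hom_def gs_comp_def
  proof (intro CollectI allI conjI ggh)
    fix n
    show "D.i n * gg (Suc n) = gg n * F.i n"
      using pdiv_homD(2)[OF g, of n] pdiv_homD(2)[OF g', of n]
      by (simp add: gg_def mat_assoc mult_pull[OF pdiv_homD(2)[OF g]])
  qed
  have surj: "pdiv_surj D F gg"
    unfolding pdiv_surj_def
  proof
    fix n
    obtain r' where r': "\<And>x. x \<in> carrier_vec (order (F.T (n + r'))) \<Longrightarrow>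
        g' (n + r') *\<^sub>v x = 0\<^sub>v (order (E.T (n + r'))) \<Longrightarrow> F.ii n r' *\<^sub>v x = 0\<^sub>v (order (F.T n))"
      using assms(5) unfolding isogeny_def pdiv_surj_def by blast
    let ?m = "n + r'"
    obtain r where r: "\<And>x. x \<in> carrier_vec (order (E.T (?m + r))) \<Longrightarrow>
        g (?m + r) *\<^sub>v x = 0\<^sub>v (order (D.T (?m + r))) \<Longrightarrow> E.ii ?m r *\<^sub>v x = 0\<^sub>v (order (E.T ?m))"
      using assms(4) unfolding isogeny_def pdiv_surj_def by blast
    let ?N = "?m + r"
    have gc: "g ?N \<in> carrier_mat (order (D.T ?N)) (order (E.T ?N))" using gs_homD(1)[OF gh] .
    have gc': "g' x \<in> carrier_mat (order (E.T x)) (order (F.T x))" for x using gs_homD(1)[OF gh'] .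
    have ic: "E.ii ?m r \<in> carrier_mat (order (E.T ?m)) (order (E.T ?N))" "F.ii ?m r \<in> carrier_mat (order (F.T ?m)) (order (F.T ?N))"
      "F.ii n r' \<in> carrier_mat (order (F.T n)) (order (F.T ?m))"
      using gs_homD(1)[OF E.ii_hom] gs_homD(1)[OF F.ii_hom] by auto
    show "\<exists>r. \<forall>x \<in> carrier_vec (order (F.T (n + r))). gg (n + r) *\<^sub>v x = 0\<^sub>v (order (D.T (n + r))) \<longrightarrow>
      F.ii n r *\<^sub>v x = 0\<^sub>v (order (F.T n))"
    proof (intro exI[of _ "r' + r"] ballI impI)
      fix x assume x: "x \<in> carrier_vec (order (F.T (n + (r' + r))))"
        and 0: "gg (n + (r' + r)) *\<^sub>v x = 0\<^sub>v (order (D.T (n + (r' + r))))"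
      have x: "x \<in> carrier_vec (order (F.T ?N))" and 0: "gg ?N *\<^sub>v x = 0\<^sub>v (order (D.T ?N))"
        using x 0 by (simp_all add: add.assoc)
      have "g ?N *\<^sub>v (g' ?N *\<^sub>v x) = 0\<^sub>v (order (D.T ?N))"
        using 0 assoc_mult_mat_vec[OF gc gc' x] by (simp add: gg_def)
      hence "E.ii ?m r *\<^sub>v (g' ?N *\<^sub>v x) = 0\<^sub>v (order (E.T ?m))" using r gc'[of ?N] x by simp
      moreover have "E.ii ?m r *\<^sub>v (g' ?N *\<^sub>v x) = (E.ii ?m r * g' ?N) *\<^sub>v x"
        by (rule assoc_mult_mat_vec[OF ic(1) gc' x, symmetric])
      moreover have "\<dots> = g' ?m *\<^sub>v (F.ii ?m r *\<^sub>v x)"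
        unfolding pdiv_hom_iter[OF assms(2,3) g'] by (rule assoc_mult_mat_vec[OF gc' ic(2) x])
      ultimately have "F.ii n r' *\<^sub>v (F.ii ?m r *\<^sub>v x) = 0\<^sub>v (order (F.T n))"
        using r' ic(2) x by simp
      thus "F.ii n (r' + r) *\<^sub>v x = 0\<^sub>v (order (F.T n))"
        unfolding F.ii_add by (subst assoc_mult_mat_vec[OF ic(3,2) x])
    qed
  qed
  obtain K \<alpha> \<kappa> where K: "finite_kernel D E g K \<alpha> \<kappa>" using assms(4) by (auto simp: isogeny_def)
  obtain K' \<beta> \<kappa>' where K': "finite_kernel E F g' K' \<beta> \<kappa>'" using assms(5) by (auto simp: isogeny_def)
  let ?N = "\<alpha> + \<beta>"
  obtain M \<mu> where M: "is_kernel M \<mu> (D.T ?N) (F.T ?N) (gg ?N)" using kernel_exists[OF _ _ ggh] D.T_scheme F.T_scheme by metis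
  note m = is_kernelD[OF M]
  note [simp] = m(1) gs_hom_dims[OF m(2)]
  have "finite_kernel D F gg M ?N \<mu>"
    unfolding finite_kernel_def gs_comp_def
  proof (intro conjI allI)
    fix r
    let ?R = "?N + r"
    have kerK: "is_kernel K (\<kappa> * D.ii \<alpha> (\<beta> + r)) (D.T ?R) (E.T ?R) (g ?R)"
      using K unfolding finite_kernel_def gs_comp_def by (simp add: add.assoc)
    have "is_kernel K' (\<kappa>' * E.ii \<beta> (\<alpha> + r)) (E.T (\<beta> + (\<alpha> + r))) (F.T (\<beta> + (\<alpha> + r))) (g' (\<beta> + (\<alpha> + r)))"
      using K' unfolding finite_kernel_def gs_comp_def by blast
    moreover have R: "\<beta> + (\<alpha> + r) = ?R" by simp
    ultimately have kerK': "is_kernel K' (\<kappa>' * E.ii \<beta> (\<alpha> + r)) (E.T ?R) (F.T ?R) (g' ?R)" by simp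
    have \<kappa>h: "\<kappa> \<in> gs_hom K (D.T \<alpha>)" and \<kappa>h': "\<kappa>' \<in> gs_hom K' (E.T \<beta>)"
      using K K' by (auto simp: finite_kernel_def)
    have iiD: "D.ii \<alpha> (\<beta> + r) \<in> gs_hom (D.T \<alpha>) (D.T ?R)" using D.ii_hom[of \<alpha> "\<beta> + r"] by (simp add: add.assoc)
    have iiE: "E.ii \<beta> (\<alpha> + r) \<in> gs_hom (E.T \<beta>) (E.T ?R)" using E.ii_hom[of \<beta> "\<alpha> + r"] unfolding R .
    note [simp] = gs_hom_dims[OF \<kappa>h] gs_hom_dims[OF \<kappa>h'] gs_hom_dims[OF iiD] gs_hom_dims[OF iiE] gs_hom_dims[OF D.ii_hom[of ?N r]]
      is_kernelD(1)[OF kerK] is_kernelD(1)[OF kerK']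
    have emb: "closed_emb M (D.T ?R) (\<mu> * D.ii ?N r)"
      by (rule closed_emb_comp[OF _ _ _ kernel_closed_emb[OF M _ _ ggh] D.ii_emb]) simp_all
    have nat: "D.ii ?N r * gg ?R = gg ?N * F.ii ?N r" by (rule pdiv_hom_iter[OF assms(1,3) hom])
    show "is_kernel M (\<mu> * D.ii ?N r) (D.T ?R) (F.T ?R) (gg ?R)"
    proof (rule is_kernelI[OF m(1) emb])
      have "\<mu> * D.ii ?N r * gg ?R = (\<mu> * gg ?N) * F.ii ?N r" by (simp add: mat_assoc nat)
      thus "\<mu> * D.ii ?N r * gg ?R = gs_zero M (F.T ?R)"
        unfolding m(3) using zero_left[OF _ _ F.ii_hom, of M ?N r] by simp
      fix S :: "'a hopf" and t assume S: "fcgs S" and t: "t \<in> gs_hom S (D.T ?R)" and 0: "t * gg ?R = gs_zero S (F.T ?R)"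
      note [simp] = S gs_hom_dims[OF t]
      have tg: "t * g ?R \<in> gs_hom S (E.T ?R)" by (rule hom_comp[OF _ _ _ t gh]) simp_all
      have "t * g ?R * g' ?R = gs_zero S (F.T ?R)" using 0 by (simp add: gg_def mat_assoc)
      then obtain v where v: "v \<in> gs_hom S K'" "v * (\<kappa>' * E.ii \<beta> (\<alpha> + r)) = t * g ?R"
        using is_kernelD(4)[OF kerK' S tg] by blast
      note [simp] = gs_hom_dims[OF v(1)]
      have tw: "t * gs_times (D.T ?R) (p ^ \<beta>) \<in> gs_hom S (D.T ?R)" by (rule hom_comp[OF _ _ _ t times_hom]) simp_all
      \<comment> \<open>The image of \<open>t\<close> under \<open>g\<close> lies in
        \<open>K'\<close>, killed by \<open>p ^ \<beta>\<close>; so \<open>p ^ \<beta>\<close> times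
        \<open>t\<close> lies in \<open>K\<close>, killed by \<open>p ^ \<alpha>\<close>.\<close>
      have "t * gs_times (D.T ?R) (p ^ \<beta>) * g ?R = (t * g ?R) * gs_times (E.T ?R) (p ^ \<beta>)"
        using times_natural[OF _ _ gh, of ?R "p ^ \<beta>"] by (simp add: mat_assoc)
      also have "\<dots> = v * (\<kappa>' * (gs_times (E.T \<beta>) (p ^ \<beta>) * E.ii \<beta> (\<alpha> + r)))"
        unfolding v(2)[symmetric] using times_natural[OF _ _ iiE, of "p ^ \<beta>"] by (simp add: mat_assoc)
      also have "\<dots> = gs_zero S (E.T ?R)"
        using E.T_killed[of \<beta> \<beta>] zero_left[OF _ _ iiE, of "E.T \<beta>"] zero_right[OF _ _ \<kappa>h', of "E.T ?R"]
          zero_right[OF _ _ v(1), of "E.T ?R"] by simp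
      finally obtain v' where v': "v' \<in> gs_hom S K" "v' * (\<kappa> * D.ii \<alpha> (\<beta> + r)) = t * gs_times (D.T ?R) (p ^ \<beta>)"
        using is_kernelD(4)[OF kerK S tw] by blast
      note [simp] = gs_hom_dims[OF v'(1)]
      have "t * gs_times (D.T ?R) (p ^ ?N) = (t * gs_times (D.T ?R) (p ^ \<beta>)) * gs_times (D.T ?R) (p ^ \<alpha>)"
        using times_power_add[of "D.T ?R" p \<beta> \<alpha>] by (simp add: mat_assoc add.commute)
      also have "\<dots> = v' * (\<kappa> * (gs_times (D.T \<alpha>) (p ^ \<alpha>) * D.ii \<alpha> (\<beta> + r)))"
        unfolding v'(2)[symmetric] using times_natural[OF _ _ iiD, of "p ^ \<alpha>"] by (simp add: mat_assoc)
      also have "\<dots> = gs_zero S (D.T ?R)"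
        using D.T_killed[of \<alpha> \<alpha>] zero_left[OF _ _ iiD, of "D.T \<alpha>"] zero_right[OF _ _ \<kappa>h, of "D.T ?R"]
          zero_right[OF _ _ v'(1), of "D.T ?R"] by simp
      finally obtain y where y: "y \<in> gs_hom S (D.T ?N)" "y * D.ii ?N r = t"
        using is_kernelD(4)[OF D.ii_kernel S t] by blast
      note [simp] = gs_hom_dims[OF y(1)]
      have "y * gg ?N = gs_zero S (F.T ?N)"
      proof (rule closed_emb_cancel[OF F.ii_emb[of ?N r]])
        show "y * gg ?N \<in> gs_hom S (F.T ?N)" by (rule hom_comp[OF _ _ _ y(1) ggh]) simp_all
        have "y * gg ?N * F.ii ?N r = (y * D.ii ?N r) * gg ?R" by (simp add: mat_assoc nat)
        thus "y * gg ?N * F.ii ?N r = gs_zero S (F.T ?N) * F.ii ?N r"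
          unfolding y(2) 0 using zero_left[OF _ _ F.ii_hom, of S ?N r] by simp
      qed (rule gs_zero_hom; simp)
      then obtain z where z: "z \<in> gs_hom S M" "z * \<mu> = y" using m(4)[OF S y(1)] by blast
      have "z * (\<mu> * D.ii ?N r) = t" using gs_hom_dims[OF z(1)] by (simp add: mult_pull[OF z(2)] y(2))
      thus "\<exists>z \<in> gs_hom S M. z * (\<mu> * D.ii ?N r) = t" using z(1) by blast
    qed
  qed (rule m(2))
  hence "isogeny D F gg" using hom surj unfolding isogeny_def by blast
  thus ?thesis unfolding gg_def .
qed

lemma isogenous_trans:
  fixes D E F :: "'k :: alg_closed_field pdiv"
  assumes "p_divisible_group p D" "p_divisible_group p E" "p_divisible_group p F" "isogenous D E" "isogenous E F"
  shows "isogenous D F"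
  using assms isogeny_comp unfolding isogenous_def pdivisible_iff by metis

text \<open>If \<open>p^m x\<close> lies in the copy of \<open>K\<close> in \<open>D'\<close>, then
  \<open>p^m \<phi>(x)\<close> lies in the copy in \<open>D\<close>, as \<open>\<phi>1\<close>
  matches the two. So \<open>\<phi>\<close> restricts to the preimages of \<open>K\<close> and
  induces \<open>\<theta>\<close> on the quotients.\<close>

lemma quotient_level_map:
  assumes "quotient_data p D h K \<kappa> C c j P \<iota> k E e" "quotient_data p D' h' K \<kappa>' C' c' j' P' \<iota>' k' E' e'"
    and \<phi>: "\<phi> \<in> gs_hom (torsion D' (Suc m)) (torsion D (Suc m))"
    and \<phi>1: "\<phi>1 \<in> gs_hom (torsion D' (Suc 0)) (torsion D (Suc 0))"
    and eq: "\<phi>1 * incl_iter D (Suc 0) m = incl_iter D' (Suc 0) m * \<phi>" and \<kappa>: "\<kappa>' * \<phi>1 = \<kappa>"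
  obtains \<chi> \<theta> where "\<chi> \<in> gs_hom (P' m) (P m)" "\<chi> * \<iota> m = \<iota>' m * \<phi>"
    "\<theta> \<in> gs_hom (E' m) (E m)" "e' m * \<theta> = \<chi> * e m"
proof -
  interpret D: quotient_data p D h K \<kappa> C c j P \<iota> k E e by fact
  interpret D': quotient_data p D' h' K \<kappa>' C' c' j' P' \<iota>' k' E' e' by fact
  note [simp] = gs_hom_dims[OF \<phi>] gs_hom_dims[OF \<phi>1]
  have \<iota>\<phi>: "\<iota>' m * \<phi> \<in> gs_hom (P' m) (D.T (Suc m))" by (rule hom_comp[OF _ _ _ D'.\<iota>_hom \<phi>]) simp_all
  obtain v where v: "v \<in> gs_hom (P' m) K"
    "\<iota>' m * gs_times (D'.T (Suc m)) (p ^ m) = v * (\<kappa>' * D'.ii (Suc 0) m)" by (rule D'.\<iota>_power)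
  note [simp] = gs_hom_dims[OF v(1)]
  have \<kappa>ii: "\<kappa>' * (D'.ii (Suc 0) m * \<phi>) = \<kappa> * D.ii (Suc 0) m"
    unfolding eq[symmetric] by (simp add: mult_pull[OF \<kappa>])
  have "\<iota>' m * \<phi> * gs_times (D.T (Suc m)) (p ^ m) = (\<iota>' m * gs_times (D'.T (Suc m)) (p ^ m)) * \<phi>"
    using times_natural[OF _ _ \<phi>, of "p ^ m"] by (simp add: mat_assoc)
  also have "\<dots> = v * (\<kappa> * D.ii (Suc 0) m)" unfolding v(2) by (simp add: mat_assoc \<kappa>ii)
  finally obtain \<chi> where \<chi>: "\<chi> \<in> gs_hom (P' m) (P m)" "\<chi> * \<iota> m = \<iota>' m * \<phi>"
    using D.factor_P[OF D'.P_scheme \<iota>\<phi> v(1)] by metis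
  note [simp] = gs_hom_dims[OF \<chi>(1)]
  have k\<chi>: "k' m * \<chi> = k m"
  proof (rule closed_emb_cancel[OF D.\<iota>_emb _ D.k_hom])
    show "k' m * \<chi> \<in> gs_hom K (P m)" by (rule hom_comp[OF _ _ _ D'.k_hom \<chi>(1)]) simp_all
    show "k' m * \<chi> * \<iota> m = k m * \<iota> m"
      by (simp add: mat_assoc \<chi>(2) mult_pull[OF D'.k_\<iota>] D.k_\<iota> \<kappa>ii)
  qed
  have "k' m * (\<chi> * e m) = gs_zero K (E m)" by (simp add: mult_pull[OF k\<chi>] D.k_e)
  then obtain \<theta> where "\<theta> \<in> gs_hom (E' m) (E m)" "e' m * \<theta> = \<chi> * e m"
    using quotient_factor[OF _ _ D'.e_quot D'.e_ker _ hom_comp[OF _ _ _ \<chi>(1) D.e_hom]]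
      D'.P_scheme D.P_scheme D'.E_scheme D.E_scheme by metis
  thus thesis using that[OF \<chi>] by blast
qed

lemma quotient_level_inverse:
  assumes "quotient_data p D h K \<kappa> C c j P \<iota> k E e" "quotient_data p D' h' K \<kappa>' C' c' j' P' \<iota>' k' E' e'"
    and \<phi>: "\<phi> \<in> gs_hom (torsion D' (Suc m)) (torsion D (Suc m))"
    and \<psi>: "\<psi> \<in> gs_hom (torsion D (Suc m)) (torsion D' (Suc m))" and inv: "\<phi> * \<psi> = gs_id (torsion D' (Suc m))"
    and \<chi>: "\<chi> \<in> gs_hom (P' m) (P m)" "\<chi> * \<iota> m = \<iota>' m * \<phi>"
    and \<theta>: "\<theta> \<in> gs_hom (E' m) (E m)" "e' m * \<theta> = \<chi> * e m"
    and \<chi>': "\<chi>' \<in> gs_hom (P m) (P' m)" "\<chi>' * \<iota>' m = \<iota> m * \<psi>"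
    and \<theta>': "\<theta>' \<in> gs_hom (E m) (E' m)" "e m * \<theta>' = \<chi>' * e' m"
  shows "\<theta> * \<theta>' = gs_id (E' m)"
proof -
  interpret D: quotient_data p D h K \<kappa> C c j P \<iota> k E e by fact
  interpret D': quotient_data p D' h' K \<kappa>' C' c' j' P' \<iota>' k' E' e' by fact
  note [simp] = gs_hom_dims[OF \<phi>] gs_hom_dims[OF \<psi>] gs_hom_dims[OF \<chi>(1)] gs_hom_dims[OF \<chi>'(1)]
    gs_hom_dims[OF \<theta>(1)] gs_hom_dims[OF \<theta>'(1)]
  have "\<chi> * \<chi>' = gs_id (P' m)"
  proof (rule closed_emb_cancel[OF D'.\<iota>_emb])
    show "\<chi> * \<chi>' \<in> gs_hom (P' m) (P' m)" by (rule hom_comp[OF _ _ _ \<chi>(1) \<chi>'(1)]) simp_all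
    have "\<chi> * \<chi>' * \<iota>' m = \<iota>' m * (\<phi> * \<psi>)" by (simp add: mat_assoc \<chi>'(2) mult_pull[OF \<chi>(2)])
    thus "\<chi> * \<chi>' * \<iota>' m = gs_id (P' m) * \<iota>' m" by (simp add: inv gs_id_def)
  qed (rule gs_id_hom; simp)
  hence \<chi>\<chi>: "\<chi> * (\<chi>' * e' m) = e' m" by (simp add: mat_assoc[symmetric] gs_id_def)
  show ?thesis
  proof (rule quotient_map_cancel[OF D'.e_quot])
    show "\<theta> * \<theta>' \<in> gs_hom (E' m) (E' m)" by (rule hom_comp[OF _ _ _ \<theta>(1) \<theta>'(1)]) simp_all
    have "e' m * (\<theta> * \<theta>') = \<chi> * (\<chi>' * e' m)" by (simp add: mult_pull[OF \<theta>(2)] mat_assoc \<theta>'(2))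
    thus "e' m * (\<theta> * \<theta>') = e' m * gs_id (E' m)" unfolding \<chi>\<chi> by (simp add: gs_id_def)
  qed (rule gs_id_hom; simp)
qed

lemma restrict_to_p_torsion:
  assumes "pdivisible p D h" "pdivisible p D' h'"
    and \<phi>: "\<phi> \<in> gs_hom (torsion D' (Suc m)) (torsion D (Suc m))"
  obtains \<phi>1 where "\<phi>1 \<in> gs_hom (torsion D' (Suc 0)) (torsion D (Suc 0))"
    "\<phi>1 * incl_iter D (Suc 0) m = incl_iter D' (Suc 0) m * \<phi>"
proof -
  interpret D: pdivisible p D h by fact
  interpret D': pdivisible p D' h' by fact
  note [simp] = D.T_scheme D'.T_scheme gs_hom_dims[OF \<phi>] gs_hom_dims[OF D'.ii1_hom] times_dims
  have i\<phi>: "D'.ii (Suc 0) m * \<phi> \<in> gs_hom (D'.T (Suc 0)) (D.T (Suc m))" by (rule hom_comp[OF _ _ _ D'.ii1_hom \<phi>]) simp_all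
  have "D'.ii (Suc 0) m * \<phi> * gs_times (D.T (Suc m)) p = gs_times (D'.T (Suc 0)) p * (D'.ii (Suc 0) m * \<phi>)"
    by (rule times_natural[OF _ _ i\<phi>]) simp_all
  also have "\<dots> = gs_zero (D'.T (Suc 0)) (D.T (Suc m))"
    using D'.T_killed[of "Suc 0" 1] zero_left[OF _ _ i\<phi>, of "D'.T (Suc 0)"] by simp
  finally have "\<exists>\<phi>1 \<in> gs_hom (D'.T (Suc 0)) (D.T (Suc 0)). \<phi>1 * D.ii (Suc 0) m = D'.ii (Suc 0) m * \<phi>"
    using is_kernelD(4)[OF D.ii_kernel[of "Suc 0" m] D'.T_scheme, of "D'.ii (Suc 0) m * \<phi>"] i\<phi> by simp
  thus thesis using that by blast
qed

text \<open>The condition minimised by \<open>isogeny_cutoff\<close>, isolated so that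
  \<open>D\<close> and \<open>E\<close> can be compared level by level before minima are
  taken.\<close>

definition determines_isogeny_class :: "nat \<Rightarrow> 'k :: field pdiv \<Rightarrow> nat \<Rightarrow> bool" where
  "determines_isogeny_class p D m \<longleftrightarrow>
     (\<forall>D'. p_divisible_group p D' \<and> torsion D' m \<cong>\<^sub>g torsion D m \<longrightarrow> isogenous D' D)"

text \<open>Returns an isogeny back from \<open>E\<close> meeting the same hypotheses:
  \<open>C\<close> is a quotient of \<open>D[p]\<close> and hence killed by \<open>p\<close>. This
  symmetry supplies both inequalities.\<close>

lemma dual_isogeny_exists:
  fixes D E :: "'k :: alg_closed_field pdiv"
  assumes "pdivisible p D h" "pdivisible p E h'" and iso: "isogeny D E g"
    and fk: "finite_kernel D E g K n \<kappa>" and K0: "gs_times K p = gs_zero K K"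
  obtains \<kappa>1 C c j P \<iota> k q b \<mu> where
    "quotient_data p D h K \<kappa>1 C c j P \<iota> k (torsion E) q"
    "isogeny E D b" "finite_kernel E D b C (Suc 0) \<mu>" "gs_times C p = gs_zero C C"
proof -
  interpret D: pdivisible p D h by fact
  interpret E: pdivisible p E h' by fact
  have g: "g \<in> pdiv_hom D E" and surj: "pdiv_surj D E g" using iso by (auto simp: isogeny_def)
  obtain \<kappa>1 where \<kappa>1: "finite_kernel D E g K (Suc 0) \<kappa>1"
    by (rule finite_kernel_level_1[OF assms(1,2) g fk K0])
  have "is_kernel K (D.ii (Suc 0) 0 \<circ>\<^sub>g \<kappa>1) (D.T (Suc 0 + 0)) (E.T (Suc 0 + 0)) (g (Suc 0 + 0))"
    using \<kappa>1 unfolding finite_kernel_def by blast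
  moreover have "\<kappa>1 \<in> gs_hom K (D.T (Suc 0))" using \<kappa>1 by (simp add: finite_kernel_def)
  ultimately have ker: "is_kernel K \<kappa>1 (D.T (Suc 0)) (E.T (Suc 0)) (g (Suc 0))"
    by (simp add: gs_comp_def gs_id_comp(2))
  have emb: "closed_emb K (D.T (Suc 0)) \<kappa>1"
    by (rule kernel_closed_emb[OF ker D.T_scheme E.T_scheme pdiv_homD(1)[OF g]])
  obtain C c j P \<iota> k where S: "subgroup_data p D h K \<kappa>1 C c j P \<iota> k"
    by (rule D.subgroup_data_exists[OF is_kernelD(1)[OF ker] emb])
  interpret S: subgroup_data p D h K \<kappa>1 C c j P \<iota> k by (rule S)
  obtain q where q: "quotient_data p D h K \<kappa>1 C c j P \<iota> k (torsion E) q" "\<And>n. q n * incl E n = \<iota> n * g (Suc n)"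
    by (rule S.isogeny_quotient[OF assms(2) g surj \<kappa>1]) blast
  obtain b \<mu> where b: "isogeny E D b" "finite_kernel E D b C (Suc 0) \<mu>"
    by (rule S.dual_isogeny[OF assms(2) g q \<kappa>1])
  have "gs_times C p = gs_zero C C"
  proof (rule killed_of_quotient[OF D.T_scheme S.C_scheme S.c_quot])
    show "c * gs_times C p = gs_zero (D.T (Suc 0)) C"
      using times_natural[OF D.T_scheme S.C_scheme S.c_hom, of p] D.T_killed[of "Suc 0" 1]
        zero_left[OF D.T_scheme D.T_scheme S.c_hom, of "Suc 0"] by simp
  qed
  thus thesis using that q(1) b by blast
qed

lemma determines_isogeny_class_step:
  fixes D E :: "'k :: alg_closed_field pdiv"
  assumes "p_divisible_group p D" "p_divisible_group p E" and iso: "isogeny D E g"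
    and fk: "finite_kernel D E g K n \<kappa>" and K0: "gs_times K p = gs_zero K K"
    and E: "determines_isogeny_class p E m"
  shows "determines_isogeny_class p D (Suc m)"
  unfolding determines_isogeny_class_def
proof (intro allI impI)
  fix D' assume "p_divisible_group p D' \<and> torsion D' (Suc m) \<cong>\<^sub>g torsion D (Suc m)"
  hence D': "p_divisible_group p D'" and iso': "torsion D' (Suc m) \<cong>\<^sub>g torsion D (Suc m)" by auto
  obtain h h' h'' where pd: "pdivisible p D h" "pdivisible p E h'" "pdivisible p D' h''"
    using assms(1,2) D' pdivisible_iff by blast
  interpret D: pdivisible p D h by fact
  interpret D': pdivisible p D' h'' by fact
  obtain \<kappa>1 C c j P \<iota> k q b \<mu> where Q: "quotient_data p D h K \<kappa>1 C c j P \<iota> k (torsion E) q" and b: "isogeny E D b"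
    by (rule dual_isogeny_exists[OF pd(1,2) iso fk K0])
  interpret Q: quotient_data p D h K \<kappa>1 C c j P \<iota> k "torsion E" q by (rule Q)
  obtain \<phi> \<psi> where \<phi>: "\<phi> \<in> gs_hom (D'.T (Suc m)) (D.T (Suc m))" and \<psi>: "\<psi> \<in> gs_hom (D.T (Suc m)) (D'.T (Suc m))"
    and inv: "\<phi> * \<psi> = gs_id (D'.T (Suc m))" "\<psi> * \<phi> = gs_id (D.T (Suc m))"
    using iso' unfolding gs_isomorphic_def gs_comp_def by blast
  obtain \<phi>1 where \<phi>1: "\<phi>1 \<in> gs_hom (D'.T (Suc 0)) (D.T (Suc 0))" "\<phi>1 * D.ii (Suc 0) m = D'.ii (Suc 0) m * \<phi>"
    by (rule restrict_to_p_torsion[OF pd(1,3) \<phi>])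
  obtain \<psi>1 where \<psi>1: "\<psi>1 \<in> gs_hom (D.T (Suc 0)) (D'.T (Suc 0))" "\<psi>1 * D'.ii (Suc 0) m = D.ii (Suc 0) m * \<psi>"
    by (rule restrict_to_p_torsion[OF pd(3,1) \<psi>])
  note [simp] = D.T_scheme D'.T_scheme gs_hom_dims[OF \<phi>] gs_hom_dims[OF \<psi>] gs_hom_dims[OF \<phi>1(1)] gs_hom_dims[OF \<psi>1(1)]
    gs_hom_dims[OF D.ii1_hom] gs_hom_dims[OF D'.ii1_hom]
  have \<psi>\<phi>: "\<psi>1 * \<phi>1 = gs_id (D.T (Suc 0))"
  proof (rule closed_emb_cancel[OF D.ii1_emb[of m]])
    show "\<psi>1 * \<phi>1 \<in> gs_hom (D.T (Suc 0)) (D.T (Suc 0))" by (rule hom_comp[OF _ _ _ \<psi>1(1) \<phi>1(1)]) simp_all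
    have "\<psi>1 * \<phi>1 * D.ii (Suc 0) m = D.ii (Suc 0) m * (\<psi> * \<phi>)" by (simp add: mat_assoc \<phi>1(2) mult_pull[OF \<psi>1(2)])
    thus "\<psi>1 * \<phi>1 * D.ii (Suc 0) m = gs_id (D.T (Suc 0)) * D.ii (Suc 0) m" by (simp add: inv gs_id_def)
  qed (rule gs_id_hom; simp)
  have "closed_emb (D.T (Suc 0)) (D'.T (Suc 0)) \<psi>1"
    using \<psi>1(1) \<psi>\<phi> gs_homD(1)[OF \<phi>1(1)] by (auto simp: closed_emb_def gs_id_def)
  \<comment> \<open>\<open>K\<close> is carried into \<open>D'[p]\<close> by the restricted
    isomorphism, so \<open>\<psi>1\<close> matches the two embeddings by definition and
    \<open>\<phi>1\<close> by \<open>\<kappa>\<phi>\<close>.\<close>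
  hence emb: "closed_emb K (D'.T (Suc 0)) (\<kappa>1 * \<psi>1)"
    by (intro closed_emb_comp[OF _ _ _ Q.\<kappa>_emb]) simp_all
  have \<kappa>\<phi>: "\<kappa>1 * \<psi>1 * \<phi>1 = \<kappa>1" by (simp add: mat_assoc \<psi>\<phi>) (simp add: gs_id_def)
  obtain C' c' j' P' \<iota>' k' where S': "subgroup_data p D' h'' K (\<kappa>1 * \<psi>1) C' c' j' P' \<iota>' k'"
    by (rule D'.subgroup_data_exists[OF Q.K_scheme emb])
  obtain E' e' where Q': "quotient_data p D' h'' K (\<kappa>1 * \<psi>1) C' c' j' P' \<iota>' k' E' e'"
    by (rule subgroup_data.quotient_data_exists[OF S'])
  interpret Q': quotient_data p D' h'' K "\<kappa>1 * \<psi>1" C' c' j' P' \<iota>' k' E' e' by (rule Q')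
  obtain \<chi> \<theta> where \<chi>: "\<chi> \<in> gs_hom (P' m) (P m)" "\<chi> * \<iota> m = \<iota>' m * \<phi>"
    and \<theta>: "\<theta> \<in> gs_hom (E' m) (torsion E m)" "e' m * \<theta> = \<chi> * q m"
    by (rule quotient_level_map[OF Q Q' \<phi> \<phi>1 \<kappa>\<phi>])
  obtain \<chi>' \<theta>' where \<chi>': "\<chi>' \<in> gs_hom (P m) (P' m)" "\<chi>' * \<iota>' m = \<iota> m * \<psi>"
    and \<theta>': "\<theta>' \<in> gs_hom (torsion E m) (E' m)" "q m * \<theta>' = \<chi>' * e' m"
    by (rule quotient_level_map[OF Q' Q \<psi> \<psi>1 refl])
  have "\<theta> * \<theta>' = gs_id (E' m)" by (rule quotient_level_inverse[OF Q Q' \<phi> \<psi> inv(1) \<chi> \<theta> \<chi>' \<theta>'])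
  moreover have "\<theta>' * \<theta> = gs_id (torsion E m)" by (rule quotient_level_inverse[OF Q' Q \<psi> \<phi> inv(2) \<chi>' \<theta>' \<chi> \<theta>])
  ultimately have "torsion Q'.quotient_pdiv m \<cong>\<^sub>g torsion E m"
    using \<theta>(1) \<theta>'(1) by (auto simp: gs_isomorphic_def gs_comp_def)
  moreover have pE': "p_divisible_group p Q'.quotient_pdiv" using Q'.Q.pdivisible_axioms pdivisible_iff by blast
  ultimately have "isogenous Q'.quotient_pdiv E" using E unfolding determines_isogeny_class_def by blast
  moreover have "isogenous D' Q'.quotient_pdiv" using Q'.quotient_isogeny by (auto simp: isogenous_def)
  ultimately have "isogenous D' E" using isogenous_trans[OF D' pE' assms(2)] by blast
  moreover have "isogenous E D" using b by (auto simp: isogenous_def)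
  ultimately show "isogenous D' D" using isogenous_trans[OF D' assms(2,1)] by blast
qed

theorem lemma6p3:
  fixes p :: nat
    and D E :: "'k::alg_closed_field pdiv"
    and g :: "nat \<Rightarrow> 'k mat"
    and K :: "'k hopf" and n :: nat and \<kappa> :: "'k mat"
  assumes "CHAR('k) = p" and "p > 0"
    and "p_divisible_group p D" and "p_divisible_group p E"
    and "isogeny D E g"
    and "finite_kernel D E g K n \<kappa>"
    and "gs_times K p = gs_zero K K"
  shows "\<bar>int (isogeny_cutoff p D) - int (isogeny_cutoff p E)\<bar> \<le> 1"
proof -
  let ?d = "determines_isogeny_class p D" and ?e = "determines_isogeny_class p E"
  have cut: "isogeny_cutoff p D = (LEAST m. ?d m)" "isogeny_cutoff p E = (LEAST m. ?e m)"
    by (simp_all add: isogeny_cutoff_def determines_isogeny_class_def)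
  obtain h h' where pd: "pdivisible p D h" "pdivisible p E h'" using assms(3,4) pdivisible_iff by blast
  obtain C b \<mu> where b: "isogeny E D b" "finite_kernel E D b C (Suc 0) \<mu>" "gs_times C p = gs_zero C C"
    by (rule dual_isogeny_exists[OF pd assms(5-7)])
  have ed: "?e m \<Longrightarrow> ?d (Suc m)" for m by (rule determines_isogeny_class_step[OF assms(3-7)])
  \<comment> \<open>The same step with the roles exchanged, applied to the dual isogeny and its
    kernel \<open>C\<close>.\<close>
  have de: "?d m \<Longrightarrow> ?e (Suc m)" for m by (rule determines_isogeny_class_step[OF assms(4,3) b])
  show ?thesis
  proof (cases "\<exists>m. ?d m")
    case True
    then obtain m where "?d m" by blast
    hence d: "?d (LEAST m. ?d m)" and e: "?e (LEAST m. ?e m)" using de by (blast intro: LeastI)+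
    have "(LEAST m. ?d m) \<le> Suc (LEAST m. ?e m)" "(LEAST m. ?e m) \<le> Suc (LEAST m. ?d m)"
      using ed[OF e] de[OF d] by (auto intro: Least_le)
    thus ?thesis unfolding cut by linarith
  next
    case False
    \<comment> \<open>No such \<open>m\<close> exists on either side, and both cutoffs are the same junk value.\<close>
    hence "?d = (\<lambda>_. False)" "?e = (\<lambda>_. False)" using ed by blast+
    thus ?thesis unfolding cut by simp
  qed
qed

end
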